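(* Let $X:V\to W$ be a centered stationary Gaussian field with continuous non-degenerate covariance function $\Omega$ and spectral measure $\mu$, let $\eta$ be the law of $X(0)$, let $f\in L^2(\eta)$ with chaotic coefficients $(f_q)_{q\ge0}$, and let $\phi$ be a test function. Let $q\ge1$ and let $p$ be the conjugate exponent of $q$ ($1/p+1/q=1$). Assume that $\mu$ has a density $\Sigma$ with respect to the Lebesgue measure on $V^*$, with $\Sigma\in L^p(V^* )$ if $q\ge2$ and $\Sigma\in C_0(V^* )$ if $q=1$. Then $$\lim_{\lambda\to+\infty}\operatorname{Var}\big(Z^{(q)}_\lambda(\phi)\big)=\frac1{q!}\int_{\xi_1+\cdots+\xi_q=0}\Big(\bigotimes_{k=1}^q\Sigma(\xi_k)\Big)(f_q)\,\mathrm d\xi .$$ For $q=1$ this reads $\lim_{\lambda\to+\infty}\operatorname{Var}(Z^{(1)}_\lambda(\phi))=\Sigma(0)(f_1)$. For $q=2$ it reads, in matrix form, $$\lim_{\lambda\to+\infty}\operatorname{Var}\big(Z^{(2)}_\lambda(\phi)\big)=\frac12\int_{V^*}\operatorname{Tr}\big(\Sigma(\xi)f_2\Sigma(\xi)f_2\big)\,\mathrm d\xi .$$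
   Context: $V,W$ are finite-dimensional real vector spaces of dimensions $d,n$; $V$ carries a Euclidean norm and its Lebesgue measure, $V^*$ the dual norm and Lebesgue measure. $X:V\to W$ is a (measurable) centered stationary Gaussian field whose covariance $\Omega(v)(\ell,m)=\mathbb E[\ell(X(v))\,m(X(0))]$, $\ell,m\in W^*$, is continuous in $v$, with $\Omega(0)$ positive definite. Hermite expansion: $\Omega(0)$ is a scalar product on $W^*$; it is transported by duality to $W$, and to $(W^* )^{\otimes q}$ by $\langle \ell_1\otimes\cdots\otimes\ell_q,m_1\otimes\cdots\otimes m_q\rangle=\prod_k\langle\ell_k,m_k\rangle$. For $x\in W$, $H^q_x=(-1)^q e^{\|x\|^2/2}D^q_x\big[e^{-\|\cdot\|^2/2}\big]$ is a symmetric $q$-linear form on $W$. For $f\in L^2(\eta)$ set $f_q=\int_W f(x)H^q_x\,\mathrm d\eta(x)$ and $\pi_q(f)(x)=\frac1{q!}\langle f_q,H^q_x\rangle$. Set $Z^{(q)}_\lambda(\phi)=\lambda^{-d/2}\int_V\phi(v/\lambda)\,\pi_q(f)(X(v))\,\mathrm dv$. Test functions: with $\hat\phi(\xi)=\int_V\phi(v)e^{-2i\pi\xi(v)}\mathrm dv$, $\gamma=|\hat\phi|^2$ and $\gamma^+(x)=\sup_{\|y\|\ge\|x\|}\gamma(y)$, a test function is a real-valued $\phi\in L^1\cap L^2(V)$ with $\|\phi\|_2=1$ and $\gamma^+\in L^1(V^* )$. Spectral measure: with $W_{\mathbb C}$ the complexification of $W$, $\mu$ is the measure on $V^*$ with values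 in positive semi-definite Hermitian forms on $W_{\mathbb C}^*$ such that $\Omega(v)=\int_{V^*}e^{2i\pi\xi(v)}\mathrm d\mu(\xi)$. The density $\Sigma(\xi)$ is thus a positive semi-definite Hermitian form on $W_{\mathbb C}^*$. $\bigotimes_k\Sigma(\xi_k)$ is the Hermitian form on $(W_{\mathbb C}^* )^{\otimes q}$ with $\bigotimes_k\Sigma(\xi_k)(\ell_1\otimes\cdots\otimes\ell_q,m_1\otimes\cdots\otimes m_q)=\prod_k\Sigma(\xi_k)(\ell_k,m_k)$, and a Hermitian form evaluated at one vector $g$ means its value at $(g,g)$. The measure $\mathrm d\xi$ on $\{\xi_1+\cdots+\xi_q=0\}$ is the Lebesgue measure $\mathrm d\xi_1\cdots\mathrm d\xi_{q-1}$ (with $\xi_q=-\xi_1-\cdots-\xi_{q-1}$). In the matrix form for $q=2$, $\Sigma(\xi)$ and $f_2$ are the Hermitian and real symmetric matrices representing these forms in a fixed basis of $W$ and its dual basis. *)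

theory Defs
  imports "HOL-Probability.Probability" "Jordan_Normal_Form.Matrix"
begin

no_notation scalar_prod (infix "\<bullet>" 70)

text \<open>
  The space \<open>V\<close> is a type \<open>'v\<close> of class \<open>euclidean_space\<close>, with its norm and Lebesgue measure
  \<open>lborel\<close>.  Its dual \<open>V\<^sup>*\<close>, with dual norm and dual Lebesgue measure, is identified with \<open>'v\<close> by
  the Riesz isometry: \<open>\<xi>\<close> acts as \<open>v \<mapsto> \<xi> \<bullet> v\<close>.

  The space \<open>W\<close> is a type \<open>'w\<close> of class \<open>euclidean_space\<close>, whose inner product serves only as a
  source of coordinates (the functionals \<open>\<lambda>x. x \<bullet> b\<close> for \<open>b \<in> Basis\<close> form the basis of \<open>W\<^sup>*\<close> dual to
  \<open>Basis\<close>).  The relevant scalar product on \<open>W\<close> is the one dual to \<open>\<Omega>(0)\<close>, defined below.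
  Elements of \<open>W\<^sup>*\<close> are linear functions \<open>'w \<Rightarrow> real\<close>.  Elements of \<open>W\<^sub>\<complex>\<^sup>*\<close> are real-linear functions
  \<open>'w \<Rightarrow> complex\<close>: a complex-linear functional on the complexification of \<open>W\<close> is determined by its
  restriction to \<open>W\<close>.  An element of the \<open>q\<close>-th tensor power of \<open>W\<^sup>*\<close>, i.e. a \<open>q\<close>-linear form on \<open>W\<close>,
  is a function on lists over \<open>'w\<close>, of which only the values on lists of length \<open>q\<close> matter.
\<close>


subsection \<open>Gaussian fields\<close>

text \<open>Degenerate (almost surely constant) variables count as Gaussian.\<close>

definition gaussian_rv :: "'o measure \<Rightarrow> ('o \<Rightarrow> real) \<Rightarrow> bool" where
  "gaussian_rv M Y \<longleftrightarrow>
     (\<exists>m s. 0 < s \<and> distributed M lborel Y (\<lambda>x. ennreal (normal_density m s x))) \<or>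
     (Y \<in> borel_measurable M \<and> (\<exists>c. AE \<omega> in M. Y \<omega> = c))"

definition gaussian_field ::
    "'o measure \<Rightarrow> ('v::euclidean_space \<Rightarrow> 'o \<Rightarrow> 'w::euclidean_space) \<Rightarrow> bool" where
  "gaussian_field M X \<longleftrightarrow>
     (\<lambda>(v, \<omega>). X v \<omega>) \<in> borel_measurable (borel \<Otimes>\<^sub>M M) \<and>
     (\<forall>I l. finite I \<longrightarrow> (\<forall>v\<in>I. linear (l v :: 'w \<Rightarrow> real)) \<longrightarrow>
        gaussian_rv M (\<lambda>\<omega>. \<Sum>v\<in>I. l v (X v \<omega>)))"

definition centered_field ::
    "'o measure \<Rightarrow> ('v \<Rightarrow> 'o \<Rightarrow> 'w::euclidean_space) \<Rightarrow> bool" where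
  "centered_field M X \<longleftrightarrow> (\<forall>v. integrable M (X v) \<and> (\<integral>\<omega>. X v \<omega> \<partial>M) = 0)"

definition stationary_field ::
    "'o measure \<Rightarrow> ('v::euclidean_space \<Rightarrow> 'o \<Rightarrow> 'w::euclidean_space) \<Rightarrow> bool" where
  "stationary_field M X \<longleftrightarrow>
     (\<forall>I h. finite I \<longrightarrow>
        distr M (Pi\<^sub>M I (\<lambda>_. borel)) (\<lambda>\<omega>. \<lambda>v\<in>I. X (v + h) \<omega>) =
        distr M (Pi\<^sub>M I (\<lambda>_. borel)) (\<lambda>\<omega>. \<lambda>v\<in>I. X v \<omega>))"

definition covariance ::
    "'o measure \<Rightarrow> ('v::euclidean_space \<Rightarrow> 'o \<Rightarrow> 'w::euclidean_space) \<Rightarrow>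
     'v \<Rightarrow> ('w \<Rightarrow> real) \<Rightarrow> ('w \<Rightarrow> real) \<Rightarrow> real" where
  "covariance M X v l m = (\<integral>\<omega>. l (X v \<omega>) * m (X 0 \<omega>) \<partial>M)"

definition continuous_form ::
    "('v::euclidean_space \<Rightarrow> ('w::euclidean_space \<Rightarrow> real) \<Rightarrow> ('w \<Rightarrow> real) \<Rightarrow> real) \<Rightarrow> bool" where
  "continuous_form \<Omega> \<longleftrightarrow>
     (\<forall>l m. linear l \<longrightarrow> linear m \<longrightarrow> continuous_on UNIV (\<lambda>v. \<Omega> v l m))"

definition positive_definite_form ::
    "(('w::euclidean_space \<Rightarrow> real) \<Rightarrow> ('w \<Rightarrow> real) \<Rightarrow> real) \<Rightarrow> bool" where
  "positive_definite_form B \<longleftrightarrow> (\<forall>l. linear l \<longrightarrow> l \<noteq> (\<lambda>_. 0) \<longrightarrow> 0 < B l l)"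


subsection \<open>Tensor products of forms\<close>

definition multi_indices :: "nat \<Rightarrow> 'w::euclidean_space list set" where
  "multi_indices q = {bs. set bs \<subseteq> Basis \<and> length bs = q}"

definition complexify :: "('w \<Rightarrow> real) \<Rightarrow> 'w \<Rightarrow> complex" where
  "complexify l = (\<lambda>x. complex_of_real (l x))"

text \<open>
  The scalar product on the \<open>q\<close>-th tensor power of \<open>W\<^sup>*\<close> induced by a scalar product \<open>B\<close> on \<open>W\<^sup>*\<close>:
  the arguments are expanded in the basis of pure tensors of coordinate functionals.
\<close>

definition tensor_inner ::
    "(('w::euclidean_space \<Rightarrow> real) \<Rightarrow> ('w \<Rightarrow> real) \<Rightarrow> real) \<Rightarrow> nat \<Rightarrow>
     ('w list \<Rightarrow> real) \<Rightarrow> ('w list \<Rightarrow> real) \<Rightarrow> real" where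
  "tensor_inner B q g h =
     (\<Sum>bs\<in>multi_indices q. \<Sum>cs\<in>multi_indices q.
        g bs * h cs * (\<Prod>k<q. B (\<lambda>x. x \<bullet> bs ! k) (\<lambda>x. x \<bullet> cs ! k)))"

text \<open>
  The Hermitian form \<open>S 0 \<otimes> \<dots> \<otimes> S (q - 1)\<close> on the \<open>q\<close>-th tensor power of \<open>W\<^sub>\<complex>\<^sup>*\<close>; see
  \<open>tensor_hermitian_pure\<close> for its values on pure tensors.
\<close>

definition tensor_hermitian ::
    "(nat \<Rightarrow> ('w::euclidean_space \<Rightarrow> complex) \<Rightarrow> ('w \<Rightarrow> complex) \<Rightarrow> complex) \<Rightarrow> nat \<Rightarrow>
     ('w list \<Rightarrow> complex) \<Rightarrow> ('w list \<Rightarrow> complex) \<Rightarrow> complex" where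
  "tensor_hermitian S q g h =
     (\<Sum>bs\<in>multi_indices q. \<Sum>cs\<in>multi_indices q.
        g bs * cnj (h cs) *
        (\<Prod>k<q. S k (complexify (\<lambda>x. x \<bullet> bs ! k)) (complexify (\<lambda>x. x \<bullet> cs ! k))))"

text \<open>Sesquilinear forms are linear in the first argument and antilinear in the second.\<close>

definition hermitian_form ::
    "(('w::euclidean_space \<Rightarrow> complex) \<Rightarrow> ('w \<Rightarrow> complex) \<Rightarrow> complex) \<Rightarrow> bool" where
  "hermitian_form B \<longleftrightarrow>
     (\<forall>l l' m. linear l \<longrightarrow> linear l' \<longrightarrow> linear m \<longrightarrow> B (\<lambda>x. l x + l' x) m = B l m + B l' m) \<and>
     (\<forall>c l m. linear l \<longrightarrow> linear m \<longrightarrow> B (\<lambda>x. c * l x) m = c * B l m) \<and>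
     (\<forall>l m. linear l \<longrightarrow> linear m \<longrightarrow> B m l = cnj (B l m))"

definition psd_hermitian_form ::
    "(('w::euclidean_space \<Rightarrow> complex) \<Rightarrow> ('w \<Rightarrow> complex) \<Rightarrow> complex) \<Rightarrow> bool" where
  "psd_hermitian_form B \<longleftrightarrow> hermitian_form B \<and> (\<forall>l. linear l \<longrightarrow> 0 \<le> Re (B l l))"

lemma sum_multi_indices_prod:
  fixes F :: "nat \<Rightarrow> 'w::euclidean_space \<Rightarrow> 'a::comm_semiring_1"
  shows "(\<Sum>bs\<in>multi_indices q. \<Prod>k<q. F k (bs ! k)) = (\<Prod>k<q. \<Sum>b\<in>Basis. F k b)"
proof (induction q arbitrary: F)
  case 0
  have "multi_indices 0 = {[] :: 'w list}" by (auto simp: multi_indices_def)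
  then show ?case by simp
next
  case (Suc q)
  have image: "(multi_indices (Suc q) :: 'w list set) = (\<lambda>(b, bs). b # bs) ` (Basis \<times> multi_indices q)"
  proof (intro Set.set_eqI iffI)
    fix bs :: "'w list" assume "bs \<in> multi_indices (Suc q)"
    then show "bs \<in> (\<lambda>(b, bs). b # bs) ` (Basis \<times> multi_indices q)"
      by (cases bs) (auto simp: multi_indices_def)
  qed (auto simp: multi_indices_def)
  have inj: "inj_on (\<lambda>(b, bs). b # bs) (Basis \<times> (multi_indices q :: 'w list set))"
    by (auto simp: inj_on_def)
  have "(\<Sum>bs\<in>multi_indices (Suc q). \<Prod>k<Suc q. F k (bs ! k)) =
        (\<Sum>b\<in>Basis. \<Sum>bs\<in>multi_indices q. F 0 b * (\<Prod>k<q. F (Suc k) (bs ! k)))"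
    unfolding image sum.reindex[OF inj]
    by (simp add: sum.cartesian_product prod.lessThan_Suc_shift case_prod_unfold
        del: prod.lessThan_Suc)
  also have "\<dots> = (\<Sum>b\<in>Basis. F 0 b) * (\<Sum>bs\<in>multi_indices q. \<Prod>k<q. F (Suc k) (bs ! k))"
    by (simp add: sum_product)
  also have "\<dots> = (\<Prod>k<Suc q. \<Sum>b\<in>Basis. F k b)"
    by (simp only: Suc.IH[of "\<lambda>k. F (Suc k)"] prod.lessThan_Suc_shift o_def)
  finally show ?case .
qed

lemma hermitian_form_sum_left:
  assumes "hermitian_form B" "linear m" "finite I" "\<And>i. i \<in> I \<Longrightarrow> linear (l i)"
  shows "B (\<lambda>x. \<Sum>i\<in>I. c i * l i x) m = (\<Sum>i\<in>I. c i * B (l i) m)"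
proof -
  have add: "B (\<lambda>x. k x + k' x) m = B k m + B k' m" if "linear k" "linear k'" for k k'
    by (rule assms(1)[unfolded hermitian_form_def, THEN conjunct1, rule_format, OF that assms(2)])
  have mult: "B (\<lambda>x. a * k x) m = a * B k m" if "linear k" for a k
    by (rule assms(1)[unfolded hermitian_form_def, THEN conjunct2, THEN conjunct1, rule_format,
          OF that assms(2)])
  have lin: "linear (\<lambda>x. a * k x)" if "linear k" for a :: complex and k :: "'a \<Rightarrow> complex"
    using linear_compose[OF that bounded_linear.linear[OF bounded_linear_mult_right[of a]]]
    by (simp add: o_def)
  show ?thesis
    using assms(3,4)
  proof (induction rule: finite_induct)
    case empty
    show ?case using mult[OF linear_zero, of 0] by simp
  next
    case (insert i I)
    have "linear (\<lambda>x. \<Sum>i\<in>I. c i * l i x)"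
      by (rule linear_compose_sum) (intro ballI lin insert.prems insertI2)
    from add[OF lin[OF insert.prems[OF insertI1]] this] mult[OF insert.prems[OF insertI1]]
    show ?case
      using insert.hyps insert.IH[OF insert.prems[OF insertI2]] by simp
  qed
qed

lemma linear_complexify: "linear l \<Longrightarrow> linear (complexify l)"
  unfolding complexify_def using linear_compose[OF _ bounded_linear.linear[OF bounded_linear_of_real]]
  by (simp add: o_def)

lemma linear_coordinate: "linear (\<lambda>x::'w::euclidean_space. x \<bullet> b)"
  by (simp add: bounded_linear.linear bounded_linear_inner_left)

lemma linear_coordinate_expansion:
  fixes l :: "'w::euclidean_space \<Rightarrow> complex"
  assumes "linear l"
  shows "l = (\<lambda>x. \<Sum>b\<in>Basis. l b * complexify (\<lambda>x. x \<bullet> b) x)"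
proof
  fix x
  have "l x = l (\<Sum>b\<in>Basis. (x \<bullet> b) *\<^sub>R b)" by (simp add: euclidean_representation)
  also have "\<dots> = (\<Sum>b\<in>Basis. (x \<bullet> b) *\<^sub>R l b)"
    by (simp add: linear_sum[OF assms] linear_scale[OF assms])
  finally show "l x = (\<Sum>b\<in>Basis. l b * complexify (\<lambda>x. x \<bullet> b) x)"
    by (simp add: complexify_def scaleR_conv_of_real mult.commute)
qed

lemma hermitian_form_coordinates:
  assumes B: "hermitian_form B" and l: "linear l" and m: "linear m"
  shows "B l m = (\<Sum>b\<in>Basis. \<Sum>c\<in>Basis.
    l b * cnj (m c) * B (complexify (\<lambda>x. x \<bullet> b)) (complexify (\<lambda>x. x \<bullet> c)))"
proof -
  let ?e = "\<lambda>b::'a. complexify (\<lambda>x. x \<bullet> b)"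
  have e: "linear (?e b)" for b
    by (intro linear_complexify linear_coordinate)
  have left: "B k n = (\<Sum>b\<in>Basis. k b * B (?e b) n)" if "linear k" "linear n" for k n
    by (subst linear_coordinate_expansion[OF that(1)])
       (rule hermitian_form_sum_left[OF B that(2) finite_Basis e])
  have sym: "B k n = cnj (B n k)" if "linear k" "linear n" for k n
    by (rule B[unfolded hermitian_form_def, THEN conjunct2, THEN conjunct2, rule_format,
          OF that(2,1)])
  have right: "B (?e b) m = (\<Sum>c\<in>Basis. cnj (m c) * B (?e b) (?e c))" for b
  proof -
    have "B (?e b) m = cnj (\<Sum>c\<in>Basis. m c * B (?e c) (?e b))"
      using sym[OF e m] left[OF m e] by simp
    also have "\<dots> = (\<Sum>c\<in>Basis. cnj (m c) * B (?e b) (?e c))"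
      by (simp add: sym[OF e e, symmetric])
    finally show ?thesis .
  qed
  show ?thesis
    by (subst left[OF l m], subst right) (simp add: sum_distrib_left mult.assoc)
qed

lemma tensor_hermitian_pure:
  assumes "\<And>k. k < q \<Longrightarrow> hermitian_form (S k)"
    and "\<And>k. k < q \<Longrightarrow> linear (l k)" and "\<And>k. k < q \<Longrightarrow> linear (m k)"
  shows "tensor_hermitian S q (\<lambda>ws. \<Prod>k<q. l k (ws ! k)) (\<lambda>ws. \<Prod>k<q. m k (ws ! k)) =
         (\<Prod>k<q. S k (l k) (m k))"
proof -
  let ?T = "\<lambda>k b c. l k b * cnj (m k c) *
    S k (complexify (\<lambda>x. x \<bullet> b)) (complexify (\<lambda>x. x \<bullet> c))"
  have "tensor_hermitian S q (\<lambda>ws. \<Prod>k<q. l k (ws ! k)) (\<lambda>ws. \<Prod>k<q. m k (ws ! k)) =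
        (\<Sum>bs\<in>multi_indices q. \<Sum>cs\<in>multi_indices q. \<Prod>k<q. ?T k (bs ! k) (cs ! k))"
    unfolding tensor_hermitian_def prod.distrib cnj_prod ..
  also have "\<dots> = (\<Prod>k<q. \<Sum>b\<in>Basis. \<Sum>c\<in>Basis. ?T k b c)"
  proof -
    have "(\<Sum>cs\<in>multi_indices q. \<Prod>k<q. ?T k (bs ! k) (cs ! k)) =
          (\<Prod>k<q. \<Sum>c\<in>Basis. ?T k (bs ! k) c)" for bs
      by (rule sum_multi_indices_prod)
    then show ?thesis
      by (simp only:) (rule sum_multi_indices_prod)
  qed
  also have "\<dots> = (\<Prod>k<q. S k (l k) (m k))"
  proof (rule prod.cong[OF refl])
    fix k assume "k \<in> {..<q}"
    then have "k < q" by simp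
    from hermitian_form_coordinates[OF assms(1)[OF this] assms(2)[OF this] assms(3)[OF this]]
    show "(\<Sum>b\<in>Basis. \<Sum>c\<in>Basis. ?T k b c) = S k (l k) (m k)" by (rule sym)
  qed
  finally show ?thesis .
qed


subsection \<open>Hermite expansion\<close>

text \<open>
  The functional corresponding to \<open>x \<in> W\<close> under the isomorphism of \<open>W\<^sup>*\<close> onto \<open>W\<close> given by the
  scalar product \<open>B\<close> on \<open>W\<^sup>*\<close>, and the scalar product on \<open>W\<close> transported along it.
\<close>

definition dual_functional ::
    "(('w::euclidean_space \<Rightarrow> real) \<Rightarrow> ('w \<Rightarrow> real) \<Rightarrow> real) \<Rightarrow> 'w \<Rightarrow> 'w \<Rightarrow> real" where
  "dual_functional B x = (THE l. linear l \<and> (\<forall>m. linear m \<longrightarrow> B l m = m x))"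

definition dual_inner ::
    "(('w::euclidean_space \<Rightarrow> real) \<Rightarrow> ('w \<Rightarrow> real) \<Rightarrow> real) \<Rightarrow> 'w \<Rightarrow> 'w \<Rightarrow> real" where
  "dual_inner B x y = B (dual_functional B x) (dual_functional B y)"

text \<open>\<open>iter_deriv g [w\<^sub>1, \<dots>, w\<^sub>q] x\<close> is \<open>D\<^sup>q\<^sub>x g (w\<^sub>1, \<dots>, w\<^sub>q)\<close> for smooth \<open>g\<close>.\<close>

fun iter_deriv :: "('w::euclidean_space \<Rightarrow> real) \<Rightarrow> 'w list \<Rightarrow> 'w \<Rightarrow> real" where
  "iter_deriv g [] x = g x"
| "iter_deriv g (w # ws) x = frechet_derivative (iter_deriv g ws) (at x) w"

definition hermite_form ::
    "(('w::euclidean_space \<Rightarrow> real) \<Rightarrow> ('w \<Rightarrow> real) \<Rightarrow> real) \<Rightarrow> 'w \<Rightarrow> 'w list \<Rightarrow> real" where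
  "hermite_form B x ws =
     (-1) ^ length ws * exp (dual_inner B x x / 2) *
     iter_deriv (\<lambda>y. exp (- (dual_inner B y y / 2))) ws x"

definition L2_function :: "'w::euclidean_space measure \<Rightarrow> ('w \<Rightarrow> real) \<Rightarrow> bool" where
  "L2_function \<eta> f \<longleftrightarrow> f \<in> borel_measurable \<eta> \<and> integrable \<eta> (\<lambda>x. (f x)\<^sup>2)"

text \<open>\<open>f\<^sub>q\<close> is the restriction of \<open>chaos_coeff B \<eta> f\<close> to lists of length \<open>q\<close>.\<close>

definition chaos_coeff ::
    "(('w::euclidean_space \<Rightarrow> real) \<Rightarrow> ('w \<Rightarrow> real) \<Rightarrow> real) \<Rightarrow> 'w measure \<Rightarrow> ('w \<Rightarrow> real) \<Rightarrow>
     'w list \<Rightarrow> real" where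
  "chaos_coeff B \<eta> f ws = (\<integral>x. f x * hermite_form B x ws \<partial>\<eta>)"

definition chaos_proj ::
    "(('w::euclidean_space \<Rightarrow> real) \<Rightarrow> ('w \<Rightarrow> real) \<Rightarrow> real) \<Rightarrow> 'w measure \<Rightarrow> ('w \<Rightarrow> real) \<Rightarrow>
     nat \<Rightarrow> 'w \<Rightarrow> real" where
  "chaos_proj B \<eta> f q x = 1 / fact q * tensor_inner B q (chaos_coeff B \<eta> f) (hermite_form B x)"

definition chaos_functional ::
    "'o measure \<Rightarrow> ('v::euclidean_space \<Rightarrow> 'o \<Rightarrow> 'w::euclidean_space) \<Rightarrow> ('w \<Rightarrow> real) \<Rightarrow> nat \<Rightarrow>
     ('v \<Rightarrow> real) \<Rightarrow> real \<Rightarrow> 'o \<Rightarrow> real" where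
  "chaos_functional M X f q \<phi> r \<omega> =
     r powr (- (real DIM('v) / 2)) *
     (\<integral>v. \<phi> (v /\<^sub>R r) *
        chaos_proj (covariance M X 0) (distr M borel (X 0)) f q (X v \<omega>) \<partial>lborel)"


subsection \<open>Test functions\<close>

definition fourier :: "('v::euclidean_space \<Rightarrow> real) \<Rightarrow> 'v \<Rightarrow> complex" where
  "fourier \<phi> \<xi> = (\<integral>v. complex_of_real (\<phi> v) * exp (- (2 * \<i> * pi * (\<xi> \<bullet> v))) \<partial>lborel)"

definition radial_sup :: "('v::euclidean_space \<Rightarrow> real) \<Rightarrow> 'v \<Rightarrow> real" where
  "radial_sup g x = (SUP y\<in>{y. norm x \<le> norm y}. g y)"

definition test_function :: "('v::euclidean_space \<Rightarrow> real) \<Rightarrow> bool" where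
  "test_function \<phi> \<longleftrightarrow>
     integrable lborel \<phi> \<and> integrable lborel (\<lambda>v. (\<phi> v)\<^sup>2) \<and> (\<integral>v. (\<phi> v)\<^sup>2 \<partial>lborel) = 1 \<and>
     integrable lborel (radial_sup (\<lambda>\<xi>. (norm (fourier \<phi> \<xi>))\<^sup>2))"


subsection \<open>Spectral measure\<close>

definition form_measure ::
    "('v::euclidean_space set \<Rightarrow> ('w::euclidean_space \<Rightarrow> complex) \<Rightarrow> ('w \<Rightarrow> complex) \<Rightarrow> complex) \<Rightarrow>
     bool" where
  "form_measure \<mu> \<longleftrightarrow>
     (\<forall>A\<in>sets borel. psd_hermitian_form (\<mu> A)) \<and>
     (\<forall>A :: nat \<Rightarrow> 'v set. range A \<subseteq> sets borel \<longrightarrow> disjoint_family A \<longrightarrow>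
        (\<forall>l m. linear l \<longrightarrow> linear m \<longrightarrow> (\<lambda>i. \<mu> (A i) l m) sums \<mu> (\<Union>i. A i) l m))"

definition diagonal_measure ::
    "('v::euclidean_space set \<Rightarrow> ('w::euclidean_space \<Rightarrow> complex) \<Rightarrow> ('w \<Rightarrow> complex) \<Rightarrow> complex) \<Rightarrow>
     ('w \<Rightarrow> complex) \<Rightarrow> 'v measure" where
  "diagonal_measure \<mu> l = measure_of UNIV (sets borel) (\<lambda>A. ennreal (Re (\<mu> A l l)))"

text \<open>
  The integral of \<open>g\<close> against the complex measure \<open>\<lambda>A. \<mu> A l m\<close>, written through finite positive
  measures by polarization.
\<close>

definition form_integral ::
    "('v::euclidean_space set \<Rightarrow> ('w::euclidean_space \<Rightarrow> complex) \<Rightarrow> ('w \<Rightarrow> complex) \<Rightarrow> complex) \<Rightarrow>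
     ('v \<Rightarrow> complex) \<Rightarrow> ('w \<Rightarrow> complex) \<Rightarrow> ('w \<Rightarrow> complex) \<Rightarrow> complex" where
  "form_integral \<mu> g l m =
     (1 / 4) * (\<Sum>k<4::nat. \<i> ^ k * (\<integral>\<xi>. g \<xi> \<partial>diagonal_measure \<mu> (\<lambda>x. l x + \<i> ^ k * m x)))"

text \<open>
  A Hermitian form is determined by its values at complexifications of elements of \<open>W\<^sup>*\<close>, so it is
  enough to test the identity of forms there.
\<close>

definition spectral_measure ::
    "('v::euclidean_space set \<Rightarrow> ('w::euclidean_space \<Rightarrow> complex) \<Rightarrow> ('w \<Rightarrow> complex) \<Rightarrow> complex) \<Rightarrow>
     ('v \<Rightarrow> ('w \<Rightarrow> real) \<Rightarrow> ('w \<Rightarrow> real) \<Rightarrow> real) \<Rightarrow> bool" where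
  "spectral_measure \<mu> \<Omega> \<longleftrightarrow>
     form_measure \<mu> \<and>
     (\<forall>v l m. linear l \<longrightarrow> linear m \<longrightarrow>
        complex_of_real (\<Omega> v l m) =
        form_integral \<mu> (\<lambda>\<xi>. exp (2 * \<i> * pi * (\<xi> \<bullet> v))) (complexify l) (complexify m))"

definition has_density ::
    "('v::euclidean_space set \<Rightarrow> ('w::euclidean_space \<Rightarrow> complex) \<Rightarrow> ('w \<Rightarrow> complex) \<Rightarrow> complex) \<Rightarrow>
     ('v \<Rightarrow> ('w \<Rightarrow> complex) \<Rightarrow> ('w \<Rightarrow> complex) \<Rightarrow> complex) \<Rightarrow> bool" where
  "has_density \<mu> \<Sigma> \<longleftrightarrow>
     (\<forall>\<xi>. psd_hermitian_form (\<Sigma> \<xi>)) \<and>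
     (\<forall>A\<in>sets borel. \<forall>l m. linear l \<longrightarrow> linear m \<longrightarrow>
        set_integrable lborel A (\<lambda>\<xi>. \<Sigma> \<xi> l m) \<and> \<mu> A l m = (LINT \<xi>:A|lborel. \<Sigma> \<xi> l m))"

text \<open>
  Membership of a function valued in the finite-dimensional space of forms in \<open>L\<^sup>p\<close> or \<open>C\<^sub>0\<close> is
  expressed through its scalar coefficients.
\<close>

definition Lp_form ::
    "real \<Rightarrow> ('v::euclidean_space \<Rightarrow> ('w::euclidean_space \<Rightarrow> complex) \<Rightarrow> ('w \<Rightarrow> complex) \<Rightarrow> complex) \<Rightarrow>
     bool" where
  "Lp_form p \<Sigma> \<longleftrightarrow>
     (\<forall>l m. linear l \<longrightarrow> linear m \<longrightarrow>
        (\<lambda>\<xi>. \<Sigma> \<xi> l m) \<in> borel_measurable borel \<and>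
        integrable lborel (\<lambda>\<xi>. norm (\<Sigma> \<xi> l m) powr p))"

definition C0_form ::
    "('v::euclidean_space \<Rightarrow> ('w::euclidean_space \<Rightarrow> complex) \<Rightarrow> ('w \<Rightarrow> complex) \<Rightarrow> complex) \<Rightarrow>
     bool" where
  "C0_form \<Sigma> \<longleftrightarrow>
     (\<forall>l m. linear l \<longrightarrow> linear m \<longrightarrow>
        continuous_on UNIV (\<lambda>\<xi>. \<Sigma> \<xi> l m) \<and> ((\<lambda>\<xi>. \<Sigma> \<xi> l m) \<longlongrightarrow> 0) at_infinity)"


subsection \<open>The two sides of the limit formula\<close>

text \<open>
  Indices run over \<open>0, \<dots>, q - 1\<close>, and the last one is eliminated.  For \<open>q = 1\<close> the product measure is
  the Dirac mass on the one-point space, so the integral is the value at \<open>\<xi> = 0\<close>.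
\<close>

definition hyperplane_integral ::
    "nat \<Rightarrow> ((nat \<Rightarrow> 'v::euclidean_space) \<Rightarrow> complex) \<Rightarrow> complex" where
  "hyperplane_integral q F =
     (\<integral>\<xi>. F (\<xi>(q - 1 := - (\<Sum>k<q - 1. \<xi> k))) \<partial>Pi\<^sub>M {..<q - 1} (\<lambda>_. lborel))"

definition basis_list :: "'w::euclidean_space list \<Rightarrow> bool" where
  "basis_list es \<longleftrightarrow> distinct es \<and> independent (set es) \<and> span (set es) = UNIV"

text \<open>The \<open>i\<close>-th element of the basis of \<open>W\<^sup>*\<close> dual to the basis \<open>es\<close> of \<open>W\<close>.\<close>

definition dual_basis :: "'w::euclidean_space list \<Rightarrow> nat \<Rightarrow> 'w \<Rightarrow> real" where
  "dual_basis es i = (\<lambda>x. representation (set es) x (es ! i))"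

definition dual_form_matrix ::
    "'w::euclidean_space list \<Rightarrow> (('w \<Rightarrow> complex) \<Rightarrow> ('w \<Rightarrow> complex) \<Rightarrow> complex) \<Rightarrow> complex mat" where
  "dual_form_matrix es B =
     mat (length es) (length es)
       (\<lambda>(i, j). B (complexify (dual_basis es i)) (complexify (dual_basis es j)))"

definition bilinear_form_matrix ::
    "'w::euclidean_space list \<Rightarrow> ('w list \<Rightarrow> real) \<Rightarrow> complex mat" where
  "bilinear_form_matrix es g =
     mat (length es) (length es) (\<lambda>(i, j). complex_of_real (g [es ! i, es ! j]))"

definition mat_trace :: "'a::comm_monoid_add mat \<Rightarrow> 'a" where
  "mat_trace A = (\<Sum>i<dim_row A. A $$ (i, i))"

end

theory Submission
  imports Defs
begin

text \<open>
  The Hermite forms are Wick products of the coordinates, and integration by parts for Gaussian vectors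
  gives \<open>E[\<pi>\<^sub>q(f)(X(v)) \<pi>\<^sub>q(f)(X(u))] = \<Omega>(v - u)\<^sup>\<otimes>\<^sup>q(f\<^sub>q, f\<^sub>q) / q!\<close>.  Each coefficient of
  \<open>\<Omega>(v)\<^sup>\<otimes>\<^sup>q\<close> is a product of Fourier transforms of coefficients of \<open>\<Sigma>\<close>, so, with \<open>F\<phi>\<close> the Fourier
  transform of \<open>\<phi>\<close>, by Parseval's identity its contribution to the variance of \<open>Z\<^sub>r\<close> is
  \<open>\<integral> \<bar>F\<phi>(\<xi>)\<bar>\<^sup>2 G(\<xi> / r) d\<xi>\<close>, where \<open>G\<close> is a \<open>q\<close>-fold convolution of coefficients of \<open>\<Sigma>\<close>.  By the
  integrability assumption on \<open>\<Sigma>\<close>, \<open>G\<close> is bounded, and continuous at \<open>0\<close> because translations are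
  continuous in \<open>L\<^sup>p\<close>.  Dominated convergence and Plancherel's identity
  \<open>\<integral> \<bar>F\<phi>\<bar>\<^sup>2 = \<integral> \<phi>\<^sup>2 = 1\<close> then yield the limit \<open>G(0)\<close>, the integral over the hyperplane.
\<close>

subsection \<open>Moments of Gaussian variables\<close>

text \<open>The joint law of X(v) and X(u) may be degenerate (it is for v = u), so no Gaussian
  density in several variables is used. The Gaussian input is the recursion for the moments of one
  centered variable; applied to \<open>Y + t * Z\<close> for all real t it is an identity between
  polynomials in t, and comparing the coefficients of t yields integration by parts. By stationarity
  the same form \<Omega>(0) defines the Wick products at both points, so only contractions between
  the two points survive, and these form a permanent. Its q! equal contributions, against the two
  factors 1/q! of the projections, leave 1/q!.

  Write n = q - 1. The conjugate exponent is p = (n + 1) / n; for n = 0 its place is taken by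
  continuity and boundedness. Plancherel's identity comes from the same limit of kernels, with a
  Gaussian in place of \<Sigma>.

  For q = 2 the hyperplane pairs \<Sigma>(\<xi>) with \<Sigma>(-\<xi>), whereas the trace pairs
  \<Sigma>(\<xi>) with itself. The two agree because the covariance is real: reflecting a frequency
  exchanges the two arguments of the form.\<close>

lemma abs_mult_le_squares: "\<bar>a * b\<bar> \<le> (a\<^sup>2 + b\<^sup>2) / (2 :: real)"
proof -
  have "0 \<le> (\<bar>a\<bar> - \<bar>b\<bar>)\<^sup>2" by simp
  then show ?thesis by (simp add: power2_diff abs_mult)
qed

lemma abs_mult_le_abs_squares: "\<bar>a * b\<bar> \<le> \<bar>a\<^sup>2 + b\<^sup>2 :: real\<bar>"
proof -
  have "x \<le> \<bar>y\<bar>" if "x \<le> y / 2" for x y :: real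
    using that by linarith
  from this[OF abs_mult_le_squares] show ?thesis .
qed

text \<open>This class is an algebra: it contains the constants and is closed under sums and
  products. Every integrability condition on a polynomial in Gaussian variables thus reduces to
  membership of its letters.\<close>

definition all_moments :: "'a measure \<Rightarrow> ('a \<Rightarrow> real) set" where
  "all_moments M = {Y \<in> borel_measurable M. \<forall>n. integrable M (\<lambda>\<omega>. \<bar>Y \<omega>\<bar> ^ n)}"

lemma all_moments_measurable [measurable_dest]: "Y \<in> all_moments M \<Longrightarrow> Y \<in> borel_measurable M"
  by (simp add: all_moments_def)

lemma all_moments_integrable:
  assumes "Y \<in> all_moments M"
  shows "integrable M Y"
proof -
  have "integrable M (\<lambda>\<omega>. \<bar>Y \<omega>\<bar> ^ 1)"
    using assms unfolding all_moments_def by blast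
  then show ?thesis
    using assms by (simp add: all_moments_def integrable_abs_iff)
qed

lemma all_moments_add:
  assumes Y: "Y \<in> all_moments M" and Z: "Z \<in> all_moments M"
  shows "(\<lambda>\<omega>. Y \<omega> + Z \<omega>) \<in> all_moments M"
proof -
  note [measurable] = all_moments_measurable[OF Y] all_moments_measurable[OF Z]
  have "integrable M (\<lambda>\<omega>. \<bar>Y \<omega> + Z \<omega>\<bar> ^ n)" for n
  proof (rule Bochner_Integration.integrable_bound)
    show "integrable M (\<lambda>\<omega>. 2 ^ n * (\<bar>Y \<omega>\<bar> ^ n + \<bar>Z \<omega>\<bar> ^ n))"
      using Y Z by (auto simp: all_moments_def)
    have "\<bar>y + z\<bar> ^ n \<le> 2 ^ n * (\<bar>y\<bar> ^ n + \<bar>z\<bar> ^ n)" for y z :: real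
    proof -
      have "\<bar>y + z\<bar> ^ n \<le> (2 * max \<bar>y\<bar> \<bar>z\<bar>) ^ n" by (intro power_mono) auto
      also have "\<dots> \<le> 2 ^ n * (\<bar>y\<bar> ^ n + \<bar>z\<bar> ^ n)"
        by (auto simp: power_mult_distrib max_def)
      finally show ?thesis .
    qed
    then show "AE \<omega> in M. norm (\<bar>Y \<omega> + Z \<omega>\<bar> ^ n) \<le> norm (2 ^ n * (\<bar>Y \<omega>\<bar> ^ n + \<bar>Z \<omega>\<bar> ^ n))"
      by simp
  qed measurable
  then show ?thesis by (simp add: all_moments_def)
qed

text \<open>With a = |y|^n and b = |z|^n, the bound ab \<le> a^2 + b^2 trades the n-th moment of the
  product for moments of order 2n of the factors.\<close>

lemma all_moments_mult:
  assumes Y: "Y \<in> all_moments M" and Z: "Z \<in> all_moments M"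
  shows "(\<lambda>\<omega>. Y \<omega> * Z \<omega>) \<in> all_moments M"
proof -
  note [measurable] = all_moments_measurable[OF Y] all_moments_measurable[OF Z]
  have "integrable M (\<lambda>\<omega>. \<bar>Y \<omega> * Z \<omega>\<bar> ^ n)" for n
  proof (rule Bochner_Integration.integrable_bound)
    show "integrable M (\<lambda>\<omega>. \<bar>Y \<omega>\<bar> ^ (n + n) + \<bar>Z \<omega>\<bar> ^ (n + n))"
      using Y Z unfolding all_moments_def by (intro Bochner_Integration.integrable_add) blast+
    have "\<bar>y * z\<bar> ^ n \<le> \<bar>y\<bar> ^ (n + n) + \<bar>z\<bar> ^ (n + n)" for y z :: real
    proof -
      have "0 \<le> a * a + b * b - a * b" if "0 \<le> a" "0 \<le> b" for a b :: real
        using sum_squares_ge_zero[of a b] zero_le_square[of "a - b"] that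
        by (smt (verit, best) mult_nonneg_nonneg square_diff_square_factored left_diff_distrib right_diff_distrib)
      from this[of "\<bar>y\<bar> ^ n" "\<bar>z\<bar> ^ n"] show ?thesis
        by (simp add: abs_mult power_mult_distrib power_add)
    qed
    then show "AE \<omega> in M. norm (\<bar>Y \<omega> * Z \<omega>\<bar> ^ n) \<le> norm (\<bar>Y \<omega>\<bar> ^ (n + n) + \<bar>Z \<omega>\<bar> ^ (n + n))"
      by simp
  qed measurable
  then show ?thesis by (simp add: all_moments_def)
qed

lemma (in prob_space) all_moments_const: "(\<lambda>\<omega>. c) \<in> all_moments M"
  by (simp add: all_moments_def)

lemma (in prob_space) all_moments_power: "Y \<in> all_moments M \<Longrightarrow> (\<lambda>\<omega>. Y \<omega> ^ n) \<in> all_moments M"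
  by (induction n) (auto intro: all_moments_const all_moments_mult)

lemma (in prob_space) all_moments_sum:
  "(\<And>y. y \<in> A \<Longrightarrow> Y y \<in> all_moments M) \<Longrightarrow> (\<lambda>\<omega>. \<Sum>y\<in>A. Y y \<omega>) \<in> all_moments M"
  by (induction A rule: infinite_finite_induct) (auto intro: all_moments_const all_moments_add)

lemma (in prob_space) all_moments_prod_list:
  "(\<And>y. y \<in> set ys \<Longrightarrow> Y y \<in> all_moments M) \<Longrightarrow> (\<lambda>\<omega>. \<Prod>y\<leftarrow>ys. Y y \<omega>) \<in> all_moments M"
  by (induction ys) (auto intro: all_moments_const all_moments_mult)

lemma (in prob_space) all_moments_diff:
  assumes "Y \<in> all_moments M" "Z \<in> all_moments M"
  shows "(\<lambda>\<omega>. Y \<omega> - Z \<omega>) \<in> all_moments M"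
  using all_moments_add[OF assms(1) all_moments_mult[OF all_moments_const[of "-1"] assms(2)]] by simp

lemma (in prob_space) all_moments_msum:
  "(\<And>m. m \<in># L \<Longrightarrow> P m \<in> all_moments M) \<Longrightarrow> (\<lambda>\<omega>. \<Sum>m\<in>#L. a m * P m \<omega>) \<in> all_moments M"
  by (induction L) (auto intro!: all_moments_const all_moments_add all_moments_mult)

lemma (in prob_space) all_moments_mprod:
  "(\<And>m. m \<in># L \<Longrightarrow> P m \<in> all_moments M) \<Longrightarrow> (\<lambda>\<omega>. \<Prod>m\<in>#L. P m \<omega>) \<in> all_moments M"
  by (induction L) (auto intro!: all_moments_const all_moments_mult)

lemma (in prob_space) expectation_msum:
  assumes "\<And>m. m \<in># L \<Longrightarrow> P m \<in> all_moments M"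
  shows "expectation (\<lambda>\<omega>. \<Sum>m\<in>#L. a m * P m \<omega>) = (\<Sum>m\<in>#L. a m * expectation (P m))"
  using assms
proof (induction L)
  case (add m L)
  then have "integrable M (P m)" "integrable M (\<lambda>\<omega>. \<Sum>m\<in>#L. a m * P m \<omega>)"
    by (auto intro!: all_moments_integrable all_moments_msum)
  with add show ?case by simp
qed simp

text \<open>The recursion is the form of Gaussianity used from here on. It involves no division by
  the variance, so it also covers the degenerate case: a centered constant is zero almost surely,
  and both sides vanish.\<close>

lemma (in prob_space) gaussian_rv_moments:
  assumes Y: "gaussian_rv M Y" and mean: "expectation Y = 0"
  shows "Y \<in> all_moments M"
    and "expectation (\<lambda>\<omega>. Y \<omega> ^ Suc (Suc n)) = real (Suc n) * expectation (\<lambda>\<omega>. Y \<omega> ^ 2) * expectation (\<lambda>\<omega>. Y \<omega> ^ n)"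
proof -
  consider (normal) m s where "0 < s" "distributed M lborel Y (normal_density m s)"
    | (const) c where "Y \<in> borel_measurable M" "AE \<omega> in M. Y \<omega> = c"
    using Y unfolding gaussian_rv_def by blast
  then have "Y \<in> all_moments M \<and> (\<forall>n. expectation (\<lambda>\<omega>. Y \<omega> ^ Suc (Suc n)) =
      real (Suc n) * expectation (\<lambda>\<omega>. Y \<omega> ^ 2) * expectation (\<lambda>\<omega>. Y \<omega> ^ n))"
  proof cases
    case normal
    have D: "distributed M lborel Y (normal_density 0 s)"
      using normal normal_distributed_expectation[OF normal] mean by simp
    have meas: "Y \<in> borel_measurable M"
      using distributed_measurable[OF D] by simp
    have "integrable M (\<lambda>\<omega>. \<bar>Y \<omega>\<bar> ^ n)" for n
    proof -
      have "integrable lborel (\<lambda>x. normal_density 0 s x * \<bar>x\<bar> ^ n)"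
      proof (cases "even n")
        case True
        then obtain k where "n = 2 * k" by (elim evenE)
        then show ?thesis
          using integrable.intros[OF normal_moment_even[OF normal(1), of 0 k]]
          by (simp add: power_even_abs)
      next
        case False
        then obtain k where "n = 2 * k + 1" by (elim oddE)
        then show ?thesis
          using integrable.intros[OF normal_moment_abs_odd[OF normal(1), of 0 k]] by simp
      qed
      then show ?thesis
        by (subst distributed_integrable[OF D, symmetric]) (auto simp: normal_density_nonneg)
    qed
    then have 1: "Y \<in> all_moments M" using meas by (simp add: all_moments_def)
    have E: "expectation (\<lambda>\<omega>. Y \<omega> ^ n) = (\<integral>x. normal_density 0 s x * (x - 0) ^ n \<partial>lborel)" for n
      by (subst distributed_integral[OF D]) (auto simp: normal_density_nonneg)
    have var: "expectation (\<lambda>\<omega>. Y \<omega> ^ 2) = s\<^sup>2"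
      unfolding E using integral_normal_moment_even[OF normal(1), of 0 1] by simp
    have "expectation (\<lambda>\<omega>. Y \<omega> ^ Suc (Suc n)) = real (Suc n) * s\<^sup>2 * expectation (\<lambda>\<omega>. Y \<omega> ^ n)" for n
    proof (cases "even n")
      case True
      then obtain k where n: "n = 2 * k" by (elim evenE)
      then have SS: "Suc (Suc n) = 2 * Suc k" by simp
      \<comment> \<open>Quotient of consecutive even moments: the 2k-th moment is (2k)! / ((2/s^2)^k
        k!), and passing to k + 1 multiplies it by (2k + 1) s^2.\<close>
      have "fact (2 * Suc k) / ((2 / s\<^sup>2) ^ Suc k * fact (Suc k)) =
          real (Suc (2 * k)) * s\<^sup>2 * (fact (2 * k) / ((2 / s\<^sup>2) ^ k * fact k))"
      proof -
        have "(2 * real k + 2) * (2 * real k + 1) * f / (2 / s\<^sup>2 * A * ((real k + 1) * g)) =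
            (2 * real k + 1) * s\<^sup>2 * (f / (A * g))" if "A \<noteq> 0" "g \<noteq> 0" for A f g :: real
        proof -
          have "real k + 1 \<noteq> 0" by linarith
          with that normal(1) show ?thesis by (simp add: divide_simps)
        qed
        from this[of "(2 / s\<^sup>2) ^ k" "fact k" "fact (2 * k)"] show ?thesis
          using normal(1) by (simp add: algebra_simps)
      qed
      then show ?thesis
        unfolding E SS integral_normal_moment_even[OF normal(1)]
        unfolding n integral_normal_moment_even[OF normal(1)]
        by simp
    next
      case False
      then obtain k where n: "n = 2 * k + 1" by (elim oddE)
      then have SS: "Suc (Suc n) = 2 * Suc k + 1" by simp
      show ?thesis
        unfolding E SS integral_normal_moment_odd[OF normal(1)]
        unfolding n integral_normal_moment_odd[OF normal(1)] by simp
    qed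
    with 1 var show ?thesis by simp
  next
    case const
    have "expectation Y = expectation (\<lambda>_. c)"
      by (rule integral_cong_AE) (use const in auto)
    with mean have [simp]: "c = 0" by (simp add: prob_space)
    have "integrable M (\<lambda>\<omega>. \<bar>Y \<omega>\<bar> ^ n)" for n
    proof (rule iffD2[OF integrable_cong_AE])
      show "integrable M (\<lambda>\<omega>. (0::real) ^ n)" by simp
    qed (use const in auto)
    moreover have "expectation (\<lambda>\<omega>. Y \<omega> ^ Suc k) = expectation (\<lambda>\<omega>. 0)" for k
      by (rule integral_cong_AE) (use const in auto)
    ultimately show ?thesis
      using const(1) by (auto simp: all_moments_def numeral_2_eq_2 simp del: power_Suc)
  qed
  then show "Y \<in> all_moments M"
    "expectation (\<lambda>\<omega>. Y \<omega> ^ Suc (Suc n)) = real (Suc n) * expectation (\<lambda>\<omega>. Y \<omega> ^ 2) * expectation (\<lambda>\<omega>. Y \<omega> ^ n)"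
    by auto
qed

text \<open>Used with k = 1: from an identity in t coming from \<open>Z + t * Y\<close> it extracts
  the part linear in Y, which is how one-variable moment formulas are polarized.\<close>

lemma linear_coefficient_eqI:
  fixes a b :: "nat \<Rightarrow> real"
  assumes "\<And>t. (\<Sum>k\<le>n. a k * t ^ k) = (\<Sum>k\<le>n. b k * t ^ k)" and "k \<le> n"
  shows "a k = b k"
  using assms polyfun_eq_coeffs[of a n b] by simp

text \<open>Closure under \<open>Y + t * Z\<close> is what polarization requires. No joint density
  is assumed, so linear dependence between the members is harmless.\<close>

locale gaussian_space = prob_space M for M :: "'a measure" +
  fixes G :: "('a \<Rightarrow> real) set"
  assumes gaussian: "Y \<in> G \<Longrightarrow> gaussian_rv M Y"
    and mean_zero: "Y \<in> G \<Longrightarrow> expectation Y = 0"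
    and add_mult_closed: "Y \<in> G \<Longrightarrow> Z \<in> G \<Longrightarrow> (\<lambda>\<omega>. Y \<omega> + t * Z \<omega>) \<in> G"
begin

lemma moments: "Y \<in> G \<Longrightarrow> Y \<in> all_moments M"
  using gaussian_rv_moments(1)[OF gaussian mean_zero] .

definition cov :: "('a \<Rightarrow> real) \<Rightarrow> ('a \<Rightarrow> real) \<Rightarrow> real" where
  "cov Y Z = expectation (\<lambda>\<omega>. Y \<omega> * Z \<omega>)"

lemma cov_commute: "cov Y Z = cov Z Y"
  by (simp add: cov_def mult.commute)

lemma cov_add_mult:
  assumes "Y \<in> G" "Z \<in> G" "Z' \<in> G"
  shows "cov Y (\<lambda>\<omega>. Z \<omega> + t * Z' \<omega>) = cov Y Z + t * cov Y Z'"
proof -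
  have "cov Y (\<lambda>\<omega>. Z \<omega> + t * Z' \<omega>) = expectation (\<lambda>\<omega>. Y \<omega> * Z \<omega> + t * (Y \<omega> * Z' \<omega>))"
    unfolding cov_def by (simp add: algebra_simps)
  also have "\<dots> = cov Y Z + t * cov Y Z'"
    unfolding cov_def using assms
    by (subst Bochner_Integration.integral_add)
       (simp_all add: all_moments_integrable all_moments_mult moments)
  finally show ?thesis .
qed

lemma expectation_power_binomial:
  assumes "Y \<in> all_moments M" "Z \<in> all_moments M" "R \<in> all_moments M"
  shows "expectation (\<lambda>\<omega>. R \<omega> * (Y \<omega> + t * Z \<omega>) ^ n) =
    (\<Sum>k\<le>n. (real (n choose k) * expectation (\<lambda>\<omega>. R \<omega> * Z \<omega> ^ k * Y \<omega> ^ (n - k))) * t ^ k)"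
proof -
  have "expectation (\<lambda>\<omega>. R \<omega> * (Y \<omega> + t * Z \<omega>) ^ n) =
    expectation (\<lambda>\<omega>. \<Sum>k\<le>n. (real (n choose k) * t ^ k) * (R \<omega> * Z \<omega> ^ k * Y \<omega> ^ (n - k)))"
    by (subst add.commute, subst binomial_ring) (simp add: sum_distrib_left power_mult_distrib ac_simps)
  also have "\<dots> = (\<Sum>k\<le>n. expectation (\<lambda>\<omega>. (real (n choose k) * t ^ k) * (R \<omega> * Z \<omega> ^ k * Y \<omega> ^ (n - k))))"
    by (intro Bochner_Integration.integral_sum integrable_mult_right all_moments_integrable
          all_moments_mult all_moments_power assms)
  also have "\<dots> = (\<Sum>k\<le>n. (real (n choose k) * t ^ k) * expectation (\<lambda>\<omega>. R \<omega> * Z \<omega> ^ k * Y \<omega> ^ (n - k)))"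
    by (simp only: integral_mult_right_zero)
  finally show ?thesis by (simp only: mult.assoc mult.commute[of "t ^ _"])
qed

text \<open>Compare the coefficients of t in the moment recursion for \<open>Z + t * Y\<close> at
  exponent n + 2. The coefficient on the right contains E[Y Z^(n-1)] besides E[Z^n], hence the
  strong induction.\<close>

lemma stein_power:
  assumes "Y \<in> G" "Z \<in> G"
  shows "expectation (\<lambda>\<omega>. Y \<omega> * Z \<omega> ^ Suc n) = real (Suc n) * cov Y Z * expectation (\<lambda>\<omega>. Z \<omega> ^ n)"
  using assms
proof (induction n rule: less_induct)
  case (less n)
  note mom = moments[OF less.prems(1)] moments[OF less.prems(2)]
  let ?E = "\<lambda>k n. expectation (\<lambda>\<omega>. Y \<omega> ^ k * Z \<omega> ^ n)"
  have expand: "expectation (\<lambda>\<omega>. (Z \<omega> + t * Y \<omega>) ^ n) = (\<Sum>k\<le>n. (real (n choose k) * ?E k (n - k)) * t ^ k)" for t n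
    using expectation_power_binomial[OF mom(2,1) all_moments_const[of 1], of t n] by simp
  \<comment> \<open>\<open>a\<close> and \<open>b\<close> are the coefficients in t of the two sides
    of the recursion, \<open>e\<close> those of E[(Z + tY)^n]. The three summands of
    \<open>b\<close> belong to the powers 1, t, t^2 in the variance of Z + tY; the conditions in
    them discard indices outside the range of \<open>e\<close>.\<close>
  define a where "a k = real (Suc (Suc n) choose k) * ?E k (Suc (Suc n) - k)" for k
  define e where "e k = real (n choose k) * ?E k (n - k)" for k
  define b where "b k = real (Suc n) * (cov Z Z * (if k \<le> n then e k else 0)
     + (if k \<ge> 1 \<and> k \<le> Suc n then 2 * cov Y Z * e (k - 1) else 0)
     + (if k \<ge> 2 then cov Y Y * e (k - 2) else 0))" for k
  have "(\<Sum>k\<le>Suc (Suc n). a k * t ^ k) = (\<Sum>k\<le>Suc (Suc n). b k * t ^ k)" for t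
  proof -
    have G: "(\<lambda>\<omega>. Z \<omega> + t * Y \<omega>) \<in> G"
      by (intro add_mult_closed less.prems)
    let ?U = "\<lambda>\<omega>. Z \<omega> + t * Y \<omega>"
    have "expectation (\<lambda>\<omega>. ?U \<omega> ^ 2) = cov ?U ?U"
      by (simp add: cov_def power2_eq_square)
    also have "\<dots> = cov ?U Z + t * cov ?U Y"
      by (rule cov_add_mult[OF G less.prems(2,1)])
    also have "cov ?U Z = cov Z Z + t * cov Z Y"
      unfolding cov_commute[of ?U Z] by (rule cov_add_mult[OF less.prems(2,2,1)])
    also have "cov ?U Y = cov Y Z + t * cov Y Y"
      unfolding cov_commute[of ?U Y] by (rule cov_add_mult[OF less.prems(1,2,1)])
    also have "cov Z Y = cov Y Z"
      by (rule cov_commute)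
    finally have var: "expectation (\<lambda>\<omega>. ?U \<omega> ^ 2) = cov Z Z + 2 * t * cov Y Z + t ^ 2 * cov Y Y"
      by (simp add: algebra_simps power2_eq_square)
    have "(\<Sum>k\<le>Suc (Suc n). a k * t ^ k) = expectation (\<lambda>\<omega>. (Z \<omega> + t * Y \<omega>) ^ Suc (Suc n))"
      unfolding expand a_def ..
    also have "\<dots> = real (Suc n) * (cov Z Z + 2 * t * cov Y Z + t ^ 2 * cov Y Y) * expectation (\<lambda>\<omega>. (Z \<omega> + t * Y \<omega>) ^ n)"
      unfolding gaussian_rv_moments(2)[OF gaussian[OF G] mean_zero[OF G], of n] var ..
    also have "expectation (\<lambda>\<omega>. (Z \<omega> + t * Y \<omega>) ^ n) = (\<Sum>k\<le>n. e k * t ^ k)"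
      unfolding expand e_def ..
    also have "real (Suc n) * (cov Z Z + 2 * t * cov Y Z + t ^ 2 * cov Y Y) * (\<Sum>k\<le>n. e k * t ^ k) =
        (\<Sum>k\<le>Suc (Suc n). b k * t ^ k)"
    proof -
      define A where "A k = (if k \<le> n then e k else 0)" for k
      define B where "B k = (if k \<ge> 1 \<and> k \<le> Suc n then e (k - 1) else 0)" for k
      define C where "C k = (if k \<ge> 2 then e (k - 2) else 0)" for k
      have 1: "(\<Sum>k\<le>Suc (Suc n). A k * t ^ k) = (\<Sum>k\<le>n. e k * t ^ k)"
        by (simp add: A_def)
      have 2: "(\<Sum>k\<le>Suc (Suc n). B k * t ^ k) = t * (\<Sum>k\<le>n. e k * t ^ k)"
        unfolding sum.atMost_Suc_shift[of _ "Suc n"] by (simp add: B_def sum_distrib_left ac_simps)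
      have 3: "(\<Sum>k\<le>Suc (Suc n). C k * t ^ k) = t ^ 2 * (\<Sum>k\<le>n. e k * t ^ k)"
        unfolding sum.atMost_Suc_shift[of _ "Suc n"] sum.atMost_Suc_shift[of _ n]
        by (simp add: C_def sum_distrib_left ac_simps power2_eq_square)
      have "b k = real (Suc n) * (cov Z Z * A k + 2 * cov Y Z * B k + cov Y Y * C k)" for k
        by (simp add: b_def A_def B_def C_def)
      then have "(\<Sum>k\<le>Suc (Suc n). b k * t ^ k) = (\<Sum>k\<le>Suc (Suc n). real (Suc n) * cov Z Z * (A k * t ^ k) +
          real (Suc n) * 2 * cov Y Z * (B k * t ^ k) + real (Suc n) * cov Y Y * (C k * t ^ k))"
        by (intro sum.cong) (simp_all only: distrib_left distrib_right mult.assoc)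
      also have "\<dots> = real (Suc n) * cov Z Z * (\<Sum>k\<le>Suc (Suc n). A k * t ^ k) +
          real (Suc n) * 2 * cov Y Z * (\<Sum>k\<le>Suc (Suc n). B k * t ^ k) +
          real (Suc n) * cov Y Y * (\<Sum>k\<le>Suc (Suc n). C k * t ^ k)"
        by (simp only: sum.distrib sum_distrib_left)
      also have "\<dots> = real (Suc n) * (cov Z Z + 2 * t * cov Y Z + t ^ 2 * cov Y Y) * (\<Sum>k\<le>n. e k * t ^ k)"
        unfolding 1 2 3 by (simp only: distrib_left distrib_right mult.assoc mult.left_commute mult.commute)
      finally show ?thesis ..
    qed
    finally show ?thesis .
  qed
  from linear_coefficient_eqI[where n="Suc (Suc n)" and a=a and b=b and k=1, OF this] have "a 1 = b 1" by simp
  \<comment> \<open>The coefficient of t. For n = 0 the term with exponent n - 1 is absent, which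
    the conditional records.\<close>
  then have *: "real (Suc (Suc n)) * expectation (\<lambda>\<omega>. Y \<omega> * Z \<omega> ^ Suc n) =
     real (Suc n) * (cov Z Z * (if 1 \<le> n then real n * ?E 1 (n - 1) else 0) + 2 * cov Y Z * expectation (\<lambda>\<omega>. Z \<omega> ^ n))"
    by (simp add: a_def b_def e_def)
  show ?case
  proof (cases n)
    case 0
    then show ?thesis using * by simp
  next
    case (Suc m)
    show ?thesis
    proof (cases m)
      case 0
      then show ?thesis using * Suc mean_zero[OF less.prems(1)] mean_zero[OF less.prems(2)] by simp
    next
      case k: (Suc k)
      have "expectation (\<lambda>\<omega>. Y \<omega> * Z \<omega> ^ Suc k) = real (Suc k) * cov Y Z * expectation (\<lambda>\<omega>. Z \<omega> ^ k)"
        using less.IH[of k] less.prems Suc k by simp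
      moreover have "expectation (\<lambda>\<omega>. Z \<omega> ^ Suc (Suc k)) = real (Suc k) * cov Z Z * expectation (\<lambda>\<omega>. Z \<omega> ^ k)"
        using gaussian_rv_moments(2)[OF gaussian[OF less.prems(2)] mean_zero[OF less.prems(2)], of k]
        by (simp add: cov_def power2_eq_square)
      \<comment> \<open>Both sides equal (n - 1) cov(Z,Z) cov(Y,Z) E[Z^(n-2)]: on the left by the
        induction hypothesis at n - 2, on the right by the moment recursion. The right-hand side of
        the identity \<open>*\<close> thus becomes (n + 1)(n + 2) cov(Y,Z) E[Z^n].\<close>
      ultimately have **: "cov Z Z * ?E 1 (n - 1) = cov Y Z * expectation (\<lambda>\<omega>. Z \<omega> ^ n)"
        unfolding Suc k by simp
      have alg: "(n' + 2) * x = (n' + 2) * ((n' + 1) * c * z)"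
        if "(n' + 2) * x = (n' + 1) * (v * (n' * y) + 2 * c * z)" "v * y = c * z" for n' x c z v y :: real
      proof -
        have "v * (n' * y) = n' * (c * z)" using that(2) by (simp add: mult.left_commute)
        then have "(n' + 2) * x = (n' + 1) * (n' * (c * z) + 2 * c * z)"
          using that(1) by (simp only:)
        then show ?thesis by (simp add: algebra_simps)
      qed
      have "1 \<le> n" using Suc by simp
      with * have "(real n + 2) * expectation (\<lambda>\<omega>. Y \<omega> * Z \<omega> ^ Suc n) =
        (real n + 1) * (cov Z Z * (real n * ?E 1 (n - 1)) + 2 * cov Y Z * expectation (\<lambda>\<omega>. Z \<omega> ^ n))"
        by (simp only: if_True of_nat_Suc) (simp add: add.commute)
      from alg[OF this **] have "real (Suc (Suc n)) * expectation (\<lambda>\<omega>. Y \<omega> * Z \<omega> ^ Suc n) =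
        real (Suc (Suc n)) * (real (Suc n) * cov Y Z * expectation (\<lambda>\<omega>. Z \<omega> ^ n))"
        by (simp add: add.commute)
      then show ?thesis
        by (rule mult_left_cancel[THEN iffD1, rotated]) (rule of_nat_neq_0)
    qed
  qed
qed

text \<open>Isserlis' formula is the case \<open>n = 0\<close>; the power of \<open>Z\<close> allows to induct on \<open>Ys\<close>, by comparing
  the coefficients of \<open>t\<close> after replacing \<open>Z\<close> by \<open>Z + t Y'\<close>.\<close>

lemma stein_power_prod_list:
  assumes "Y \<in> G" "Z \<in> G" "set Ys \<subseteq> G"
  shows "expectation (\<lambda>\<omega>. Y \<omega> * Z \<omega> ^ n * (\<Prod>U\<leftarrow>Ys. U \<omega>)) =
    real n * cov Y Z * expectation (\<lambda>\<omega>. Z \<omega> ^ (n - 1) * (\<Prod>U\<leftarrow>Ys. U \<omega>)) +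
    (\<Sum>i<length Ys. cov Y (Ys ! i) * expectation (\<lambda>\<omega>. Z \<omega> ^ n * (\<Prod>U\<leftarrow>take i Ys @ drop (Suc i) Ys. U \<omega>)))"
  using assms
proof (induction Ys arbitrary: Z n)
  case Nil
  then show ?case
    using stein_power[of Y Z "n - 1"] mean_zero[of Y] by (cases n) simp_all
next
  case (Cons Y' Ys)
  have mom: "Y \<in> all_moments M" "Z \<in> all_moments M" "Y' \<in> all_moments M"
    and momP: "\<And>L. set L \<subseteq> G \<Longrightarrow> (\<lambda>\<omega>. \<Prod>U\<leftarrow>L. U \<omega>) \<in> all_moments M"
    using Cons.prems moments by (auto intro!: all_moments_prod_list)
  define P where "P = (\<lambda>\<omega>. \<Prod>U\<leftarrow>Ys. U \<omega>)"
  define R where "R i = (\<lambda>\<omega>. \<Prod>U\<leftarrow>take i Ys @ drop (Suc i) Ys. U \<omega>)" for i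
  have P: "P \<in> all_moments M" unfolding P_def using Cons.prems by (intro momP) auto
  have R: "R i \<in> all_moments M" for i
  proof -
    have "set (take i Ys @ drop (Suc i) Ys) \<subseteq> G"
      using Cons.prems(3) set_take_subset[of i Ys] set_drop_subset[of "Suc i" Ys] by auto
    then show ?thesis unfolding R_def by (rule momP)
  qed
  \<comment> \<open>One power of Z more than in the claim: the coefficient of t in (Z + tY')^(n+1)
    is (n + 1) Z^n Y', which produces the new factor Y'. The factor n + 1 occurs in every term and
    is cancelled at the end.\<close>
  let ?m = "Suc n"
  define a where "a k = real (?m choose k) * expectation (\<lambda>\<omega>. Y \<omega> * P \<omega> * Y' \<omega> ^ k * Z \<omega> ^ (?m - k))" for k
  define e where "e k = real (n choose k) * expectation (\<lambda>\<omega>. P \<omega> * Y' \<omega> ^ k * Z \<omega> ^ (n - k))" for k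
  define c where "c i k = real (?m choose k) * expectation (\<lambda>\<omega>. R i \<omega> * Y' \<omega> ^ k * Z \<omega> ^ (?m - k))" for i k
  define b where "b k = real ?m * (cov Y Z * (if k \<le> n then e k else 0) + cov Y Y' * (if k \<ge> 1 then e (k - 1) else 0))
     + (\<Sum>i<length Ys. cov Y (Ys ! i) * c i k)" for k
  have "(\<Sum>k\<le>?m. a k * t ^ k) = (\<Sum>k\<le>?m. b k * t ^ k)" for t
  proof -
    let ?Z = "\<lambda>\<omega>. Z \<omega> + t * Y' \<omega>"
    define S where "S = (\<Sum>k\<le>n. e k * t ^ k)"
    define C where "C i = (\<Sum>k\<le>?m. c i k * t ^ k)" for i
    have "(\<Sum>k\<le>?m. a k * t ^ k) = expectation (\<lambda>\<omega>. Y \<omega> * P \<omega> * ?Z \<omega> ^ ?m)"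
      unfolding a_def
      by (rule expectation_power_binomial[OF mom(2,3) all_moments_mult[OF mom(1) P], symmetric])
    also have "\<dots> = expectation (\<lambda>\<omega>. Y \<omega> * ?Z \<omega> ^ ?m * P \<omega>)"
      by (simp only: mult.assoc mult.commute[of "P _"])
    also have "\<dots> = real ?m * cov Y ?Z * expectation (\<lambda>\<omega>. ?Z \<omega> ^ n * P \<omega>) +
        (\<Sum>i<length Ys. cov Y (Ys ! i) * expectation (\<lambda>\<omega>. ?Z \<omega> ^ ?m * R i \<omega>))"
      using Cons.IH[of ?Z ?m] Cons.prems add_mult_closed[of Z Y' t] unfolding P_def R_def by simp
    also have "cov Y ?Z = cov Y Z + t * cov Y Y'"
      using Cons.prems by (intro cov_add_mult) auto
    also have "expectation (\<lambda>\<omega>. ?Z \<omega> ^ n * P \<omega>) = S"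
      unfolding S_def e_def mult.commute[of _ "P _"] by (rule expectation_power_binomial[OF mom(2,3) P])
    also have "(\<lambda>i. expectation (\<lambda>\<omega>. ?Z \<omega> ^ ?m * R i \<omega>)) = C"
      unfolding C_def c_def mult.commute[of _ "R _ _"]
      by (intro ext expectation_power_binomial[OF mom(2,3) R])
    also have "real ?m * (cov Y Z + t * cov Y Y') * S + (\<Sum>i<length Ys. cov Y (Ys ! i) * C i) =
        (\<Sum>k\<le>?m. b k * t ^ k)"
    proof -
      define A where "A k = (if k \<le> n then e k else 0)" for k
      define B where "B k = (if k \<ge> 1 then e (k - 1) else 0)" for k
      have A: "(\<Sum>k\<le>?m. A k * t ^ k) = S"
        by (simp add: A_def S_def)
      have B: "(\<Sum>k\<le>?m. B k * t ^ k) = t * S"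
        unfolding sum.atMost_Suc_shift[of _ n] by (simp add: B_def S_def sum_distrib_left ac_simps)
      have C: "(\<Sum>k\<le>?m. (\<Sum>i<length Ys. cov Y (Ys ! i) * c i k) * t ^ k) = (\<Sum>i<length Ys. cov Y (Ys ! i) * C i)"
        unfolding C_def sum_distrib_left sum_distrib_right by (subst sum.swap) (simp add: mult.assoc)
      have "(\<Sum>k\<le>?m. b k * t ^ k) = (\<Sum>k\<le>?m. real ?m * cov Y Z * (A k * t ^ k) + real ?m * cov Y Y' * (B k * t ^ k)
          + (\<Sum>i<length Ys. cov Y (Ys ! i) * c i k) * t ^ k)"
        unfolding b_def A_def[symmetric] B_def[symmetric]
        by (intro sum.cong refl) (simp only: distrib_left distrib_right mult.assoc)
      also have "\<dots> = real ?m * cov Y Z * S + real ?m * cov Y Y' * (t * S) + (\<Sum>i<length Ys. cov Y (Ys ! i) * C i)"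
        unfolding B[symmetric] unfolding A[symmetric] C[symmetric] by (simp only: sum.distrib sum_distrib_left)
      finally show ?thesis by (simp add: algebra_simps)
    qed
    finally show ?thesis .
  qed
  from linear_coefficient_eqI[where n="?m" and a=a and b=b and k=1, OF this] have "a 1 = b 1" by simp
  define E1 where "E1 = expectation (\<lambda>\<omega>. Y \<omega> * Z \<omega> ^ n * (Y' \<omega> * P \<omega>))"
  define E2 where "E2 = expectation (\<lambda>\<omega>. Z \<omega> ^ (n - 1) * (Y' \<omega> * P \<omega>))"
  define E3 where "E3 = expectation (\<lambda>\<omega>. Z \<omega> ^ n * P \<omega>)"
  define D where "D i = expectation (\<lambda>\<omega>. Z \<omega> ^ n * (Y' \<omega> * R i \<omega>))" for i
  have "a 1 = real ?m * E1"
    by (simp add: a_def E1_def ac_simps)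
  moreover have "(if 1 \<le> n then e 1 else 0) = real n * E2"
    by (simp add: e_def E2_def ac_simps)
  moreover have "e (1 - 1) = E3"
    by (simp add: e_def E3_def mult.commute)
  moreover have "c i 1 = real ?m * D i" for i
    by (simp add: c_def D_def ac_simps)
  ultimately have "real ?m * E1 = real ?m * (cov Y Z * (real n * E2) + cov Y Y' * E3) + (\<Sum>i<length Ys. cov Y (Ys ! i) * (real ?m * D i))"
    using \<open>a 1 = b 1\<close> by (simp only: b_def order_refl if_True)
  also have "\<dots> = real ?m * (real n * cov Y Z * E2 + (cov Y Y' * E3 + (\<Sum>i<length Ys. cov Y (Ys ! i) * D i)))"
    by (simp only: sum_distrib_left distrib_left mult.left_commute mult.assoc add.assoc)
  finally have "E1 = real n * cov Y Z * E2 + (cov Y Y' * E3 + (\<Sum>i<length Ys. cov Y (Ys ! i) * D i))"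
    by (rule mult_left_cancel[THEN iffD1, rotated]) (rule of_nat_neq_0)
  then show ?case
    unfolding E1_def E2_def E3_def D_def P_def R_def
    by (simp add: sum.lessThan_Suc_shift mult.assoc del: sum.lessThan_Suc)
qed

lemma isserlis:
  assumes "Y \<in> G" "set Ys \<subseteq> G"
  shows "expectation (\<lambda>\<omega>. Y \<omega> * (\<Prod>U\<leftarrow>Ys. U \<omega>)) =
    (\<Sum>i<length Ys. cov Y (Ys ! i) * expectation (\<lambda>\<omega>. \<Prod>U\<leftarrow>take i Ys @ drop (Suc i) Ys. U \<omega>))"
  using stein_power_prod_list[OF assms(1,1,2), of 0] by simp

end


subsection \<open>Wick polynomials\<close>

lemma sum_mset_minus_single:
  fixes h :: "'l \<Rightarrow> real"
  assumes "m \<in># M"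
  shows "(\<Sum>n\<in>#M - {#m#}. h n) = (\<Sum>n\<in>#M. h n) - h m"
proof -
  obtain N where "M = add_mset m N" using assms by (rule mset_add)
  then show ?thesis by simp
qed

lemma sum_mset_mset: "(\<Sum>m\<in>#mset ls. f m) = (\<Sum>m\<leftarrow>ls. f m)"
  by (induction ls) simp_all

lemma sum_mset_mult_right: "(\<Sum>m\<in>#M. f m) * c = (\<Sum>m\<in>#M. f m * c :: real)"
  by (induction M) (simp_all add: distrib_right)

lemma sum_mset_diff: "(\<Sum>m\<in>#M. f m - g m) = (\<Sum>m\<in>#M. f m) - (\<Sum>m\<in>#M. g m :: real)"
  by (induction M) simp_all

text \<open>Both sides run over ordered pairs of distinct occurrences: removing one copy of the
  outer element from the inner multiset subtracts the diagonal from the full double sum.\<close>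

lemma sum_mset_swap_pairs:
  fixes h :: "'l \<Rightarrow> 'l \<Rightarrow> real"
  shows "(\<Sum>m\<in>#M. \<Sum>n\<in>#M - {#m#}. h m n) = (\<Sum>n\<in>#M. \<Sum>m\<in>#M - {#n#}. h m n)"
proof -
  have "(\<Sum>m\<in>#M. \<Sum>n\<in>#M - {#m#}. h m n) = (\<Sum>m\<in>#M. (\<Sum>n\<in>#M. h m n) - h m m)"
    by (intro arg_cong[of _ _ sum_mset] image_mset_cong sum_mset_minus_single)
  also have "\<dots> = (\<Sum>n\<in>#M. \<Sum>m\<in>#M. h m n) - (\<Sum>n\<in>#M. h n n)"
    unfolding sum_mset_diff by (subst sum_mset.swap) (rule refl)
  also have "\<dots> = (\<Sum>n\<in>#M. (\<Sum>m\<in>#M. h m n) - h n n)"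
    by (simp only: sum_mset_diff)
  also have "\<dots> = (\<Sum>n\<in>#M. \<Sum>m\<in>#M - {#n#}. h m n)"
    by (intro arg_cong[of _ _ sum_mset] image_mset_cong) (simp only: sum_mset_minus_single)
  finally show ?thesis .
qed

lemma mset_take_drop_Suc: "i < length ls \<Longrightarrow> mset (take i ls @ drop (Suc i) ls) = mset ls - {#ls ! i#}"
  by (subst (3) id_take_nth_drop[of i ls]) simp_all

text \<open>Passes from removing a position of a list, as in \<open>isserlis\<close>, to removing an
  element of a multiset, as in the recursion for \<open>wick\<close>.\<close>

lemma sum_remove_index:
  fixes f :: "'l \<Rightarrow> 'l multiset \<Rightarrow> real"
  shows "(\<Sum>i<length ls. f (ls ! i) (mset (take i ls @ drop (Suc i) ls))) = (\<Sum>m\<in>#mset ls. f m (mset ls - {#m#}))"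
proof -
  have "(\<Sum>m\<in>#mset ls. f m (mset ls - {#m#})) = (\<Sum>m\<leftarrow>ls. f m (mset ls - {#m#}))"
    by (rule sum_mset_mset)
  also have "\<dots> = (\<Sum>i<length ls. f (ls ! i) (mset ls - {#ls ! i#}))"
    by (simp add: sum_list_sum_nth atLeast0LessThan)
  also have "\<dots> = (\<Sum>i<length ls. f (ls ! i) (mset (take i ls @ drop (Suc i) ls)))"
    by (intro sum.cong refl) (simp only: mset_take_drop_Suc lessThan_iff)
  finally show ?thesis ..
qed

lemma (in gaussian_space) isserlis_mset:
  assumes "Y l \<in> G" "\<And>m. m \<in># L \<Longrightarrow> Y m \<in> G"
  shows "expectation (\<lambda>\<omega>. Y l \<omega> * (\<Prod>m\<in>#L. Y m \<omega>)) =
    (\<Sum>m\<in>#L. cov (Y l) (Y m) * expectation (\<lambda>\<omega>. \<Prod>n\<in>#L - {#m#}. Y n \<omega>))"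
proof -
  obtain ls where ls: "mset ls = L" using ex_mset by blast
  have P: "(\<Prod>U\<leftarrow>map Y ks. U \<omega>) = (\<Prod>m\<in>#mset ks. Y m \<omega>)" for ks \<omega>
    by (induction ks) simp_all
  have "expectation (\<lambda>\<omega>. Y l \<omega> * (\<Prod>U\<leftarrow>map Y ls. U \<omega>)) =
    (\<Sum>i<length (map Y ls). cov (Y l) (map Y ls ! i) * expectation (\<lambda>\<omega>. \<Prod>U\<leftarrow>take i (map Y ls) @ drop (Suc i) (map Y ls). U \<omega>))"
    by (rule isserlis) (use assms ls in auto)
  also have "\<dots> = (\<Sum>i<length ls. cov (Y l) (Y (ls ! i)) * expectation (\<lambda>\<omega>. \<Prod>n\<in>#mset (take i ls @ drop (Suc i) ls). Y n \<omega>))"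
    by (intro sum.cong) (simp_all only: take_map drop_map map_append[symmetric] P length_map lessThan_iff nth_map)
  also have "\<dots> = (\<Sum>m\<in>#mset ls. cov (Y l) (Y m) * expectation (\<lambda>\<omega>. \<Prod>n\<in>#mset ls - {#m#}. Y n \<omega>))"
    by (rule sum_remove_index)
  finally show ?thesis unfolding P ls .
qed

text \<open>The recursion subtracts the contractions of the first letter with each later position.
  For repeated letters \<open>remove1\<close> may delete another copy than the one the sum stands
  at; the remaining multiset is the same, and for symmetric B only that matters, by
  \<open>wick_list_cong_mset\<close>.\<close>

function wick_list :: "('l \<Rightarrow> 'l \<Rightarrow> real) \<Rightarrow> ('l \<Rightarrow> real) \<Rightarrow> 'l list \<Rightarrow> real" where
  "wick_list B e [] = 1"
| "wick_list B e (l # ls) = e l * wick_list B e ls - (\<Sum>m\<leftarrow>ls. B l m * wick_list B e (remove1 m ls))"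
  by pat_completeness auto
termination
  by (relation "Wellfounded.measure (\<lambda>(B, e, ls). length ls)") (auto simp: length_remove1)

text \<open>For a Gaussian vector with covariance \<open>B\<close>, \<open>wick B e L\<close> is the Wick product of the letters in
  \<open>L\<close>, evaluated at the values \<open>e\<close>.\<close>

definition wick :: "('l \<Rightarrow> 'l \<Rightarrow> real) \<Rightarrow> ('l \<Rightarrow> real) \<Rightarrow> 'l multiset \<Rightarrow> real" where
  "wick B e L = wick_list B e (SOME ls. mset ls = L)"

text \<open>Strong induction on the length. Shorter lists may be replaced by their multisets, so
  only the choice of the first letter is in question. Expanding two steps with the letters a, b in
  front gives an expression symmetric in a and b: the contraction of a with b is symmetric because B
  is, and the double contractions are by \<open>sum_mset_swap_pairs\<close>.\<close>

lemma wick_list_cong_mset: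
  assumes sym: "\<And>l m. B l m = B m l" and "mset ls = mset ls'"
  shows "wick_list B e ls = wick_list B e ls'"
  using assms(2)
proof (induction "length ls" arbitrary: ls ls' rule: less_induct)
  case less
  let ?W = "wick B e"
  have W: "wick_list B e ks = ?W (mset ks)" if "length ks < length ls" for ks
    unfolding wick_def by (rule less.hyps[OF that]) (metis (mono_tags) someI)
  define R where "R l L = e l * ?W L - (\<Sum>m\<in>#L. B l m * ?W (L - {#m#}))" for l L
  have R: "wick_list B e (l # ks) = R l (mset ks)" if "length ks < length ls" for l ks
  proof -
    have "(\<Sum>m\<leftarrow>ks. B l m * wick_list B e (remove1 m ks)) = (\<Sum>m\<leftarrow>ks. B l m * ?W (mset ks - {#m#}))"
    proof (intro arg_cong[of _ _ sum_list] map_cong refl)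
      fix m assume "m \<in> set ks"
      then have "length (remove1 m ks) < length ls" using that by (simp add: length_remove1)
      from W[OF this] show "B l m * wick_list B e (remove1 m ks) = B l m * ?W (mset ks - {#m#})" by simp
    qed
    also have "\<dots> = (\<Sum>m\<in>#mset ks. B l m * ?W (mset ks - {#m#}))"
      by (rule sum_mset_mset[symmetric])
    finally show ?thesis using W[OF that] by (simp add: R_def)
  qed
  \<comment> \<open>\<open>?W\<close> obeys the recursion for lists strictly shorter than
    \<open>ls\<close> only; at the length of \<open>ls\<close> the independence of the order is what
    is being proved.\<close>
  have WR: "?W (add_mset l L) = R l L" if "Suc (size L) < length ls" for l L
  proof -
    obtain ks where "mset ks = L" using ex_mset by blast
    with that W[of "l # ks"] R[of ks l] show ?thesis by (auto simp flip: size_mset)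
  qed
  have swap: "R a (add_mset b U) = R b (add_mset a U)" if "Suc (Suc (size U)) = length ls" for a b U
  proof -
    define S where "S a b = (\<Sum>m\<in>#U. \<Sum>n\<in>#U - {#m#}. B a m * B b n * ?W (U - {#m#} - {#n#}))" for a b
    have expand: "R a (add_mset b U) = e a * e b * ?W U - B a b * ?W U
        - e a * (\<Sum>m\<in>#U. B b m * ?W (U - {#m#})) - e b * (\<Sum>m\<in>#U. B a m * ?W (U - {#m#})) + S a b" for a b
    proof -
      have "(\<Sum>m\<in>#U. B a m * ?W (add_mset b U - {#m#})) =
          (\<Sum>m\<in>#U. e b * (B a m * ?W (U - {#m#})) - (\<Sum>n\<in>#U - {#m#}. B a m * B b n * ?W (U - {#m#} - {#n#})))"
      proof (intro arg_cong[of _ _ sum_mset] image_mset_cong)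
        fix m assume m: "m \<in># U"
        then have "add_mset b U - {#m#} = add_mset b (U - {#m#})" by simp
        moreover have "Suc (size (U - {#m#})) < length ls"
          using m that by (simp add: size_Diff_singleton)
        ultimately have "?W (add_mset b U - {#m#}) = R b (U - {#m#})" using WR by simp
        then show "B a m * ?W (add_mset b U - {#m#}) =
          e b * (B a m * ?W (U - {#m#})) - (\<Sum>n\<in>#U - {#m#}. B a m * B b n * ?W (U - {#m#} - {#n#}))"
          by (simp add: R_def right_diff_distrib sum_mset_distrib_left multiset.map_comp o_def mult.assoc mult.left_commute)
      qed
      also have "\<dots> = e b * (\<Sum>m\<in>#U. B a m * ?W (U - {#m#})) - S a b"
        by (simp add: sum_mset_diff sum_mset_distrib_left multiset.map_comp o_def S_def)
      finally have "(\<Sum>m\<in>#U. B a m * ?W (add_mset b U - {#m#})) = \<dots>" .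
      moreover have "?W (add_mset b U) = R b U" using that by (intro WR) simp
      ultimately show ?thesis
        unfolding R_def[of a] by (simp add: R_def[of b] right_diff_distrib)
    qed
    have "S a b = S b a"
      unfolding S_def
      by (subst sum_mset_swap_pairs) (simp add: mult.commute mult.left_commute add_mset_commute)
    then show ?thesis unfolding expand by (simp add: sym[of a b] mult.commute)
  qed
  show ?case
  proof (cases ls)
    case Nil
    then show ?thesis using less.prems by simp
  next
    case (Cons l t)
    then obtain l' t' where ls': "ls' = l' # t'" using less.prems by (cases ls') auto
    have len: "length t < length ls" "length t' < length ls"
      using Cons ls' mset_eq_length[OF less.prems] by auto
    show ?thesis
    proof (cases "l = l'")
      case True
      then have "mset t = mset t'" using Cons ls' less.prems by simp
      then show ?thesis unfolding Cons ls' by (simp only: R[OF len(1)] R[OF len(2)] True)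
    next
      case False
      have "add_mset l (mset t) = add_mset l' (mset t')" using Cons ls' less.prems by simp
      then obtain U where *: "mset t = add_mset l' U" "mset t' = add_mset l U"
        using False unfolding add_eq_conv_ex by blast
      have "Suc (Suc (size U)) = length ls"
        using arg_cong[OF *(1), of size] Cons by simp
      from swap[OF this, of l l'] show ?thesis
        unfolding Cons ls' R[OF len(1)] R[OF len(2)] * .
    qed
  qed
qed

locale symmetric_form =
  fixes B :: "'l \<Rightarrow> 'l \<Rightarrow> real"
  assumes sym: "B l m = B m l"
begin

lemma wick_mset: "wick B e (mset ls) = wick_list B e ls"
  unfolding wick_def by (rule wick_list_cong_mset[OF sym]) (metis (mono_tags) someI)

lemma wick_empty [simp]: "wick B e {#} = 1"
  using wick_mset[of e "[]"] by simp

lemma wick_add_mset: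
  "wick B e (add_mset l L) = e l * wick B e L - (\<Sum>m\<in>#L. B l m * wick B e (L - {#m#}))"
proof -
  obtain ls where ls: "mset ls = L" using ex_mset by blast
  have "wick B e (add_mset l L) = wick_list B e (l # ls)"
    using wick_mset[of e "l # ls"] ls by simp
  also have "\<dots> = e l * wick B e L - (\<Sum>m\<leftarrow>ls. B l m * wick B e (L - {#m#}))"
    by (simp add: ls[symmetric] wick_mset flip: mset_remove1)
  also have "(\<Sum>m\<leftarrow>ls. B l m * wick B e (L - {#m#})) = (\<Sum>m\<in>#L. B l m * wick B e (L - {#m#}))"
    unfolding ls[symmetric] by (rule sum_mset_mset[symmetric])
  finally show ?thesis .
qed

text \<open>The derivative of the Wick product when the value of each letter m moves at rate
  \<open>c m\<close>: as for a monomial, one letter at a time is replaced by its rate. The rate is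
  \<open>m h\<close> in \<open>has_derivative_wick\<close> and \<open>cov y (Y m)\<close> in
  \<open>stein_wick\<close>.\<close>

definition wick_diff :: "('l \<Rightarrow> real) \<Rightarrow> ('l \<Rightarrow> real) \<Rightarrow> 'l multiset \<Rightarrow> real" where
  "wick_diff c e L = (\<Sum>m\<in>#L. c m * wick B e (L - {#m#}))"

text \<open>This is the product rule applied to \<open>wick_add_mset\<close>. An operation that is
  linear and satisfies the product rule is therefore recognized as \<open>wick_diff\<close> by
  induction along the recursion.\<close>

lemma wick_diff_add_mset:
  "wick_diff c e (add_mset l L) =
     c l * wick B e L + e l * wick_diff c e L - (\<Sum>m\<in>#L. B l m * wick_diff c e (L - {#m#}))"
proof -
  define S where "S = (\<Sum>m\<in>#L. \<Sum>n\<in>#L - {#m#}. c m * B l n * wick B e (L - {#m#} - {#n#}))"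
  have "(\<Sum>m\<in>#L. c m * wick B e (add_mset l L - {#m#})) =
      (\<Sum>m\<in>#L. e l * (c m * wick B e (L - {#m#})) - (\<Sum>n\<in>#L - {#m#}. c m * B l n * wick B e (L - {#m#} - {#n#})))"
  proof (intro arg_cong[of _ _ sum_mset] image_mset_cong)
    fix m assume "m \<in># L"
    then have "add_mset l L - {#m#} = add_mset l (L - {#m#})" by simp
    then show "c m * wick B e (add_mset l L - {#m#}) =
      e l * (c m * wick B e (L - {#m#})) - (\<Sum>n\<in>#L - {#m#}. c m * B l n * wick B e (L - {#m#} - {#n#}))"
      by (simp add: wick_add_mset right_diff_distrib sum_mset_distrib_left multiset.map_comp o_def mult.assoc mult.left_commute)
  qed
  also have "\<dots> = e l * wick_diff c e L - S"
    by (simp add: sum_mset_diff sum_mset_distrib_left multiset.map_comp o_def wick_diff_def S_def)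
  also have "S = (\<Sum>m\<in>#L. B l m * wick_diff c e (L - {#m#}))"
    unfolding S_def wick_diff_def
    by (subst sum_mset_swap_pairs)
       (simp add: sum_mset_distrib_left multiset.map_comp o_def mult.assoc mult.left_commute diff_right_commute add_mset_commute)
  finally show ?thesis
    unfolding wick_diff_def[of c e "add_mset l L"] by simp
qed

text \<open>The recursion for \<open>wick\<close> descends both to L and to L without one letter;
  both are available as induction hypotheses.\<close>

lemma wick_induct [case_names empty add]:
  assumes "P {#}"
    and "\<And>l L. P L \<Longrightarrow> (\<And>m. m \<in># L \<Longrightarrow> P (L - {#m#})) \<Longrightarrow> P (add_mset l L)"
  shows "P L"
proof (induction "size L" arbitrary: L rule: less_induct)
  case less
  show ?case
  proof (cases L)
    case (add l N)
    show ?thesis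
      unfolding add by (intro assms(2) less) (auto simp: add size_Diff_singleton)
  qed (use assms(1) in simp)
qed

end

lemma has_derivative_wick:
  fixes B :: "('w::euclidean_space \<Rightarrow> real) \<Rightarrow> ('w \<Rightarrow> real) \<Rightarrow> real"
  assumes "symmetric_form B" "\<And>l. l \<in># L \<Longrightarrow> linear l"
  shows "((\<lambda>x. wick B (\<lambda>l. l x) L) has_derivative (\<lambda>h. symmetric_form.wick_diff B (\<lambda>l. l h) (\<lambda>l. l x) L)) (at x)"
proof -
  interpret symmetric_form B by fact
  show ?thesis
    using assms(2)
  proof (induction L rule: wick_induct)
    case empty
    show ?case by (simp add: wick_diff_def)
  next
    case (add l L)
    have l: "(l has_derivative l) (at x)"
      using add.prems by (intro linear_imp_has_derivative) simp
    have L: "((\<lambda>x. wick B (\<lambda>l. l x) L) has_derivative (\<lambda>h. wick_diff (\<lambda>l. l h) (\<lambda>l. l x) L)) (at x)"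
      using add.prems by (intro add.IH(1)) simp
    have minus: "((\<lambda>x. wick B (\<lambda>l. l x) (L - {#m#})) has_derivative
          (\<lambda>h. wick_diff (\<lambda>l. l h) (\<lambda>l. l x) (L - {#m#}))) (at x)" if "m \<in># L" for m
      using add.prems by (intro add.IH(2)[OF that]) (auto dest: in_diffD)
    \<comment> \<open>The range N of the sum is detached from the L in the summand, so that an
      induction can shrink the former and keep the latter.\<close>
    have S: "((\<lambda>x. \<Sum>m\<in>#N. B l m * wick B (\<lambda>l. l x) (L - {#m#})) has_derivative
        (\<lambda>h. \<Sum>m\<in>#N. B l m * wick_diff (\<lambda>l. l h) (\<lambda>l. l x) (L - {#m#}))) (at x)" if "N \<subseteq># L" for N
      using that
    proof (induction N)
      case (add m N)
      then have m: "m \<in># L" and N: "N \<subseteq># L"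
        by (auto simp: insert_subset_eq_iff intro: subset_mset.order_trans[OF _ diff_subset_eq_self])
      have "((\<lambda>x. wick B (\<lambda>l. l x) (L - {#m#})) has_derivative
          (\<lambda>h. wick_diff (\<lambda>l. l h) (\<lambda>l. l x) (L - {#m#}))) (at x)"
        by (rule minus[OF m])
      with N show ?case
        using add.IH by (auto intro!: has_derivative_add has_derivative_mult_right)
    qed simp
    show ?case
      unfolding wick_add_mset wick_diff_add_mset
      by (rule has_derivative_eq_rhs[OF has_derivative_diff[OF has_derivative_mult[OF l L] S[OF subset_mset.order_refl]]])
         (simp add: fun_eq_iff algebra_simps)
  qed
qed

section \<open>Integration by parts for Wick polynomials of Gaussian variables\<close>

locale wick_space = gaussian_space M G + symmetric_form B
  for M :: "'a measure" and G :: "('a \<Rightarrow> real) set" and B :: "'l \<Rightarrow> 'l \<Rightarrow> real"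
begin

lemma all_moments_wick:
  "(\<And>l. l \<in># L \<Longrightarrow> Y l \<in> G) \<Longrightarrow> (\<lambda>\<omega>. wick B (\<lambda>l. Y l \<omega>) L) \<in> all_moments M"
proof (induction L rule: wick_induct)
  case empty
  show ?case by (simp add: all_moments_const)
next
  case (add l L)
  have "(\<lambda>\<omega>. wick B (\<lambda>l. Y l \<omega>) (L - {#m#})) \<in> all_moments M" if "m \<in># L" for m
    using add.prems by (intro add.IH(2)[OF that]) (auto dest: in_diffD)
  with add show ?case
    unfolding wick_add_mset
    by (intro all_moments_diff all_moments_mult all_moments_msum) (auto intro: moments)
qed

text \<open>\<open>D\<close> is the derivative of the polynomial \<open>P\<close> in the direction given by \<open>cov y\<close>.\<close>

definition stein :: "('a \<Rightarrow> real) \<Rightarrow> ('a \<Rightarrow> real) \<Rightarrow> ('a \<Rightarrow> real) \<Rightarrow> bool" where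
  "stein y P D \<longleftrightarrow> P \<in> all_moments M \<and> D \<in> all_moments M \<and>
     (\<forall>L. set_mset L \<subseteq> G \<longrightarrow>
        expectation (\<lambda>\<omega>. y \<omega> * P \<omega> * (\<Prod>m\<in>#L. m \<omega>)) =
        expectation (\<lambda>\<omega>. D \<omega> * (\<Prod>m\<in>#L. m \<omega>)) +
        (\<Sum>m\<in>#L. cov y m * expectation (\<lambda>\<omega>. P \<omega> * (\<Prod>n\<in>#L - {#m#}. n \<omega>))))"

lemma stein_const:
  assumes "y \<in> G"
  shows "stein y (\<lambda>_. a) (\<lambda>_. 0)"
  unfolding stein_def
proof (intro conjI allI impI all_moments_const)
  fix L assume L: "set_mset L \<subseteq> G"
  have "expectation (\<lambda>\<omega>. y \<omega> * a * (\<Prod>m\<in>#L. m \<omega>)) = a * expectation (\<lambda>\<omega>. y \<omega> * (\<Prod>m\<in>#L. m \<omega>))"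
    by (simp flip: integral_mult_right_zero add: mult.left_commute mult.assoc)
  also have "\<dots> = (\<Sum>m\<in>#L. cov y m * (a * expectation (\<lambda>\<omega>. \<Prod>n\<in>#L - {#m#}. n \<omega>)))"
    using isserlis_mset[of "\<lambda>y. y" y L] assms L
    by (simp add: subset_iff sum_mset_distrib_left multiset.map_comp o_def mult.left_commute)
  finally show "expectation (\<lambda>\<omega>. y \<omega> * a * (\<Prod>m\<in>#L. m \<omega>)) =
        expectation (\<lambda>\<omega>. 0 * (\<Prod>m\<in>#L. m \<omega>)) +
        (\<Sum>m\<in>#L. cov y m * expectation (\<lambda>\<omega>. a * (\<Prod>n\<in>#L - {#m#}. n \<omega>)))"
    by simp
qed

text \<open>The test product L is arbitrary in \<open>stein\<close>, so the new factor l can be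
  moved into it. Its contraction \<open>cov y l\<close> is then the product-rule term of the
  derivative; the contractions with the other letters stay where they were.\<close>

lemma stein_mult:
  assumes y: "y \<in> G" and P: "stein y P D" and l: "l \<in> G"
  shows "stein y (\<lambda>\<omega>. l \<omega> * P \<omega>) (\<lambda>\<omega>. cov y l * P \<omega> + l \<omega> * D \<omega>)"
proof -
  have PD: "P \<in> all_moments M" "D \<in> all_moments M" using P by (auto simp: stein_def)
  have *: "expectation (\<lambda>\<omega>. y \<omega> * (l \<omega> * P \<omega>) * (\<Prod>m\<in>#L. m \<omega>)) =
        expectation (\<lambda>\<omega>. (cov y l * P \<omega> + l \<omega> * D \<omega>) * (\<Prod>m\<in>#L. m \<omega>)) +
        (\<Sum>m\<in>#L. cov y m * expectation (\<lambda>\<omega>. l \<omega> * P \<omega> * (\<Prod>n\<in>#L - {#m#}. n \<omega>)))"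
    if L: "set_mset L \<subseteq> G" for L
  proof -
    have prod: "(\<lambda>\<omega>. \<Prod>m\<in>#L. m \<omega>) \<in> all_moments M"
      using L by (intro all_moments_mprod moments) auto
    have int: "integrable M (\<lambda>\<omega>. cov y l * (P \<omega> * (\<Prod>m\<in>#L. m \<omega>)))"
      "integrable M (\<lambda>\<omega>. l \<omega> * D \<omega> * (\<Prod>m\<in>#L. m \<omega>))"
      by (intro all_moments_integrable all_moments_mult all_moments_const PD prod moments[OF l])+
    have "expectation (\<lambda>\<omega>. y \<omega> * (l \<omega> * P \<omega>) * (\<Prod>m\<in>#L. m \<omega>)) =
        expectation (\<lambda>\<omega>. y \<omega> * P \<omega> * (\<Prod>m\<in>#add_mset l L. m \<omega>))"
      by (simp add: ac_simps)
    also have "\<dots> = expectation (\<lambda>\<omega>. D \<omega> * (\<Prod>m\<in>#add_mset l L. m \<omega>)) +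
        (\<Sum>m\<in>#add_mset l L. cov y m * expectation (\<lambda>\<omega>. P \<omega> * (\<Prod>n\<in>#add_mset l L - {#m#}. n \<omega>)))"
      using P L l by (simp only: stein_def set_mset_add_mset_insert insert_subset simp_thms)
    also have "(\<Sum>m\<in>#add_mset l L. cov y m * expectation (\<lambda>\<omega>. P \<omega> * (\<Prod>n\<in>#add_mset l L - {#m#}. n \<omega>))) =
        cov y l * expectation (\<lambda>\<omega>. P \<omega> * (\<Prod>n\<in>#L. n \<omega>)) +
        (\<Sum>m\<in>#L. cov y m * expectation (\<lambda>\<omega>. P \<omega> * (\<Prod>n\<in>#add_mset l L - {#m#}. n \<omega>)))"
      by simp
    also have "(\<Sum>m\<in>#L. cov y m * expectation (\<lambda>\<omega>. P \<omega> * (\<Prod>n\<in>#add_mset l L - {#m#}. n \<omega>))) =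
        (\<Sum>m\<in>#L. cov y m * expectation (\<lambda>\<omega>. l \<omega> * P \<omega> * (\<Prod>n\<in>#L - {#m#}. n \<omega>)))"
      by (intro arg_cong[of _ _ sum_mset] image_mset_cong) (simp add: ac_simps)
    also have "expectation (\<lambda>\<omega>. D \<omega> * (\<Prod>m\<in>#add_mset l L. m \<omega>)) +
        (cov y l * expectation (\<lambda>\<omega>. P \<omega> * (\<Prod>n\<in>#L. n \<omega>)) + R) =
        expectation (\<lambda>\<omega>. (cov y l * P \<omega> + l \<omega> * D \<omega>) * (\<Prod>m\<in>#L. m \<omega>)) + R" for R
    proof -
      have "expectation (\<lambda>\<omega>. (cov y l * P \<omega> + l \<omega> * D \<omega>) * (\<Prod>m\<in>#L. m \<omega>)) =
          expectation (\<lambda>\<omega>. cov y l * (P \<omega> * (\<Prod>m\<in>#L. m \<omega>)) + l \<omega> * D \<omega> * (\<Prod>m\<in>#L. m \<omega>))"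
        by (simp add: algebra_simps)
      also have "\<dots> = cov y l * expectation (\<lambda>\<omega>. P \<omega> * (\<Prod>m\<in>#L. m \<omega>)) + expectation (\<lambda>\<omega>. l \<omega> * D \<omega> * (\<Prod>m\<in>#L. m \<omega>))"
        by (simp only: Bochner_Integration.integral_add[OF int] integral_mult_right_zero)
      also have "(\<lambda>\<omega>. l \<omega> * D \<omega> * (\<Prod>m\<in>#L. m \<omega>)) = (\<lambda>\<omega>. D \<omega> * (\<Prod>m\<in>#add_mset l L. m \<omega>))"
        by (simp add: ac_simps)
      finally show ?thesis by simp
    qed
    finally show ?thesis .
  qed
  then show ?thesis
    unfolding stein_def by (intro conjI allI impI all_moments_add all_moments_mult all_moments_const PD moments[OF l])
qed

lemma stein_add_mult:
  assumes y: "y \<in> G" and P: "stein y P D" and Q: "stein y Q E"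
  shows "stein y (\<lambda>\<omega>. P \<omega> + a * Q \<omega>) (\<lambda>\<omega>. D \<omega> + a * E \<omega>)"
proof -
  have mom: "P \<in> all_moments M" "D \<in> all_moments M" "Q \<in> all_moments M" "E \<in> all_moments M"
    using P Q by (auto simp: stein_def)
  have lin: "expectation (\<lambda>\<omega>. R \<omega> * (U \<omega> + a * V \<omega>) * S \<omega>) =
      expectation (\<lambda>\<omega>. R \<omega> * U \<omega> * S \<omega>) + a * expectation (\<lambda>\<omega>. R \<omega> * V \<omega> * S \<omega>)"
    if "R \<in> all_moments M" "S \<in> all_moments M" "U \<in> all_moments M" "V \<in> all_moments M" for R S U V
  proof -
    have "expectation (\<lambda>\<omega>. R \<omega> * (U \<omega> + a * V \<omega>) * S \<omega>) = expectation (\<lambda>\<omega>. R \<omega> * U \<omega> * S \<omega> + a * (R \<omega> * V \<omega> * S \<omega>))"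
      by (simp add: algebra_simps)
    then show ?thesis
      using that by (simp add: all_moments_integrable all_moments_mult)
  qed
  have lin': "expectation (\<lambda>\<omega>. (U \<omega> + a * V \<omega>) * S \<omega>) = expectation (\<lambda>\<omega>. U \<omega> * S \<omega>) + a * expectation (\<lambda>\<omega>. V \<omega> * S \<omega>)"
    if "S \<in> all_moments M" "U \<in> all_moments M" "V \<in> all_moments M" for S U V
    using lin[OF all_moments_const[of 1] that] by simp
  have prod: "(\<lambda>\<omega>. \<Prod>m\<in>#L. m \<omega>) \<in> all_moments M" if "set_mset L \<subseteq> G" for L
    using that by (intro all_moments_mprod moments) auto
  have *: "expectation (\<lambda>\<omega>. y \<omega> * (P \<omega> + a * Q \<omega>) * (\<Prod>m\<in>#L. m \<omega>)) =
        expectation (\<lambda>\<omega>. (D \<omega> + a * E \<omega>) * (\<Prod>m\<in>#L. m \<omega>)) +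
        (\<Sum>m\<in>#L. cov y m * expectation (\<lambda>\<omega>. (P \<omega> + a * Q \<omega>) * (\<Prod>n\<in>#L - {#m#}. n \<omega>)))"
    if L: "set_mset L \<subseteq> G" for L
  proof -
    have "(\<Sum>m\<in>#L. cov y m * expectation (\<lambda>\<omega>. (P \<omega> + a * Q \<omega>) * (\<Prod>n\<in>#L - {#m#}. n \<omega>))) =
      (\<Sum>m\<in>#L. cov y m * expectation (\<lambda>\<omega>. P \<omega> * (\<Prod>n\<in>#L - {#m#}. n \<omega>)) +
        a * (cov y m * expectation (\<lambda>\<omega>. Q \<omega> * (\<Prod>n\<in>#L - {#m#}. n \<omega>))))"
    proof (intro arg_cong[of _ _ sum_mset] image_mset_cong)
      fix m
      have "set_mset (L - {#m#}) \<subseteq> G" using L by (auto dest: in_diffD)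
      from lin'[OF prod[OF this] mom(1,3)]
      show "cov y m * expectation (\<lambda>\<omega>. (P \<omega> + a * Q \<omega>) * (\<Prod>n\<in>#L - {#m#}. n \<omega>)) =
        cov y m * expectation (\<lambda>\<omega>. P \<omega> * (\<Prod>n\<in>#L - {#m#}. n \<omega>)) +
        a * (cov y m * expectation (\<lambda>\<omega>. Q \<omega> * (\<Prod>n\<in>#L - {#m#}. n \<omega>)))"
        by (simp add: algebra_simps)
    qed
    also have "\<dots> = (\<Sum>m\<in>#L. cov y m * expectation (\<lambda>\<omega>. P \<omega> * (\<Prod>n\<in>#L - {#m#}. n \<omega>))) +
        a * (\<Sum>m\<in>#L. cov y m * expectation (\<lambda>\<omega>. Q \<omega> * (\<Prod>n\<in>#L - {#m#}. n \<omega>)))"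
      by (simp add: sum_mset.distrib sum_mset_distrib_left multiset.map_comp o_def)
    finally have 1: "(\<Sum>m\<in>#L. cov y m * expectation (\<lambda>\<omega>. (P \<omega> + a * Q \<omega>) * (\<Prod>n\<in>#L - {#m#}. n \<omega>))) = \<dots>" .
    have "expectation (\<lambda>\<omega>. y \<omega> * P \<omega> * (\<Prod>m\<in>#L. m \<omega>)) =
        expectation (\<lambda>\<omega>. D \<omega> * (\<Prod>m\<in>#L. m \<omega>)) +
        (\<Sum>m\<in>#L. cov y m * expectation (\<lambda>\<omega>. P \<omega> * (\<Prod>n\<in>#L - {#m#}. n \<omega>)))"
      "expectation (\<lambda>\<omega>. y \<omega> * Q \<omega> * (\<Prod>m\<in>#L. m \<omega>)) =
        expectation (\<lambda>\<omega>. E \<omega> * (\<Prod>m\<in>#L. m \<omega>)) +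
        (\<Sum>m\<in>#L. cov y m * expectation (\<lambda>\<omega>. Q \<omega> * (\<Prod>n\<in>#L - {#m#}. n \<omega>)))"
      using P Q L unfolding stein_def by blast+
    then show ?thesis
      unfolding 1 lin[OF moments[OF y] prod[OF L] mom(1,3)] lin'[OF prod[OF L] mom(2,4)]
      by (simp only: distrib_left add.assoc add.left_commute)
  qed
  then show ?thesis
    unfolding stein_def by (intro conjI allI impI all_moments_add all_moments_mult all_moments_const mom)
qed

lemma stein_cong: "stein y P D \<Longrightarrow> P = P' \<Longrightarrow> D = D' \<Longrightarrow> stein y P' D'"
  by simp

lemma stein_msum:
  assumes "y \<in> G" "\<And>m. m \<in># L \<Longrightarrow> stein y (P m) (D m)"
  shows "stein y (\<lambda>\<omega>. \<Sum>m\<in>#L. a m * P m \<omega>) (\<lambda>\<omega>. \<Sum>m\<in>#L. a m * D m \<omega>)"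
  using assms(2)
proof (induction L)
  case empty
  show ?case using stein_const[OF assms(1), of 0] by simp
next
  case (add m L)
  then have "stein y (\<lambda>\<omega>. (\<Sum>m\<in>#L. a m * P m \<omega>) + a m * P m \<omega>) (\<lambda>\<omega>. (\<Sum>m\<in>#L. a m * D m \<omega>) + a m * D m \<omega>)"
    by (intro stein_add_mult assms(1) add.IH add.prems) auto
  then show ?case by (simp add: add.commute)
qed

text \<open>Induction along \<open>wick_add_mset\<close>, with \<open>wick_diff_add_mset\<close> for
  the derivative. The factor Q allows a second application, which gives the Leibniz rule for a
  product of two Wick polynomials.\<close>

lemma stein_wick:
  assumes y: "y \<in> G" and Q: "stein y Q E" and L: "\<And>l. l \<in># L \<Longrightarrow> Y l \<in> G"
  shows "stein y (\<lambda>\<omega>. wick B (\<lambda>l. Y l \<omega>) L * Q \<omega>)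
    (\<lambda>\<omega>. wick_diff (\<lambda>l. cov y (Y l)) (\<lambda>l. Y l \<omega>) L * Q \<omega> + wick B (\<lambda>l. Y l \<omega>) L * E \<omega>)"
  using L
proof (induction L rule: wick_induct)
  case empty
  show ?case using Q by (simp add: wick_diff_def)
next
  case (add l L)
  let ?W = "\<lambda>L \<omega>. wick B (\<lambda>l. Y l \<omega>) L" and ?D = "\<lambda>L \<omega>. wick_diff (\<lambda>l. cov y (Y l)) (\<lambda>l. Y l \<omega>) L"
  have 1: "stein y (\<lambda>\<omega>. ?W L \<omega> * Q \<omega>) (\<lambda>\<omega>. ?D L \<omega> * Q \<omega> + ?W L \<omega> * E \<omega>)"
    using add.prems by (intro add.IH(1)) simp
  have 2: "stein y (\<lambda>\<omega>. ?W (L - {#m#}) \<omega> * Q \<omega>) (\<lambda>\<omega>. ?D (L - {#m#}) \<omega> * Q \<omega> + ?W (L - {#m#}) \<omega> * E \<omega>)"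
    if "m \<in># L" for m
    using add.prems by (intro add.IH(2)[OF that]) (auto dest: in_diffD)
  have "Y l \<in> G" using add.prems by simp
  have 3: "stein y (\<lambda>\<omega>. \<Sum>m\<in>#L. B l m * (?W (L - {#m#}) \<omega> * Q \<omega>))
      (\<lambda>\<omega>. \<Sum>m\<in>#L. B l m * (?D (L - {#m#}) \<omega> * Q \<omega> + ?W (L - {#m#}) \<omega> * E \<omega>))"
    by (rule stein_msum[OF y]) (rule 2)
  define S where "S \<omega> = (\<Sum>m\<in>#L. B l m * ?W (L - {#m#}) \<omega>)" for \<omega>
  define S' where "S' \<omega> = (\<Sum>m\<in>#L. B l m * ?D (L - {#m#}) \<omega>)" for \<omega>
  have S: "(\<Sum>m\<in>#L. B l m * (?W (L - {#m#}) \<omega> * Q \<omega>)) = S \<omega> * Q \<omega>" for \<omega>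
    by (simp only: S_def sum_mset_mult_right mult.assoc)
  have S': "(\<Sum>m\<in>#L. B l m * (?D (L - {#m#}) \<omega> * Q \<omega> + ?W (L - {#m#}) \<omega> * E \<omega>)) = S' \<omega> * Q \<omega> + S \<omega> * E \<omega>" for \<omega>
    by (simp only: S_def S'_def sum_mset_mult_right sum_mset.distrib[symmetric] distrib_left mult.assoc)
  have "stein y (\<lambda>\<omega>. Y l \<omega> * (?W L \<omega> * Q \<omega>) + -1 * (S \<omega> * Q \<omega>))
     (\<lambda>\<omega>. cov y (Y l) * (?W L \<omega> * Q \<omega>) + Y l \<omega> * (?D L \<omega> * Q \<omega> + ?W L \<omega> * E \<omega>) + -1 * (S' \<omega> * Q \<omega> + S \<omega> * E \<omega>))"
    by (rule stein_add_mult[OF y stein_mult[OF y 1 \<open>Y l \<in> G\<close>] 3[unfolded S S']])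
  then show ?case
    unfolding wick_add_mset wick_diff_add_mset S_def[symmetric] S'_def[symmetric]
    by (rule stein_cong) (simp_all add: fun_eq_iff algebra_simps)
qed

text \<open>Integration by parts with y = Y l contracts l with the letters of both products. The
  contractions inside the first product have covariance B, so they are exactly what the recursion
  for \<open>wick\<close> subtracts; the contractions with N remain.\<close>

lemma expectation_wick_wick:
  assumes L: "\<And>m. m \<in># add_mset l L \<Longrightarrow> Y m \<in> G" and N: "\<And>m. m \<in># N \<Longrightarrow> Z m \<in> G"
    and B: "\<And>m. m \<in># L \<Longrightarrow> cov (Y l) (Y m) = B l m"
  shows "expectation (\<lambda>\<omega>. wick B (\<lambda>l. Y l \<omega>) (add_mset l L) * wick B (\<lambda>l. Z l \<omega>) N) =
    (\<Sum>m\<in>#N. cov (Y l) (Z m) * expectation (\<lambda>\<omega>. wick B (\<lambda>l. Y l \<omega>) L * wick B (\<lambda>l. Z l \<omega>) (N - {#m#})))"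
proof -
  let ?W = "\<lambda>L \<omega>. wick B (\<lambda>l. Y l \<omega>) L" and ?V = "\<lambda>N \<omega>. wick B (\<lambda>l. Z l \<omega>) N"
  have y: "Y l \<in> G" using L by simp
  have mW: "?W K \<in> all_moments M" if "K \<subseteq># add_mset l L" for K
    using L mset_subset_eqD[OF that] by (intro all_moments_wick) auto
  have mV: "?V K \<in> all_moments M" if "K \<subseteq># N" for K
    using N mset_subset_eqD[OF that] by (intro all_moments_wick) auto
  have "stein (Y l) (\<lambda>\<omega>. ?V N \<omega> * 1) (\<lambda>\<omega>. wick_diff (\<lambda>m. cov (Y l) (Z m)) (\<lambda>l. Z l \<omega>) N * 1 + ?V N \<omega> * 0)"
    by (rule stein_wick[OF y stein_const[OF y] N])
  then have "stein (Y l) (\<lambda>\<omega>. ?W L \<omega> * (?V N \<omega> * 1)) (\<lambda>\<omega>. wick_diff (\<lambda>m. cov (Y l) (Y m)) (\<lambda>l. Y l \<omega>) L * (?V N \<omega> * 1) +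
      ?W L \<omega> * (wick_diff (\<lambda>m. cov (Y l) (Z m)) (\<lambda>l. Z l \<omega>) N * 1 + ?V N \<omega> * 0))"
    by (rule stein_wick[OF y]) (use L in auto)
  \<comment> \<open>The integration by parts identity with the empty test product.\<close>
  then have *: "expectation (\<lambda>\<omega>. Y l \<omega> * (?W L \<omega> * ?V N \<omega>)) = expectation (\<lambda>\<omega>. wick_diff (\<lambda>m. cov (Y l) (Y m)) (\<lambda>l. Y l \<omega>) L * ?V N \<omega> +
      ?W L \<omega> * wick_diff (\<lambda>m. cov (Y l) (Z m)) (\<lambda>l. Z l \<omega>) N)"
    unfolding stein_def by (auto dest!: spec[of _ "{#}"])
  have diff: "wick_diff (\<lambda>m. cov (Y l) (Y m)) (\<lambda>l. Y l \<omega>) L = (\<Sum>m\<in>#L. B l m * ?W (L - {#m#}) \<omega>)" for \<omega>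
    unfolding wick_diff_def by (intro arg_cong[of _ _ sum_mset] image_mset_cong) (simp add: B)
  have mD: "(\<lambda>\<omega>. \<Sum>m\<in>#L. B l m * ?W (L - {#m#}) \<omega>) \<in> all_moments M"
    by (intro all_moments_msum mW) (simp add: diff_subset_eq_self subset_mset.order_trans[OF diff_subset_eq_self])
  have mE: "(\<lambda>\<omega>. wick_diff (\<lambda>m. cov (Y l) (Z m)) (\<lambda>l. Z l \<omega>) N) \<in> all_moments M"
    unfolding wick_diff_def by (intro all_moments_msum mV) simp
  have LW: "?W L \<in> all_moments M" by (rule mW) simp
  have NV: "?V N \<in> all_moments M" by (rule mV) simp
  note ints = all_moments_integrable all_moments_mult mD mE LW NV moments[OF y]
  have "expectation (\<lambda>\<omega>. ?W (add_mset l L) \<omega> * ?V N \<omega>) =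
      expectation (\<lambda>\<omega>. Y l \<omega> * (?W L \<omega> * ?V N \<omega>) - (\<Sum>m\<in>#L. B l m * ?W (L - {#m#}) \<omega>) * ?V N \<omega>)"
    unfolding wick_add_mset by (simp add: algebra_simps)
  also have "\<dots> = expectation (\<lambda>\<omega>. Y l \<omega> * (?W L \<omega> * ?V N \<omega>)) - expectation (\<lambda>\<omega>. (\<Sum>m\<in>#L. B l m * ?W (L - {#m#}) \<omega>) * ?V N \<omega>)"
    by (intro Bochner_Integration.integral_diff ints)
  also have "\<dots> = expectation (\<lambda>\<omega>. ?W L \<omega> * wick_diff (\<lambda>m. cov (Y l) (Z m)) (\<lambda>l. Z l \<omega>) N)"
    unfolding * diff
    by (subst Bochner_Integration.integral_add) (auto intro!: ints)
  also have "\<dots> = expectation (\<lambda>\<omega>. \<Sum>m\<in>#N. cov (Y l) (Z m) * (?W L \<omega> * ?V (N - {#m#}) \<omega>))"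
    unfolding wick_diff_def by (simp add: sum_mset_distrib_left multiset.map_comp o_def mult.left_commute)
  also have "\<dots> = (\<Sum>m\<in>#N. cov (Y l) (Z m) * expectation (\<lambda>\<omega>. ?W L \<omega> * ?V (N - {#m#}) \<omega>))"
    by (intro expectation_msum all_moments_mult LW mV) simp
  finally show ?thesis .
qed

end

section \<open>Sums over multi-indices and permanents\<close>

lemma sum_multi_indices_insert:
  fixes g :: "'w::euclidean_space list \<Rightarrow> 'a::comm_monoid_add"
  assumes "i \<le> q"
  shows "(\<Sum>cs\<in>multi_indices (Suc q). g cs) = (\<Sum>d\<in>Basis. \<Sum>cs\<in>multi_indices q. g (take i cs @ d # drop i cs))"
  unfolding sum.cartesian_product
proof (rule sum.reindex_bij_witness[where i = "\<lambda>(d, cs). take i cs @ d # drop i cs"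
      and j = "\<lambda>cs. (cs ! i, take i cs @ drop (Suc i) cs)"])
  fix cs :: "'w list" assume cs: "cs \<in> multi_indices (Suc q)"
  then have len: "i < length cs" using assms by (simp add: multi_indices_def)
  show "(case (cs ! i, take i cs @ drop (Suc i) cs) of (d, cs) \<Rightarrow> take i cs @ d # drop i cs) = cs"
    using len by (simp add: min_def id_take_nth_drop[symmetric])
  have "cs ! i \<in> Basis" "set (take i cs @ drop (Suc i) cs) \<subseteq> Basis"
    using cs len set_take_subset[of i cs] set_drop_subset[of "Suc i" cs] by (auto simp: multi_indices_def)
  then show "(cs ! i, take i cs @ drop (Suc i) cs) \<in> Basis \<times> multi_indices q"
    using cs assms by (auto simp: multi_indices_def)
  show "(case (cs ! i, take i cs @ drop (Suc i) cs) of (d, cs) \<Rightarrow> g (take i cs @ d # drop i cs)) = g cs"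
    using len by (simp add: min_def id_take_nth_drop[symmetric])
next
  fix x :: "'w \<times> 'w list" assume x: "x \<in> Basis \<times> multi_indices q"
  obtain d cs where [simp]: "x = (d, cs)" by (cases x)
  from x assms have len: "i \<le> length cs" "length cs = q" "d \<in> Basis" "set cs \<subseteq> Basis" by (auto simp: multi_indices_def)
  show "((case x of (d, cs) \<Rightarrow> take i cs @ d # drop i cs) ! i,
      take i (case x of (d, cs) \<Rightarrow> take i cs @ d # drop i cs) @ drop (Suc i) (case x of (d, cs) \<Rightarrow> take i cs @ d # drop i cs)) = x"
    using len by (simp add: nth_append)
  show "(case x of (d, cs) \<Rightarrow> take i cs @ d # drop i cs) \<in> multi_indices (Suc q)"
    using len set_take_subset[of i cs] set_drop_subset[of i cs] by (auto simp: multi_indices_def)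
qed

text \<open>The recursion makes \<open>K bs cs\<close> the permanent of the matrix with entries C(b,
  c), expanded along its first row. Since F is symmetric, each of the q! permutations contributes
  the same sum over \<open>cs\<close>.\<close>

lemma sum_multi_indices_permanent:
  fixes K :: "'w::euclidean_space list \<Rightarrow> 'w list \<Rightarrow> real"
  assumes "\<And>cs cs'. mset cs = mset cs' \<Longrightarrow> F cs = F cs'"
    and "K [] [] = 1"
    and rec: "\<And>b bs cs. length cs = Suc (length bs) \<Longrightarrow> set (b # bs) \<subseteq> Basis \<Longrightarrow> set cs \<subseteq> Basis \<Longrightarrow>
      K (b # bs) cs = (\<Sum>i<length cs. C b (cs ! i) * K bs (take i cs @ drop (Suc i) cs))"
    and "bs \<in> multi_indices q"
  shows "(\<Sum>cs\<in>multi_indices q. F cs * K bs cs) = fact q * (\<Sum>cs\<in>multi_indices q. F cs * (\<Prod>k<q. C (bs ! k) (cs ! k)))"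
  using assms(1,4)
proof (induction q arbitrary: F bs)
  case 0
  have "multi_indices 0 = {[] :: 'w list}" by (auto simp: multi_indices_def)
  then show ?case using 0(2) assms(2) by simp
next
  case (Suc q)
  obtain b bs' where bs: "bs = b # bs'" "bs' \<in> multi_indices q" "set (b # bs') \<subseteq> Basis"
    using Suc.prems(2) by (cases bs) (auto simp: multi_indices_def)
  let ?P = "\<lambda>d. \<Sum>cs\<in>multi_indices q. F (d # cs) * (\<Prod>k<q. C (bs' ! k) (cs ! k))"
  have "(\<Sum>cs\<in>multi_indices (Suc q). F cs * K bs cs) =
      (\<Sum>cs\<in>multi_indices (Suc q). \<Sum>i<Suc q. F cs * (C b (cs ! i) * K bs' (take i cs @ drop (Suc i) cs)))"
  proof (rule sum.cong[OF refl])
    fix cs :: "'w list" assume "cs \<in> multi_indices (Suc q)"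
    then have "length cs = Suc q" "set cs \<subseteq> Basis" by (auto simp: multi_indices_def)
    with bs rec[of cs bs' b] show "F cs * K bs cs = (\<Sum>i<Suc q. F cs * (C b (cs ! i) * K bs' (take i cs @ drop (Suc i) cs)))"
      by (simp add: multi_indices_def sum_distrib_left del: sum.lessThan_Suc)
  qed
  also have "\<dots> = (\<Sum>i<Suc q. \<Sum>cs\<in>multi_indices (Suc q). F cs * (C b (cs ! i) * K bs' (take i cs @ drop (Suc i) cs)))"
    by (rule sum.swap)
  \<comment> \<open>The partner d of the first letter is moved from position i to the front, which F
    does not notice. The result does not depend on i, so the q + 1 positions turn the factor q! into
    (q + 1)!.\<close>
  also have "\<dots> = (\<Sum>i<Suc q. \<Sum>d\<in>Basis. C b d * (fact q * ?P d))"
  proof (rule sum.cong[OF refl])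
    fix i assume i: "i \<in> {..<Suc q}"
    have "(\<Sum>cs\<in>multi_indices (Suc q). F cs * (C b (cs ! i) * K bs' (take i cs @ drop (Suc i) cs))) =
      (\<Sum>d\<in>Basis. \<Sum>cs\<in>multi_indices q. C b d * (F (d # cs) * K bs' cs))"
    proof (subst sum_multi_indices_insert[of i], goal_cases)
      case 2
      show ?case
      proof (intro sum.cong refl, goal_cases)
        case (1 d cs)
        then have "length cs = q" by (simp add: multi_indices_def)
        moreover have "F (take i cs @ d # drop i cs) = F (d # cs)"
        proof (rule Suc.prems(1))
          have "mset (take i cs) + mset (drop i cs) = mset cs"
            by (metis append_take_drop_id mset_append)
          then show "mset (take i cs @ d # drop i cs) = mset (d # cs)" by simp
        qed
        ultimately show ?case using i by (simp add: nth_append min_def)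
      qed
    qed (use i in simp)
    also have "\<dots> = (\<Sum>d\<in>Basis. C b d * (fact q * ?P d))"
      unfolding sum_distrib_left[symmetric]
      using Suc.prems(1) bs(2) by (intro sum.cong refl arg_cong[where f="(*) _"] Suc.IH) auto
    finally show "(\<Sum>cs\<in>multi_indices (Suc q). F cs * (C b (cs ! i) * K bs' (take i cs @ drop (Suc i) cs))) = \<dots>" .
  qed
  also have "\<dots> = fact (Suc q) * (\<Sum>d\<in>Basis. C b d * ?P d)"
    by (simp add: sum_distrib_left algebra_simps)
  also have "(\<Sum>d\<in>Basis. C b d * ?P d) = (\<Sum>cs\<in>multi_indices (Suc q). F cs * (\<Prod>k<Suc q. C (bs ! k) (cs ! k)))"
    by (subst sum_multi_indices_insert[of 0])
       (simp_all add: bs sum_distrib_left prod.lessThan_Suc_shift mult.left_commute del: prod.lessThan_Suc)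
  finally show ?case .
qed


subsection \<open>Hermite forms as Wick polynomials\<close>

abbreviation coord :: "'w::euclidean_space \<Rightarrow> 'w \<Rightarrow> real" where
  "coord b \<equiv> \<lambda>x. x \<bullet> b"

lemma linear_expansion:
  fixes l :: "'w::euclidean_space \<Rightarrow> real"
  assumes "linear l"
  shows "l = (\<lambda>x. \<Sum>b\<in>Basis. l b * coord b x)"
proof
  fix x
  have "l x = l (\<Sum>b\<in>Basis. (x \<bullet> b) *\<^sub>R b)" by (simp add: euclidean_representation)
  also have "\<dots> = (\<Sum>b\<in>Basis. l b * (x \<bullet> b))"
    by (simp add: linear_sum[OF assms] linear_scale[OF assms] mult.commute)
  finally show "l x = (\<Sum>b\<in>Basis. l b * (x \<bullet> b))" .
qed

lemma linear_mult_const: "linear l \<Longrightarrow> linear (\<lambda>x. c * l x :: real)"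
  using linear_compose_scale_right[of l c] by simp

lemma linear_sum_mult: "(\<And>i. i \<in> I \<Longrightarrow> linear (l i)) \<Longrightarrow> linear (\<lambda>x. \<Sum>i\<in>I. c i * l i x :: real)"
  by (intro linear_compose_sum ballI linear_mult_const)

text \<open>Bilinearity is asked for linear arguments only: the type \<open>'w => real\<close> also
  contains functions outside the dual space, for which the integral that defines a covariance may
  fail to converge.\<close>

locale scalar_product = symmetric_form B
  for B :: "('w::euclidean_space \<Rightarrow> real) \<Rightarrow> ('w \<Rightarrow> real) \<Rightarrow> real" +
  assumes add_left: "linear l \<Longrightarrow> linear l' \<Longrightarrow> linear m \<Longrightarrow> B (\<lambda>x. l x + l' x) m = B l m + B l' m"
    and mult_left: "linear l \<Longrightarrow> linear m \<Longrightarrow> B (\<lambda>x. c * l x) m = c * B l m"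
    and pos_def: "positive_definite_form B"
begin

lemma sum_left:
  assumes "linear m" "finite I" "\<And>i. i \<in> I \<Longrightarrow> linear (l i)"
  shows "B (\<lambda>x. \<Sum>i\<in>I. c i * l i x) m = (\<Sum>i\<in>I. c i * B (l i) m)"
  using assms(2,3)
proof (induction rule: finite_induct)
  case empty
  show ?case using mult_left[of m m 0] assms(1) by simp
next
  case (insert i I)
  then show ?case
    by (simp add: add_left mult_left linear_mult_const linear_sum_mult assms(1))
qed

lemma sum_right:
  assumes "linear m" "finite I" "\<And>i. i \<in> I \<Longrightarrow> linear (l i)"
  shows "B m (\<lambda>x. \<Sum>i\<in>I. c i * l i x) = (\<Sum>i\<in>I. c i * B m (l i))"
  using sum_left[OF assms, where c=c] by (simp add: sym[of m])

lemma expand_right: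
  assumes "linear l" "linear m"
  shows "B l m = (\<Sum>b\<in>Basis. m b * B l (coord b))"
  by (subst linear_expansion[OF assms(2)]) (rule sum_right[OF assms(1) finite_Basis linear_coordinate])

lemma nondegenerate:
  assumes "linear l" "linear l'" "\<And>m. linear m \<Longrightarrow> B l m = B l' m"
  shows "l = l'"
proof (rule ccontr)
  assume "l \<noteq> l'"
  define k where "k = (\<lambda>x. l x + (-1) * l' x)"
  have k: "linear k" unfolding k_def by (intro linear_compose_add linear_mult_const assms)
  have "k \<noteq> (\<lambda>_. 0)" using \<open>l \<noteq> l'\<close> by (auto simp: k_def fun_eq_iff)
  then have "0 < B k k" using pos_def k by (simp add: positive_definite_form_def)
  moreover have "B k k = B l k + (-1) * B l' k"
    by (subst (1) k_def) (simp only: add_left mult_left linear_mult_const assms k)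
  ultimately show False using assms(3)[OF k] by simp
qed

text \<open>\<open>A\<close> is the Gram matrix of B in the coordinate functionals, seen as an
  endomorphism of W. Positive definiteness makes it injective, hence surjective, and if A w = x then
  \<open>coord w\<close> is the functional sought.\<close>

lemma dual_functional_ex: "\<exists>l. linear l \<and> (\<forall>m. linear m \<longrightarrow> B l m = m x)"
proof -
  define A where "A w = (\<Sum>b\<in>Basis. B (coord w) (coord b) *\<^sub>R b)" for w
  have c: "linear (coord w)" for w :: 'w by (rule linear_coordinate)
  have A: "linear A"
  proof (rule linearI)
    fix v w
    have "B (coord (v + w)) (coord b) = B (coord v) (coord b) + B (coord w) (coord b)" for b
      using add_left[OF c c c, of v w b] by (simp add: inner_add_right)
    then show "A (v + w) = A v + A w"
      by (simp add: A_def scaleR_left_distrib sum.distrib)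
  next
    fix r w
    have "B (coord (r *\<^sub>R w)) (coord b) = r * B (coord w) (coord b)" for b
      using mult_left[OF c c, of r w b] by simp
    then show "A (r *\<^sub>R w) = r *\<^sub>R A w"
      by (simp add: A_def scaleR_sum_right)
  qed
  have Ab: "A w \<bullet> b = B (coord w) (coord b)" if "b \<in> Basis" for w b
    using that by (simp add: A_def inner_sum_left inner_Basis if_distrib sum.delta cong: if_cong)
  have "inj A"
  proof (rule linear_injective_0[OF A, THEN iffD2], intro allI impI)
    fix w assume "A w = 0"
    then have "B (coord w) (coord b) = 0" if "b \<in> Basis" for b using Ab[OF that, of w] by simp
    then have "B (coord w) (coord w) = 0" unfolding expand_right[OF c[of w] c[of w]] by simp
    moreover have "B (coord w) (coord w) \<noteq> 0" if "coord w \<noteq> (\<lambda>_. 0)"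
      using pos_def c[of w] that unfolding positive_definite_form_def by (metis (no_types) less_irrefl)
    ultimately have "coord w = (\<lambda>_. 0)" by blast
    then have "coord w w = 0" by (rule fun_cong)
    then show "w = 0" by simp
  qed
  then have "surj A" using A linear_injective_imp_surjective by blast
  then obtain w where w: "A w = x" by (metis surjD)
  have "B (coord w) m = m x" if m: "linear m" for m
  proof -
    have "B (coord w) m = (\<Sum>b\<in>Basis. m b * coord b x)"
      unfolding expand_right[OF c m] by (intro sum.cong refl) (simp add: Ab w[symmetric])
    also have "\<dots> = m x" by (rule fun_cong[OF linear_expansion[OF m], symmetric])
    finally show ?thesis .
  qed
  then show ?thesis using c by blast
qed

abbreviation T :: "'w \<Rightarrow> 'w \<Rightarrow> real" where "T \<equiv> dual_functional B"

lemma linear_T: "linear (T x)" and B_T: "linear m \<Longrightarrow> B (T x) m = m x"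
proof -
  have "\<exists>!l. linear l \<and> (\<forall>m. linear m \<longrightarrow> B l m = m x)"
    using dual_functional_ex[of x] nondegenerate by (metis (no_types, lifting))
  from theI'[OF this] show "linear (T x)" "linear m \<Longrightarrow> B (T x) m = m x"
    unfolding dual_functional_def by auto
qed

lemma T_commute: "T x y = T y x"
  using B_T[OF linear_T] sym by metis

lemma dual_inner_T: "dual_inner B x y = T x y"
  by (simp add: dual_inner_def B_T[OF linear_T] T_commute)

lemma T_expand: "T x y = (\<Sum>b\<in>Basis. (x \<bullet> b) * T b y)"
proof -
  have "T x y = T y (\<Sum>b\<in>Basis. (x \<bullet> b) *\<^sub>R b)" by (simp add: euclidean_representation T_commute)
  then show ?thesis
    by (simp add: linear_sum[OF linear_T] linear_scale[OF linear_T] T_commute[of y])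
qed

lemma has_derivative_T: "((\<lambda>x. T x x) has_derivative (\<lambda>h. 2 * T x h)) (at x)"
proof -
  have "((\<lambda>x. \<Sum>b\<in>Basis. (x \<bullet> b) * T b x) has_derivative (\<lambda>h. \<Sum>b\<in>Basis. (x \<bullet> b) * T b h + (h \<bullet> b) * T b x)) (at x)"
    by (intro has_derivative_sum has_derivative_mult linear_imp_has_derivative linear_T linear_coordinate)
  moreover have "T x h + T h x = 2 * T x h" for h
    unfolding T_commute[of h] by (rule mult_2[symmetric])
  ultimately show ?thesis
    unfolding sum.distrib T_expand[symmetric] by (simp only:)
qed

text \<open>Differentiating exp(-|x|^2/2) times a Wick polynomial in direction w gives, up to sign,
  the Wick product with the letter T w added: the exponential contributes the multiplication by T w,
  the polynomial contributes the contractions, because B (T w) m = m w. The Rodrigues formula and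
  the Wick recursion thus coincide.\<close>

lemma iter_deriv_gaussian:
  "iter_deriv (\<lambda>y. exp (- (dual_inner B y y / 2))) ws =
     (\<lambda>x. (-1) ^ length ws * (exp (- (T x x / 2)) * wick B (\<lambda>l. l x) (mset (map T ws))))"
proof (induction ws)
  case Nil
  show ?case by (simp add: fun_eq_iff dual_inner_T)
next
  case (Cons w ws)
  show ?case
  proof
    fix x
    let ?L = "mset (map T ws)"
    let ?W = "\<lambda>x. wick B (\<lambda>l. l x) ?L"
    have lin: "linear l" if "l \<in># ?L" for l using that linear_T by auto
    have W: "(?W has_derivative (\<lambda>h. wick_diff (\<lambda>l. l h) (\<lambda>l. l x) ?L)) (at x)"
      by (rule has_derivative_wick[OF symmetric_form_axioms lin])
    have E: "((\<lambda>x. exp (- (T x x / 2))) has_derivative (\<lambda>h. exp (- (T x x / 2)) * (- T x h))) (at x)"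
      by (auto intro!: derivative_eq_intros has_derivative_T simp: fun_eq_iff mult.commute)
    have "(iter_deriv (\<lambda>y. exp (- (dual_inner B y y / 2))) ws has_derivative
       (\<lambda>h. (-1) ^ length ws * (exp (- (T x x / 2)) * wick_diff (\<lambda>l. l h) (\<lambda>l. l x) ?L + exp (- (T x x / 2)) * (- T x h) * ?W x))) (at x)"
      unfolding Cons.IH by (intro has_derivative_mult_right has_derivative_mult E W)
    from frechet_derivative_at[OF this, symmetric]
    have "iter_deriv (\<lambda>y. exp (- (dual_inner B y y / 2))) (w # ws) x =
       (-1) ^ length ws * (exp (- (T x x / 2)) * wick_diff (\<lambda>l. l w) (\<lambda>l. l x) ?L + exp (- (T x x / 2)) * (- T x w) * ?W x)"
      by simp
    also have "wick_diff (\<lambda>l. l w) (\<lambda>l. l x) ?L = T x w * ?W x - wick B (\<lambda>l. l x) (add_mset (T w) ?L)"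
      unfolding wick_diff_def wick_add_mset T_commute[of x w] diff_diff_eq2 add_diff_cancel_left'
      by (intro arg_cong[of _ _ sum_mset] image_mset_cong) (simp only: B_T[OF lin])
    finally show "iter_deriv (\<lambda>y. exp (- (dual_inner B y y / 2))) (w # ws) x =
      (-1) ^ length (w # ws) * (exp (- (T x x / 2)) * wick B (\<lambda>l. l x) (mset (map T (w # ws))))"
      by (simp add: algebra_simps)
  qed
qed

lemma hermite_form_wick: "hermite_form B x ws = wick B (\<lambda>l. l x) (mset (map T ws))"
proof -
  have alg: "(s * e) * (s * (e' * W)) = W" if "s * s = 1" "e * e' = 1" for s e e' W :: real
  proof -
    have "(s * e) * (s * (e' * W)) = (s * s) * (e * e') * W" by (simp only: ac_simps)
    with that show ?thesis by simp
  qed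
  show ?thesis
    unfolding hermite_form_def iter_deriv_gaussian unfolding dual_inner_T
    by (rule alg) (simp_all flip: power_mult_distrib exp_add)
qed

text \<open>The functionals T d, for d in the standard basis, are dual to the coordinate functionals
  with respect to B, since B (T d) m = m d; the coefficients are the corresponding scalar
  products.\<close>

lemma coord_expand: "coord b = (\<lambda>x. \<Sum>d\<in>Basis. B (coord b) (coord d) * T d x)"
proof (rule nondegenerate[OF linear_coordinate linear_sum_mult[OF linear_T]])
  fix m :: "'w \<Rightarrow> real" assume m: "linear m"
  show "B (coord b) m = B (\<lambda>x. \<Sum>d\<in>Basis. B (coord b) (coord d) * T d x) m"
    unfolding sum_left[OF m finite_Basis linear_T] expand_right[OF linear_coordinate m] B_T[OF m]
    by (simp add: mult.commute)
qed

text \<open>Wick products are linear in each letter, and \<open>coord_expand\<close> writes every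
  coordinate functional in the letters T d. The multiset N collects the letters T d that the
  induction has already split off.\<close>

lemma wick_multilinear:
  assumes "set bs \<subseteq> Basis" "\<And>l. l \<in># N \<Longrightarrow> linear l"
  shows "(\<Sum>cs\<in>multi_indices (length bs). (\<Prod>k<length bs. B (coord (bs ! k)) (coord (cs ! k))) *
      wick B (\<lambda>l. l x) (mset (map T cs) + N)) = wick B (\<lambda>l. l x) (mset (map coord bs) + N)"
  using assms
proof (induction bs arbitrary: N)
  case Nil
  have "multi_indices 0 = {[] :: 'w list}" by (auto simp: multi_indices_def)
  then show ?case by simp
next
  case (Cons b bs)
  let ?P = "\<lambda>cs. \<Prod>k<length bs. B (coord (bs ! k)) (coord (cs ! k))"
  let ?N = "mset (map coord bs) + N"
  have N: "linear l" if "l \<in># ?N" for l using that Cons.prems(2) linear_coordinate by auto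
  have "(\<Sum>cs\<in>multi_indices (length (b # bs)). (\<Prod>k<length (b # bs). B (coord ((b # bs) ! k)) (coord (cs ! k))) *
      wick B (\<lambda>l. l x) (mset (map T cs) + N)) =
      (\<Sum>d\<in>Basis. \<Sum>cs\<in>multi_indices (length bs). B (coord b) (coord d) * (?P cs * wick B (\<lambda>l. l x) (mset (map T cs) + add_mset (T d) N)))"
    unfolding list.size(4) add_Suc_right add_0_right
    by (subst sum_multi_indices_insert[of 0])
       (simp_all add: prod.lessThan_Suc_shift mult.assoc del: prod.lessThan_Suc)
  also have "\<dots> = (\<Sum>d\<in>Basis. B (coord b) (coord d) * wick B (\<lambda>l. l x) (mset (map coord bs) + add_mset (T d) N))"
    unfolding sum_distrib_left[symmetric]
    by (intro sum.cong refl arg_cong[where f="(*) _"] Cons.IH) (use Cons.prems linear_T in auto)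
  also have "\<dots> = (\<Sum>d\<in>Basis. B (coord b) (coord d) * (T d x * wick B (\<lambda>l. l x) ?N - (\<Sum>m\<in>#?N. B (T d) m * wick B (\<lambda>l. l x) (?N - {#m#}))))"
    by (simp add: wick_add_mset)
  also have "\<dots> = coord b x * wick B (\<lambda>l. l x) ?N - (\<Sum>m\<in>#?N. B (coord b) m * wick B (\<lambda>l. l x) (?N - {#m#}))"
  proof -
    have "(\<Sum>d\<in>Basis. B (coord b) (coord d) * (\<Sum>m\<in>#K. B (T d) m * g m)) = (\<Sum>m\<in>#K. B (coord b) m * g m)"
      if "\<And>l. l \<in># K \<Longrightarrow> linear l" for K g
      using that
    proof (induction K)
      case (add m K)
      have "B (coord b) m = (\<Sum>d\<in>Basis. B (coord b) (coord d) * B (T d) m)"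
        by (subst (1) coord_expand) (use add.prems in \<open>simp add: sum_left linear_T\<close>)
      with add show ?case
        by (simp add: distrib_left sum.distrib sum_distrib_right mult.assoc)
    qed simp
    note sums = this[OF N]
    have "coord b x = (\<Sum>d\<in>Basis. B (coord b) (coord d) * T d x)"
      by (rule fun_cong[OF coord_expand])
    then show ?thesis
      by (simp only: right_diff_distrib sum_subtractf sums sum_distrib_right mult.assoc)
  qed
  also have "\<dots> = wick B (\<lambda>l. l x) (mset (map coord (b # bs)) + N)"
    by (simp add: wick_add_mset)
  finally show ?case .
qed

text \<open>The Hermite form carries letters T c, images of basis vectors under the isomorphism
  defined by B; summing against the scalar products in \<open>tensor_inner\<close> turns them back
  into coordinate functionals.\<close>

lemma chaos_proj_wick:
  "chaos_proj B \<eta> f q x =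
     1 / fact q * (\<Sum>bs\<in>multi_indices q. chaos_coeff B \<eta> f bs * wick B (\<lambda>l. l x) (mset (map coord bs)))"
proof -
  have "tensor_inner B q (chaos_coeff B \<eta> f) (hermite_form B x) =
      (\<Sum>bs\<in>multi_indices q. chaos_coeff B \<eta> f bs * wick B (\<lambda>l. l x) (mset (map coord bs)))"
    unfolding tensor_inner_def
  proof (rule sum.cong[OF refl])
    fix bs :: "'w list" assume "bs \<in> multi_indices q"
    then have "set bs \<subseteq> Basis" "length bs = q" by (auto simp: multi_indices_def)
    with wick_multilinear[of bs "{#}" x]
    show "(\<Sum>cs\<in>multi_indices q. chaos_coeff B \<eta> f bs * hermite_form B x cs * (\<Prod>k<q. B (coord (bs ! k)) (coord (cs ! k)))) =
      chaos_coeff B \<eta> f bs * wick B (\<lambda>l. l x) (mset (map coord bs))"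
      by (simp add: hermite_form_wick mult.assoc mult.commute[of "wick _ _ _"] flip: sum_distrib_left)
  qed
  then show ?thesis by (simp add: chaos_proj_def)
qed

lemma chaos_coeff_symmetric:
  assumes "mset ws = mset ws'"
  shows "chaos_coeff B \<eta> f ws = chaos_coeff B \<eta> f ws'"
  unfolding chaos_coeff_def hermite_form_wick using assms by simp

end


subsection \<open>Covariances of chaotic components\<close>

lemma borel_measurable_linear: "linear (l :: 'w::euclidean_space \<Rightarrow> real) \<Longrightarrow> l \<in> borel_measurable borel"
  by (intro borel_measurable_continuous_onI linear_continuous_on) (simp add: linear_conv_bounded_linear)

locale stationary_gaussian = prob_space M for M :: "'o measure" +
  fixes X :: "'v::euclidean_space \<Rightarrow> 'o \<Rightarrow> 'w::euclidean_space"
  assumes field: "gaussian_field M X" and centered: "centered_field M X"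
    and stationary: "stationary_field M X" and pos_def_cov: "positive_definite_form (covariance M X 0)"
begin

abbreviation "B \<equiv> covariance M X 0"

lemma measurable_field [measurable]: "(\<lambda>(v, \<omega>). X v \<omega>) \<in> borel_measurable (borel \<Otimes>\<^sub>M M)"
  using field by (simp add: gaussian_field_def)

lemma measurable_X [measurable]: "X v \<in> borel_measurable M"
  using measurable_compose[OF measurable_Pair1'[of v borel M] measurable_field] by simp

text \<open>A second moment involves the field at two points only. The case u = v is included and
  serves for statements at a single point.\<close>

definition pair_space :: "'v \<Rightarrow> 'v \<Rightarrow> ('o \<Rightarrow> real) set" where
  "pair_space v u = {\<lambda>\<omega>. l (X v \<omega>) + m (X u \<omega>) |l m. linear l \<and> linear m}"

lemma pair_spaceI: "linear l \<Longrightarrow> linear m \<Longrightarrow> (\<lambda>\<omega>. l (X v \<omega>) + m (X u \<omega>)) \<in> pair_space v u"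
  by (auto simp: pair_space_def)

lemma linear_X_in_pair_space:
  assumes "linear l"
  shows "(\<lambda>\<omega>. l (X v \<omega>)) \<in> pair_space v u" "(\<lambda>\<omega>. l (X u \<omega>)) \<in> pair_space v u"
  using pair_spaceI[OF assms linear_zero, where v=v and u=u] pair_spaceI[OF linear_zero assms, where v=v and u=u] by simp_all

lemma expectation_linear:
  assumes "linear l"
  shows "integrable M (\<lambda>\<omega>. l (X v \<omega>))" "expectation (\<lambda>\<omega>. l (X v \<omega>)) = 0"
proof -
  have "integrable M (X v)" "expectation (X v) = 0"
    using centered by (auto simp: centered_field_def)
  moreover have "bounded_linear l" using assms by (simp add: linear_conv_bounded_linear)
  ultimately show "integrable M (\<lambda>\<omega>. l (X v \<omega>))" "expectation (\<lambda>\<omega>. l (X v \<omega>)) = 0"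
    using integrable_bounded_linear[of l M "X v"] integral_bounded_linear[of l M "X v"]
    by (simp_all add: linear_0 assms)
qed

lemma gaussian_space_pair: "gaussian_space M (pair_space v u)"
proof
  fix Y assume "Y \<in> pair_space v u"
  then obtain l m where Y: "Y = (\<lambda>\<omega>. l (X v \<omega>) + m (X u \<omega>))" and lm: "linear l" "linear m"
    by (auto simp: pair_space_def)
  have rv: "gaussian_rv M (\<lambda>\<omega>. \<Sum>v\<in>I. k v (X v \<omega>))" if "finite I" "\<And>v. v \<in> I \<Longrightarrow> linear (k v)" for I k
    using field that unfolding gaussian_field_def by blast
  \<comment> \<open>\<open>gaussian_field\<close> sums over a set of points with one functional for
    each; when v = u the two functionals have to be added first.\<close>
  show "gaussian_rv M Y"
  proof (cases "v = u")
    case True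
    then show ?thesis
      using rv[of "{v}" "\<lambda>_ x. l x + m x"] linear_compose_add[OF lm] by (simp add: Y)
  next
    case False
    then show ?thesis
      using rv[of "{v, u}" "\<lambda>w. if w = v then l else m"] lm by (simp add: Y if_distrib)
  qed
  show "expectation Y = 0"
    using expectation_linear[OF lm(1)] expectation_linear[OF lm(2)] by (simp add: Y)
next
  fix Y Z t assume "Y \<in> pair_space v u" "Z \<in> pair_space v u"
  then obtain l m l' m' where *: "Y = (\<lambda>\<omega>. l (X v \<omega>) + m (X u \<omega>))" "linear l" "linear m"
    "Z = (\<lambda>\<omega>. l' (X v \<omega>) + m' (X u \<omega>))" "linear l'" "linear m'"
    by (auto simp: pair_space_def)
  have "(\<lambda>\<omega>. (l (X v \<omega>) + t * l' (X v \<omega>)) + (m (X u \<omega>) + t * m' (X u \<omega>))) \<in> pair_space v u"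
    by (intro pair_spaceI[of "\<lambda>x. l x + t * l' x" "\<lambda>x. m x + t * m' x"] linear_compose_add linear_mult_const *)
  then show "(\<lambda>\<omega>. Y \<omega> + t * Z \<omega>) \<in> pair_space v u"
    by (simp add: * algebra_simps)
qed

lemma covariance_stationary:
  assumes "linear l" "linear m"
  shows "expectation (\<lambda>\<omega>. l (X v \<omega>) * m (X u \<omega>)) = covariance M X (v - u) l m"
proof -
  note [measurable] = borel_measurable_linear[OF assms(1)] borel_measurable_linear[OF assms(2)]
  let ?I = "{v - u, 0}"
  let ?N = "Pi\<^sub>M ?I (\<lambda>_. borel :: 'w measure)"
  let ?g = "\<lambda>x. l (x (v - u)) * m (x 0)"
  have g: "?g \<in> borel_measurable ?N" by measurable
  have E: "expectation (\<lambda>\<omega>. l (X (v - u + h) \<omega>) * m (X (0 + h) \<omega>)) = integral\<^sup>L (distr M ?N (\<lambda>\<omega>. \<lambda>v\<in>?I. X (v + h) \<omega>)) ?g" for h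
    by (subst integral_distr[OF _ g]) (auto intro!: measurable_restrict)
  \<comment> \<open>The shift by u carries {v - u, 0} to {v, u}.\<close>
  have "distr M ?N (\<lambda>\<omega>. \<lambda>v\<in>?I. X (v + u) \<omega>) = distr M ?N (\<lambda>\<omega>. \<lambda>v\<in>?I. X (v + 0) \<omega>)"
    using stationary unfolding stationary_field_def by simp
  with E[of u] E[of 0] show ?thesis by (simp add: covariance_def)
qed

lemma covariance_0: "linear l \<Longrightarrow> linear m \<Longrightarrow> expectation (\<lambda>\<omega>. l (X v \<omega>) * m (X v \<omega>)) = B l m"
  using covariance_stationary[of l m v v] by simp

lemma covariance_coord: "expectation (\<lambda>\<omega>. coord b (X v \<omega>) * coord c (X v \<omega>)) = B (coord b) (coord c)"
  by (rule covariance_0[OF linear_coordinate linear_coordinate])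

lemma integrable_product:
  fixes l m :: "'w \<Rightarrow> real"
  assumes "linear l" "linear m"
  shows "integrable M (\<lambda>\<omega>. l (X v \<omega>) * m (X u \<omega>))"
proof -
  interpret gaussian_space M "pair_space v u" by (rule gaussian_space_pair)
  show ?thesis
    by (rule all_moments_integrable[OF all_moments_mult[OF moments moments]]) (rule linear_X_in_pair_space[OF assms(1)] linear_X_in_pair_space[OF assms(2)])+
qed

sublocale scalar_product B
proof
  show "B l m = B m l" for l m by (simp add: covariance_def mult.commute)
  show "B (\<lambda>x. l x + l' x) m = B l m + B l' m" if "linear l" "linear l'" "linear m" for l l' m
    by (simp add: covariance_def distrib_right integrable_product that)
  show "B (\<lambda>x. c * l x) m = c * B l m" for c l m
    by (simp add: covariance_def mult.assoc)
  show "positive_definite_form B" by (rule pos_def_cov)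
qed

lemma wick_space_pair: "wick_space M (pair_space v u) B"
  by (intro wick_space.intro gaussian_space_pair symmetric_form_axioms)

lemma wick_X_all_moments:
  assumes "\<And>l. l \<in># L \<Longrightarrow> linear l"
  shows "(\<lambda>\<omega>. wick B (\<lambda>l. l (X v \<omega>)) L) \<in> all_moments M"
proof -
  interpret wick_space M "pair_space v v" B by (rule wick_space_pair)
  show ?thesis using assms by (intro all_moments_wick linear_X_in_pair_space)
qed

abbreviation \<eta> :: "'w measure" where "\<eta> \<equiv> distr M borel (X 0)"
abbreviation coeff :: "('w \<Rightarrow> real) \<Rightarrow> 'w list \<Rightarrow> real" where "coeff \<equiv> chaos_coeff B \<eta>"
abbreviation proj :: "('w \<Rightarrow> real) \<Rightarrow> nat \<Rightarrow> 'w \<Rightarrow> real" where "proj \<equiv> chaos_proj B \<eta>"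

lemma proj_all_moments: "(\<lambda>\<omega>. proj f q (X v \<omega>)) \<in> all_moments M"
  unfolding chaos_proj_wick
  by (intro all_moments_mult all_moments_const all_moments_sum wick_X_all_moments) (auto intro: linear_coordinate)

lemma expectation_proj:
  assumes "q \<ge> 1"
  shows "expectation (\<lambda>\<omega>. proj f q (X v \<omega>)) = 0"
proof -
  interpret wick_space M "pair_space v v" B by (rule wick_space_pair)
  have "expectation (\<lambda>\<omega>. wick B (\<lambda>l. l (X v \<omega>)) (mset (map coord bs))) = 0" if bsq: "bs \<in> multi_indices q" for bs
  proof -
    obtain b bs' where bs: "bs = b # bs'" using bsq assms by (cases bs) (auto simp: multi_indices_def)
    \<comment> \<open>Written as a product with the empty Wick product, which offers no letter to
      contract with.\<close>
    have "expectation (\<lambda>\<omega>. wick B (\<lambda>l. l (X v \<omega>)) (add_mset (coord b) (mset (map coord bs'))) * wick B (\<lambda>l. l (X v \<omega>)) {#}) = 0"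
      by (subst expectation_wick_wick)
         (auto intro!: linear_X_in_pair_space linear_coordinate simp: cov_def covariance_coord)
    then show ?thesis by (simp add: bs)
  qed
  moreover have "integrable M (\<lambda>\<omega>. wick B (\<lambda>l. l (X v \<omega>)) (mset (map coord bs)))" for bs :: "'w list"
    by (intro all_moments_integrable wick_X_all_moments) (auto intro: linear_coordinate)
  ultimately show ?thesis
    unfolding chaos_proj_wick by simp
qed

text \<open>By stationarity the same form B is the covariance at v and at u, so
  \<open>expectation_wick_wick\<close> applies, and the expectations \<open>K\<close> of pairs of
  Wick products satisfy the recursion of a permanent in the covariances at lag v - u. The resulting
  q! cancels one of the two factors 1/q!.\<close>

lemma expectation_proj_proj:
  "expectation (\<lambda>\<omega>. proj f q (X v \<omega>) * proj f q (X u \<omega>)) =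
     1 / fact q * (\<Sum>bs\<in>multi_indices q. \<Sum>cs\<in>multi_indices q. coeff f bs * coeff f cs *
        (\<Prod>k<q. covariance M X (v - u) (coord (bs ! k)) (coord (cs ! k))))"
proof -
  interpret wick_space M "pair_space v u" B by (rule wick_space_pair)
  define W where "W v bs \<omega> = wick B (\<lambda>l. l (X v \<omega>)) (mset (map coord bs))" for v and bs :: "'w list" and \<omega>
  define K where "K bs cs = expectation (\<lambda>\<omega>. W v bs \<omega> * W u cs \<omega>)" for bs cs
  let ?C = "\<lambda>b c. covariance M X (v - u) (coord b) (coord c)"
  have W: "W w bs \<in> all_moments M" for w bs
    unfolding W_def by (intro wick_X_all_moments) (auto intro: linear_coordinate)
  have rec: "K (b # bs) cs = (\<Sum>i<length cs. ?C b (cs ! i) * K bs (take i cs @ drop (Suc i) cs))" for b bs cs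
  proof -
    define f where "f m N = cov (\<lambda>\<omega>. coord b (X v \<omega>)) (\<lambda>\<omega>. m (X u \<omega>)) *
        expectation (\<lambda>\<omega>. wick B (\<lambda>l. l (X v \<omega>)) (mset (map coord bs)) * wick B (\<lambda>l. l (X u \<omega>)) N)" for m N
    have "K (b # bs) cs = (\<Sum>m\<in>#mset (map coord cs). f m (mset (map coord cs) - {#m#}))"
      unfolding K_def W_def list.map mset.simps f_def
      by (rule expectation_wick_wick)
         (auto intro!: linear_X_in_pair_space linear_coordinate simp: cov_def covariance_coord)
    also have "\<dots> = (\<Sum>i<length (map coord cs). f (map coord cs ! i) (mset (take i (map coord cs) @ drop (Suc i) (map coord cs))))"
      by (rule sum_remove_index[symmetric])
    also have "\<dots> = (\<Sum>i<length cs. ?C b (cs ! i) * K bs (take i cs @ drop (Suc i) cs))"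
    proof (intro sum.cong)
      fix i assume "i \<in> {..<length cs}"
      then have "cov (\<lambda>\<omega>. coord b (X v \<omega>)) (\<lambda>\<omega>. (map coord cs ! i) (X u \<omega>)) = ?C b (cs ! i)"
        unfolding cov_def by (simp add: covariance_stationary[OF linear_coordinate linear_coordinate])
      then show "f (map coord cs ! i) (mset (take i (map coord cs) @ drop (Suc i) (map coord cs))) = ?C b (cs ! i) * K bs (take i cs @ drop (Suc i) cs)"
        unfolding f_def K_def W_def by (simp add: take_map drop_map)
    qed simp
    finally show ?thesis .
  qed
  have K0: "K [] [] = 1" by (simp add: K_def W_def prob_space)
  let ?F = "coeff f"
  have "expectation (\<lambda>\<omega>. proj f q (X v \<omega>) * proj f q (X u \<omega>)) =
    expectation (\<lambda>\<omega>. (1 / fact q)\<^sup>2 * (\<Sum>bs\<in>multi_indices q. \<Sum>cs\<in>multi_indices q. ?F bs * ?F cs * (W v bs \<omega> * W u cs \<omega>)))"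
    unfolding chaos_proj_wick W_def[symmetric]
    by (simp add: sum_product power2_eq_square mult.assoc mult.left_commute)
  also have "\<dots> = (1 / fact q)\<^sup>2 * (\<Sum>bs\<in>multi_indices q. \<Sum>cs\<in>multi_indices q. ?F bs * ?F cs * K bs cs)"
    unfolding K_def by (simp add: all_moments_integrable all_moments_mult W)
  also have "(\<Sum>bs\<in>multi_indices q. \<Sum>cs\<in>multi_indices q. ?F bs * ?F cs * K bs cs) =
     (\<Sum>bs\<in>multi_indices q. ?F bs * (fact q * (\<Sum>cs\<in>multi_indices q. ?F cs * (\<Prod>k<q. ?C (bs ! k) (cs ! k)))))"
  proof (rule sum.cong[OF refl])
    fix bs :: "'w list" assume bs: "bs \<in> multi_indices q"
    have "(\<Sum>cs\<in>multi_indices q. ?F cs * K bs cs) = fact q * (\<Sum>cs\<in>multi_indices q. ?F cs * (\<Prod>k<q. ?C (bs ! k) (cs ! k)))"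
      by (rule sum_multi_indices_permanent[OF chaos_coeff_symmetric K0 rec bs])
    then show "(\<Sum>cs\<in>multi_indices q. ?F bs * ?F cs * K bs cs) = ?F bs * (fact q * (\<Sum>cs\<in>multi_indices q. ?F cs * (\<Prod>k<q. ?C (bs ! k) (cs ! k))))"
      by (simp only: sum_distrib_left[of "?F bs", symmetric] mult.assoc)
  qed
  also have "(1 / fact q)\<^sup>2 * \<dots> = 1 / fact q * (\<Sum>bs\<in>multi_indices q. \<Sum>cs\<in>multi_indices q. ?F bs * ?F cs * (\<Prod>k<q. ?C (bs ! k) (cs ! k)))"
    by (simp add: sum_distrib_left power2_eq_square mult.assoc mult.left_commute)
  finally show ?thesis .
qed

end


subsection \<open>Continuity of translations in \<open>L\<^sup>p\<close>\<close>

lemma nn_integral_lborel_affine: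
  fixes f :: "'v::euclidean_space \<Rightarrow> ennreal"
  assumes [measurable]: "f \<in> borel_measurable borel" and c: "c \<noteq> 0"
  shows "(\<integral>\<^sup>+x. f x \<partial>lborel) = ennreal (\<bar>c\<bar> ^ DIM('v)) * (\<integral>\<^sup>+x. f (t + c *\<^sub>R x) \<partial>lborel)"
  by (subst lborel_affine[OF c, of t])
     (simp add: nn_integral_density nn_integral_distr nn_integral_cmult)

lemma integrable_lborel_affine:
  fixes f :: "'v::euclidean_space \<Rightarrow> 'b::{banach, second_countable_topology}"
  assumes f: "integrable lborel f" and c: "c \<noteq> 0"
  shows "integrable lborel (\<lambda>x. f (t + c *\<^sub>R x))"
  using f f[THEN borel_measurable_integrable] c unfolding integrable_iff_bounded
  by (subst (asm) nn_integral_lborel_affine[where c=c and t=t]) (auto simp: ennreal_mult_less_top ennreal_mult_eq_top_iff less_top[symmetric])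

lemma integrable_lborel_affine_iff:
  fixes f :: "'v::euclidean_space \<Rightarrow> 'b::{banach, second_countable_topology}"
  assumes c: "c \<noteq> 0"
  shows "integrable lborel (\<lambda>x. f (t + c *\<^sub>R x)) \<longleftrightarrow> integrable lborel f"
  using integrable_lborel_affine[of f c t]
    integrable_lborel_affine[of "\<lambda>x. f (t + c *\<^sub>R x)" "1 / c" "- t /\<^sub>R c"] c
  by (auto simp: algebra_simps)

lemma integral_lborel_affine:
  fixes f :: "'v::euclidean_space \<Rightarrow> 'b::{banach, second_countable_topology}"
  assumes c: "c \<noteq> 0"
  shows "(\<integral>x. f x \<partial>lborel) = (\<bar>c\<bar> ^ DIM('v)) *\<^sub>R (\<integral>x. f (t + c *\<^sub>R x) \<partial>lborel)"
proof cases
  assume f[measurable]: "integrable lborel f" then show ?thesis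
    using c f f[THEN borel_measurable_integrable] integrable_lborel_affine[OF f c, of t]
    by (subst lborel_affine[OF c, of t])
       (simp add: integral_density integral_distr)
next
  assume "\<not> integrable lborel f" with c show ?thesis
    by (simp add: integrable_lborel_affine_iff not_integrable_integral_eq)
qed

lemma integrable_lborel_scale:
  fixes f :: "'v::euclidean_space \<Rightarrow> 'b::{banach, second_countable_topology}"
  shows "integrable lborel f \<Longrightarrow> 0 < r \<Longrightarrow> integrable lborel (\<lambda>x. f (x /\<^sub>R r))"
  using integrable_lborel_affine[of f "1 / r" 0] by (simp add: divide_inverse)

lemma integrable_lborel_shift:
  fixes f :: "'v::euclidean_space \<Rightarrow> 'b::{banach, second_countable_topology}"
  shows "integrable lborel f \<Longrightarrow> integrable lborel (\<lambda>x. f (t + x))"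
  using integrable_lborel_affine[of f 1 t] by simp

lemma integral_lborel_shift:
  fixes f :: "'v::euclidean_space \<Rightarrow> 'b::{banach, second_countable_topology}"
  shows "(\<integral>x. f (t + x) \<partial>lborel) = (\<integral>x. f x \<partial>lborel)"
  using integral_lborel_affine[of 1 f t] by simp

lemma nn_integral_lborel_reflect:
  fixes f :: "'v::euclidean_space \<Rightarrow> ennreal"
  assumes "f \<in> borel_measurable borel"
  shows "(\<integral>\<^sup>+x. f (t - x) \<partial>lborel) = (\<integral>\<^sup>+x. f x \<partial>lborel)"
  using nn_integral_lborel_affine[OF assms, of "-1" t] by simp

text \<open>The integral is twice the measure of A minus twice its overlap with the translate, so
  the overlap has to tend to the measure of A. With an open U containing A in place of the
  translated set this is dominated convergence, since every x in A has a neighbourhood in U; outer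
  regularity makes the error U - A small.\<close>

lemma indicator_translation_tendsto:
  fixes A :: "'v::euclidean_space set"
  assumes A: "A \<in> sets borel" "emeasure lborel A < \<infinity>" and s: "s \<longlonglongrightarrow> 0"
  shows "(\<lambda>i. \<integral>x. \<bar>indicator A (s i + x) - indicator A x\<bar> \<partial>lborel :: real) \<longlonglongrightarrow> 0"
proof (rule LIMSEQ_I)
  fix e :: real assume e: "0 < e"
  \<comment> \<open>The error counts twice e/4 for U - A and twice e/4 for the convergence of the
    overlap.\<close>
  obtain U where U: "open U" "A \<subseteq> U" "U - A \<in> lmeasurable" "emeasure lebesgue (U - A) < ennreal (e / 4)"
    using sets_lebesgue_outer_open[of A "e / 4"] A(1) e by auto
  have [measurable]: "U \<in> sets borel" "A \<in> sets borel" using U(1) A(1) by auto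
  let ?a = "indicator A :: 'v \<Rightarrow> real" and ?u = "indicator U :: 'v \<Rightarrow> real" and ?d = "indicator (U - A) :: 'v \<Rightarrow> real"
  have a: "integrable lborel ?a" using A by (simp add: integrable_indicator_iff)
  have small: "emeasure lborel (U - A) < ennreal (e / 4)" using U(4) by simp
  then have fin: "emeasure lborel (U - A) < \<infinity>" by (rule order.strict_trans) simp
  then have d: "integrable lborel ?d" by (simp add: integrable_indicator_iff)
  have "ennreal (measure lborel (U - A)) < ennreal (e / 4)"
    using small fin by (simp add: emeasure_eq_ennreal_measure)
  then have "measure lborel (U - A) < e / 4" by (simp only: ennreal_less_iff measure_nonneg)
  then have d_small: "(\<integral>x. ?d x \<partial>lborel) < e / 4" by simp
  have au: "integrable lborel (\<lambda>x. ?a x * ?u (t + x))" and aa: "integrable lborel (\<lambda>x. ?a x * ?a (t + x))" for t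
    by (rule Bochner_Integration.integrable_bound[OF a]; auto simp: indicator_def)+
  have lim: "(\<lambda>i. \<integral>x. ?a x * ?u (s i + x) \<partial>lborel) \<longlonglongrightarrow> (\<integral>x. ?a x \<partial>lborel)"
  proof (rule integral_dominated_convergence[where w = ?a])
    show "AE x in lborel. (\<lambda>i. ?a x * ?u (s i + x)) \<longlonglongrightarrow> ?a x"
    proof (intro AE_I2)
      fix x :: 'v
      show "(\<lambda>i. ?a x * ?u (s i + x)) \<longlonglongrightarrow> ?a x"
      proof (cases "x \<in> A")
        case True
        have "(\<lambda>i. s i + x) \<longlonglongrightarrow> 0 + x" by (intro tendsto_intros s)
        then have "\<forall>\<^sub>F i in sequentially. s i + x \<in> U"
          using U(1,2) True by (intro topological_tendstoD) auto
        then have "\<forall>\<^sub>F i in sequentially. ?a x * ?u (s i + x) = ?a x"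
          by eventually_elim simp
        then show ?thesis by (rule tendsto_eventually)
      qed simp
    qed
  qed (use a in \<open>auto simp: indicator_def\<close>)
  have "0 < e / 4" using e by simp
  from LIMSEQ_D[OF lim this] obtain N where
    N: "\<And>i. i \<ge> N \<Longrightarrow> norm ((\<integral>x. ?a x * ?u (s i + x) \<partial>lborel) - (\<integral>x. ?a x \<partial>lborel)) < e / 4"
    by blast
  have "norm ((\<integral>x. \<bar>?a (s i + x) - ?a x\<bar> \<partial>lborel) - 0) < e" if "i \<ge> N" for i
  proof -
    have d': "integrable lborel (\<lambda>x. ?d (s i + x))" and a': "integrable lborel (\<lambda>x. ?a (s i + x))"
      by (intro integrable_lborel_shift d a)+
    have "(\<integral>x. ?a x * ?u (s i + x) \<partial>lborel) \<le> (\<integral>x. ?a x * ?a (s i + x) + ?d (s i + x) \<partial>lborel)"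
      using au aa d' by (intro integral_mono) (auto simp: indicator_def)
    also have "\<dots> = (\<integral>x. ?a x * ?a (s i + x) \<partial>lborel) + (\<integral>x. ?d x \<partial>lborel)"
      using aa d' by (simp add: integral_lborel_shift[of ?d])
    finally have 1: "(\<integral>x. ?a x * ?u (s i + x) \<partial>lborel) \<le> (\<integral>x. ?a x * ?a (s i + x) \<partial>lborel) + (\<integral>x. ?d x \<partial>lborel)" .
    have "(\<integral>x. \<bar>?a (s i + x) - ?a x\<bar> \<partial>lborel) = (\<integral>x. ?a (s i + x) + ?a x - 2 * (?a x * ?a (s i + x)) \<partial>lborel)"
      by (intro Bochner_Integration.integral_cong) (auto simp: indicator_def)
    also have "\<dots> = 2 * (\<integral>x. ?a x \<partial>lborel) - 2 * (\<integral>x. ?a x * ?a (s i + x) \<partial>lborel)"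
      using a a' aa[of "s i"] by (simp add: integral_lborel_shift[of ?a] del: integral_indicator)
    finally have 2: "(\<integral>x. \<bar>?a (s i + x) - ?a x\<bar> \<partial>lborel) = 2 * (\<integral>x. ?a x \<partial>lborel) - 2 * (\<integral>x. ?a x * ?a (s i + x) \<partial>lborel)" .
    have "0 \<le> (\<integral>x. \<bar>?a (s i + x) - ?a x\<bar> \<partial>lborel)" by simp
    with 1 2 N[OF that] d_small show ?thesis unfolding real_norm_def by linarith
  qed
  then show "\<exists>N. \<forall>i\<ge>N. norm ((\<integral>x. \<bar>indicator A (s i + x) - indicator A x\<bar> \<partial>lborel :: real) - 0) < e" by blast
qed

lemma norm_triangle3:
  fixes a b c :: "'b::real_normed_vector"
  shows "norm (a - b + c) \<le> norm a + norm b + norm c"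
  by (rule order_trans[OF norm_triangle_ineq add_right_mono[OF norm_triangle_ineq4]])

text \<open>Indicators, sums, and limits dominated by 2 |f| exhaust the integrable functions. In the
  limit case the approximation error enters twice, at x and at its translate, with the same integral
  by translation invariance.\<close>

lemma L1_translation_tendsto:
  fixes g :: "'v::euclidean_space \<Rightarrow> 'b::{banach, second_countable_topology}"
  assumes g: "integrable lborel g" and s: "s \<longlonglongrightarrow> 0"
  shows "(\<lambda>i. \<integral>x. norm (g (s i + x) - g x) \<partial>lborel) \<longlonglongrightarrow> 0"
  using g
proof (induction rule: integrable_induct)
  case (base A c)
  have "(\<lambda>i. (\<integral>x. \<bar>indicator A (s i + x) - indicator A x\<bar> \<partial>lborel) * norm c) \<longlonglongrightarrow> 0 * norm c"
    using base by (intro tendsto_mult_right indicator_translation_tendsto s) auto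
  moreover have "norm (indicator A (s i + x) *\<^sub>R c - indicator A x *\<^sub>R c) = \<bar>indicator A (s i + x) - indicator A x\<bar> * norm c" for i x
    by (simp flip: scaleR_left_diff_distrib)
  ultimately show ?case by simp
next
  case (add f g)
  have "(\<lambda>i. (\<integral>x. norm (f (s i + x) - f x) \<partial>lborel) + (\<integral>x. norm (g (s i + x) - g x) \<partial>lborel)) \<longlonglongrightarrow> 0 + 0"
    by (intro tendsto_add add)
  then have lim: "(\<lambda>i. (\<integral>x. norm (f (s i + x) - f x) \<partial>lborel) + (\<integral>x. norm (g (s i + x) - g x) \<partial>lborel)) \<longlonglongrightarrow> 0"
    by simp
  show ?case
  proof (rule tendsto_sandwich[OF _ _ tendsto_const lim])
    have "(\<integral>x. norm (f (t + x) + g (t + x) - (f x + g x)) \<partial>lborel) \<le> (\<integral>x. norm (f (t + x) - f x) \<partial>lborel) + (\<integral>x. norm (g (t + x) - g x) \<partial>lborel)" for t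
    proof -
      have i: "integrable lborel (\<lambda>x. norm (f (t + x) - f x))" "integrable lborel (\<lambda>x. norm (g (t + x) - g x))"
        "integrable lborel (\<lambda>x. norm (f (t + x) + g (t + x) - (f x + g x)))"
        by (intro integrable_norm Bochner_Integration.integrable_diff Bochner_Integration.integrable_add integrable_lborel_shift add)+
      have "(\<integral>x. norm (f (t + x) + g (t + x) - (f x + g x)) \<partial>lborel) \<le> (\<integral>x. norm (f (t + x) - f x) + norm (g (t + x) - g x) \<partial>lborel)"
        by (intro integral_mono i Bochner_Integration.integrable_add) (simp add: add_diff_add norm_triangle_ineq)
      then show ?thesis using i by simp
    qed
    then show "\<forall>\<^sub>F i in sequentially. (\<integral>x. norm (f (s i + x) + g (s i + x) - (f x + g x)) \<partial>lborel) \<le> (\<integral>x. norm (f (s i + x) - f x) \<partial>lborel) + (\<integral>x. norm (g (s i + x) - g x) \<partial>lborel)"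
      by simp
  qed simp
next
  case (lim f h)
  have bound: "norm (h i x) \<le> 2 * norm (f x)" for i x by (intro lim) simp
  have IH: "(\<lambda>i. \<integral>x. norm (h k (s i + x) - h k x) \<partial>lborel) \<longlonglongrightarrow> 0" for k by (rule lim)
  have "(\<lambda>i. \<integral>x. norm (h i x - f x) \<partial>lborel) \<longlonglongrightarrow> (\<integral>x. norm (f x - f x) \<partial>lborel)"
  proof (rule integral_dominated_convergence[where w = "\<lambda>x. 3 * norm (f x)"])
    show "AE x in lborel. (\<lambda>i. norm (h i x - f x)) \<longlonglongrightarrow> norm (f x - f x)"
      using lim by (intro AE_I2 tendsto_norm tendsto_diff tendsto_const) auto
    have "norm (h i x - f x) \<le> 3 * norm (f x)" for i x
      using norm_triangle_ineq4[of "h i x" "f x"] bound[of i x] by simp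
    then show "AE x in lborel. norm (norm (h i x - f x)) \<le> 3 * norm (f x)" for i by simp
  qed (use lim in \<open>auto intro: borel_measurable_integrable\<close>)
  then have appr: "(\<lambda>i. \<integral>x. norm (h i x - f x) \<partial>lborel) \<longlonglongrightarrow> 0" by simp
  show ?case
  proof (rule LIMSEQ_I)
    fix e :: real assume e: "0 < e"
    then have e3: "0 < e / 3" by simp
    from LIMSEQ_D[OF appr this] obtain k where k: "norm ((\<integral>x. norm (h k x - f x) \<partial>lborel) - 0) < e / 3"
      by blast
    from LIMSEQ_D[OF IH e3, of k]
    obtain N where N: "\<And>i. i \<ge> N \<Longrightarrow> norm ((\<integral>x. norm (h k (s i + x) - h k x) \<partial>lborel) - 0) < e / 3"
      by blast
    have "norm ((\<integral>x. norm (f (s i + x) - f x) \<partial>lborel) - 0) < e" if "i \<ge> N" for i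
    proof -
      let ?t = "s i"
      have 1: "integrable lborel (\<lambda>x. norm (h k x - f x))"
        by (intro integrable_norm Bochner_Integration.integrable_diff lim)
      have 2: "integrable lborel (\<lambda>x. norm (h k (?t + x) - f (?t + x)))"
        by (rule integrable_lborel_shift[OF 1])
      have 3: "integrable lborel (\<lambda>x. norm (h k (?t + x) - h k x))" "integrable lborel (\<lambda>x. norm (f (?t + x) - f x))"
        by (intro integrable_norm Bochner_Integration.integrable_diff integrable_lborel_shift lim)+
      have "(\<integral>x. norm (f (?t + x) - f x) \<partial>lborel) \<le>
          (\<integral>x. norm (h k (?t + x) - h k x) + norm (h k (?t + x) - f (?t + x)) + norm (h k x - f x) \<partial>lborel)"
      proof (intro integral_mono 1 2 3 Bochner_Integration.integrable_add)
        fix x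
        have "f (?t + x) - f x = (h k (?t + x) - h k x) - (h k (?t + x) - f (?t + x)) + (h k x - f x)" by simp
        then show "norm (f (?t + x) - f x) \<le> norm (h k (?t + x) - h k x) + norm (h k (?t + x) - f (?t + x)) + norm (h k x - f x)"
          by (simp only: norm_triangle3)
      qed
      also have "\<dots> = (\<integral>x. norm (h k (?t + x) - h k x) \<partial>lborel) + 2 * (\<integral>x. norm (h k x - f x) \<partial>lborel)"
        using 1 2 3 integral_lborel_shift[of "\<lambda>x. norm (h k x - f x)" ?t] by simp
      finally show ?thesis using N[OF that] k by (simp add: abs_less_iff)
    qed
    then show "\<exists>N. \<forall>i\<ge>N. norm ((\<integral>x. norm (f (s i + x) - f x) \<partial>lborel) - 0) < e" by blast
  qed
qed

lemma powr_sum3_le: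
  fixes a b c p :: real
  assumes "0 \<le> a" "0 \<le> b" "0 \<le> c" "0 \<le> p"
  shows "(a + b + c) powr p \<le> 3 powr p * (a powr p + b powr p + c powr p)"
proof -
  define m where "m = max a (max b c)"
  have "(a + b + c) powr p \<le> (3 * m) powr p"
    using assms by (intro powr_mono2) (auto simp: m_def)
  also have "\<dots> = 3 powr p * m powr p"
    using assms by (simp add: powr_mult m_def)
  also have "m powr p \<le> a powr p + b powr p + c powr p"
    unfolding m_def max_def by simp
  finally show ?thesis by simp
qed

text \<open>Truncation at height N reduces the claim to L^1: the increment of the truncated function
  is at most 2N, so its p-th power is at most (2N)^(p-1) times the increment itself. The truncation
  error is small in L^p by dominated convergence.\<close>

lemma Lp_translation_tendsto:
  fixes g :: "'v::euclidean_space \<Rightarrow> 'b::{banach, second_countable_topology}"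
  assumes g: "integrable lborel g" and gp: "integrable lborel (\<lambda>x. norm (g x) powr p)" and p: "1 \<le> p"
    and s: "s \<longlonglongrightarrow> 0"
  shows "(\<lambda>i. \<integral>x. norm (g (s i + x) - g x) powr p \<partial>lborel) \<longlonglongrightarrow> 0"
    and "integrable lborel (\<lambda>x. norm (g (t + x) - g x) powr p)"
proof -
  have [measurable]: "g \<in> borel_measurable borel" using borel_measurable_integrable[OF g] by simp
  have gpt: "integrable lborel (\<lambda>x. norm (g (t + x)) powr p)" for t
    using integrable_lborel_shift[OF gp] .
  show int: "integrable lborel (\<lambda>x. norm (g (t + x) - g x) powr p)" for t
  proof (rule Bochner_Integration.integrable_bound)
    show "integrable lborel (\<lambda>x. 3 powr p * (norm (g (t + x)) powr p + norm (g x) powr p + 0 powr p))"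
      using gp gpt p by simp
    have "norm (g (t + x) - g x) powr p \<le> 3 powr p * (norm (g (t + x)) powr p + norm (g x) powr p + 0 powr p)" for x
      using norm_triangle_ineq4[of "g (t + x)" "g x"] p
      by (intro order_trans[OF powr_mono2 powr_sum3_le]) auto
    then show "AE x in lborel. norm (norm (g (t + x) - g x) powr p) \<le> norm (3 powr p * (norm (g (t + x)) powr p + norm (g x) powr p + 0 powr p))"
      by (intro AE_I2) (simp add: order_trans[OF _ abs_ge_self])
  qed measurable
  define h where "h N x = (if norm (g x) \<le> real N then g x else 0)" for N x
  have [measurable]: "h N \<in> borel_measurable borel" for N unfolding h_def by measurable
  have h1: "integrable lborel (h N)" for N
    by (rule Bochner_Integration.integrable_bound[OF g]) (auto simp: h_def)
  have hp: "integrable lborel (\<lambda>x. norm (g x - h N x) powr p)" for N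
    by (rule Bochner_Integration.integrable_bound[OF gp]) (auto simp: h_def)
  have "(\<lambda>N. \<integral>x. norm (g x - h N x) powr p \<partial>lborel) \<longlonglongrightarrow> (\<integral>x. 0 \<partial>(lborel :: 'v measure))"
  proof (rule integral_dominated_convergence[where w = "\<lambda>x. norm (g x) powr p"])
    show "AE x in lborel. (\<lambda>N. norm (g x - h N x) powr p) \<longlonglongrightarrow> 0"
    proof (intro AE_I2 tendsto_eventually)
      fix x
      obtain N0 :: nat where "norm (g x) \<le> real N0" using real_arch_simple by blast
      then show "\<forall>\<^sub>F N in sequentially. norm (g x - h N x) powr p = 0"
        unfolding eventually_sequentially by (intro exI[of _ N0]) (auto simp: h_def)
    qed
  qed (use gp in \<open>auto simp: h_def\<close>)
  then have appr: "(\<lambda>N. \<integral>x. norm (g x - h N x) powr p \<partial>lborel) \<longlonglongrightarrow> 0" by simp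
  show "(\<lambda>i. \<integral>x. norm (g (s i + x) - g x) powr p \<partial>lborel) \<longlonglongrightarrow> 0"
  proof (rule LIMSEQ_I)
    fix e :: real assume e: "0 < e"
    \<comment> \<open>The three parts of the increment contribute less than 3 powr p times e' + 2
      e', which is e.\<close>
    define e' where "e' = e / (3 * 3 powr p)"
    have e': "0 < e'" using e by (simp add: e'_def)
    obtain N where N: "norm ((\<integral>x. norm (g x - h N x) powr p \<partial>lborel) - 0) < e'"
      using LIMSEQ_D[OF appr e'] by auto
    \<comment> \<open>The summand 1 keeps C positive when N = 0, so that e' / C is a positive
      tolerance.\<close>
    define C where "C = (2 * real N) powr (p - 1) + 1"
    have C: "0 < C" by (simp add: C_def add_nonneg_pos)
    obtain I where I: "\<And>i. i \<ge> I \<Longrightarrow> norm ((\<integral>x. norm (h N (s i + x) - h N x) \<partial>lborel) - 0) < e' / C"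
      using LIMSEQ_D[OF L1_translation_tendsto[OF h1[of N] s], of "e' / C"] e' C by auto
    have "norm ((\<integral>x. norm (g (s i + x) - g x) powr p \<partial>lborel) - 0) < e" if "i \<ge> I" for i
    proof -
      let ?t = "s i" and ?D = "\<lambda>x. norm (h N (s i + x) - h N x)"
      have 1: "integrable lborel ?D"
        by (intro integrable_norm Bochner_Integration.integrable_diff integrable_lborel_shift h1)
      have 2: "integrable lborel (\<lambda>x. norm (g (?t + x) - h N (?t + x)) powr p)"
        using integrable_lborel_shift[OF hp] .
      have hN: "norm (h N x) \<le> real N" for x by (simp add: h_def)
      have D: "?D x powr p \<le> C * ?D x" for x
      proof (cases "?D x = 0")
        case False
        then have pos: "0 < ?D x" by (simp add: less_le)
        have "?D x powr p = ?D x powr (p - 1) * ?D x"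
          using pos by (simp add: powr_mult_base mult.commute)
        also have "?D x powr (p - 1) \<le> (2 * real N) powr (p - 1)"
          using p hN[of "?t + x"] hN[of x] norm_triangle_ineq4[of "h N (?t + x)" "h N x"] by (intro powr_mono2) auto
        then have "?D x powr (p - 1) * ?D x \<le> C * ?D x"
          by (intro mult_right_mono) (auto simp: C_def)
        finally show ?thesis .
      qed (use p in simp)
      have "(\<integral>x. norm (g (?t + x) - g x) powr p \<partial>lborel) \<le>
        (\<integral>x. 3 powr p * (C * ?D x + norm (g (?t + x) - h N (?t + x)) powr p + norm (g x - h N x) powr p) \<partial>lborel)"
      proof (intro integral_mono int)
        show "integrable lborel (\<lambda>x. 3 powr p * (C * ?D x + norm (g (?t + x) - h N (?t + x)) powr p + norm (g x - h N x) powr p))"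
          using 1 2 hp by simp
        fix x
        have "g (?t + x) - g x = (h N (?t + x) - h N x) - (h N (?t + x) - g (?t + x)) + (h N x - g x)" by simp
        then have "norm (g (?t + x) - g x) \<le> ?D x + norm (h N (?t + x) - g (?t + x)) + norm (h N x - g x)"
          by (simp only: norm_triangle3)
        then have "norm (g (?t + x) - g x) \<le> ?D x + norm (g (?t + x) - h N (?t + x)) + norm (g x - h N x)"
          by (simp only: norm_minus_commute)
        then have "norm (g (?t + x) - g x) powr p \<le> (?D x + norm (g (?t + x) - h N (?t + x)) + norm (g x - h N x)) powr p"
          using p by (intro powr_mono2) auto
        also have "\<dots> \<le> 3 powr p * (?D x powr p + norm (g (?t + x) - h N (?t + x)) powr p + norm (g x - h N x) powr p)"
          using p by (intro powr_sum3_le) auto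
        also have "\<dots> \<le> 3 powr p * (C * ?D x + norm (g (?t + x) - h N (?t + x)) powr p + norm (g x - h N x) powr p)"
          using D[of x] by simp
        finally show "norm (g (?t + x) - g x) powr p \<le> \<dots>" .
      qed
      also have "\<dots> = 3 powr p * (C * (\<integral>x. ?D x \<partial>lborel) + 2 * (\<integral>x. norm (g x - h N x) powr p \<partial>lborel))"
        using 1 2 hp[of N] integral_lborel_shift[of "\<lambda>x. norm (g x - h N x) powr p" ?t] by simp
      also have "\<dots> < 3 powr p * (C * (e' / C) + 2 * e')"
        using I[OF that] N C by (intro mult_strict_left_mono add_strict_mono) (auto simp: abs_less_iff)
      also have "\<dots> = e"
        using C by (simp add: e'_def)
      finally show ?thesis by (simp add: integral_nonneg_AE)
    qed
    then show "\<exists>I. \<forall>i\<ge>I. norm ((\<integral>x. norm (g (s i + x) - g x) powr p \<partial>lborel) - 0) < e" by blast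
  qed
qed


subsection \<open>Convolutions as integrals over hyperplanes\<close>

text \<open>Let a m be the smallest factor. Writing it as a product of n equal roots and bounding
  each by the n-th root of another factor removes it from the product and raises the other factors
  to the power 1 + 1/n. The sum over k spares naming m. Each summand lacks one factor, so that n
  factors in n independent variables remain to be integrated.\<close>

lemma prod_le_sum_prod_powr:
  fixes a :: "nat \<Rightarrow> real"
  assumes n: "n \<ge> 1" and nonneg: "\<And>j. j \<le> n \<Longrightarrow> 0 \<le> a j"
  shows "(\<Prod>j\<le>n. a j) \<le> (\<Sum>k\<le>n. \<Prod>j\<in>{..n} - {k}. a j powr (real (Suc n) / real n))"
proof -
  have "Min (a ` {..n}) \<in> a ` {..n}" by (intro Min_in) auto
  then obtain m where "Min (a ` {..n}) = a m" "m \<in> {..n}" by (rule imageE)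
  then have m: "m \<le> n" "a m = Min (a ` {..n})" by simp_all
  have min: "a m \<le> a j" if "j \<le> n" for j using that m(2) by simp
  have "(\<Prod>j\<le>n. a j) \<le> (\<Prod>j\<in>{..n} - {m}. a j powr (real (Suc n) / real n))"
  proof (cases "a m = 0")
    case True
    then have z: "(\<Prod>j\<le>n. a j) = 0" using m(1) by (intro prod_zero) auto
    show ?thesis unfolding z by (intro prod_nonneg) simp
  next
    case False
    then have pos: "0 < a j" if "j \<le> n" for j using min[OF that] nonneg[OF m(1)] by linarith
    have "a m = (a m powr (1 / real n)) ^ card ({..n} - {m})"
      using pos[OF m(1)] n m(1) by (simp add: powr_power)
    also have "\<dots> = (\<Prod>j\<in>{..n} - {m}. a m powr (1 / real n))"
      by (rule prod_constant[symmetric])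
    also have "\<dots> \<le> (\<Prod>j\<in>{..n} - {m}. a j powr (1 / real n))"
      using pos[OF m(1)] min by (intro prod_mono) (auto intro!: powr_mono2)
    finally have "a m * (\<Prod>j\<in>{..n} - {m}. a j) \<le> (\<Prod>j\<in>{..n} - {m}. a j powr (1 / real n)) * (\<Prod>j\<in>{..n} - {m}. a j)"
      using nonneg by (intro mult_right_mono prod_nonneg) auto
    also have "\<dots> = (\<Prod>j\<in>{..n} - {m}. a j powr (real (Suc n) / real n))"
      unfolding prod.distrib[symmetric]
    proof (rule prod.cong[OF refl])
      fix j assume "j \<in> {..n} - {m}"
      then have "0 < a j" using pos by simp
      then have "a j powr (1 / real n) * a j = a j powr (1 / real n) * a j powr 1" by simp
      also have "\<dots> = a j powr (real (Suc n) / real n)"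
        unfolding powr_add[symmetric] using n by (simp add: field_simps)
      finally show "a j powr (1 / real n) * a j = a j powr (real (Suc n) / real n)" .
    qed
    also have "a m * (\<Prod>j\<in>{..n} - {m}. a j) = (\<Prod>j\<le>n. a j)"
      using m(1) by (intro prod.remove[symmetric]) auto
    finally show ?thesis .
  qed
  also have "\<dots> \<le> (\<Sum>k\<le>n. \<Prod>j\<in>{..n} - {k}. a j powr (real (Suc n) / real n))"
    using m(1) by (intro member_le_sum) (auto intro: prod_nonneg)
  finally show ?thesis .
qed

lemma measurable_component_update_sum [measurable]:
  fixes g :: "'v::euclidean_space \<Rightarrow> 'b::topological_space" and n :: nat
  assumes [measurable]: "g \<in> borel_measurable borel" and j: "j \<le> n"
  shows "(\<lambda>x. g ((x(n := s - (\<Sum>i<n. x i))) j)) \<in> borel_measurable (Pi\<^sub>M {..<n} (\<lambda>_. lborel))"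
proof (cases "j = n")
  case False
  with j have "j < n" by simp
  then have "(\<lambda>x. x j) \<in> measurable (Pi\<^sub>M {..<n} (\<lambda>_. lborel :: 'v measure)) lborel"
    by (intro measurable_component_singleton) simp
  from measurable_compose[OF this, of g borel] show ?thesis using False by simp
next
  case True
  have [measurable]: "(\<lambda>x. \<Sum>i<n. x i) \<in> borel_measurable (Pi\<^sub>M {..<n} (\<lambda>_. lborel :: 'v measure))"
    by (intro borel_measurable_sum) (use measurable_component_singleton[of _ "{..<n}" "\<lambda>_. lborel :: 'v measure"] in auto)
  show ?thesis using True by simp
qed

lemma prod_le_ennreal:
  fixes f g :: "'x \<Rightarrow> ennreal"
  shows "(\<And>j. j \<in> A \<Longrightarrow> f j \<le> g j) \<Longrightarrow> prod f A \<le> prod g A"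
  by (induction A rule: infinite_finite_induct) (auto intro!: mult_mono)

text \<open>Any n of the n + 1 coordinates of the hyperplane are free coordinates for the same
  Lebesgue measure. For k < n the integral over x k is taken first: this variable enters only
  through the last coordinate, and invariance under translation and reflection makes that coordinate
  free.\<close>

lemma nn_integral_hyperplane_omit:
  fixes H :: "nat \<Rightarrow> 'v::euclidean_space \<Rightarrow> ennreal"
  assumes H [measurable]: "\<And>j. H j \<in> borel_measurable borel" and k: "k \<le> n"
  shows "(\<integral>\<^sup>+x. (\<Prod>j\<in>{..n} - {k}. H j ((x(n := s - (\<Sum>i<n. x i))) j)) \<partial>Pi\<^sub>M {..<n} (\<lambda>_. lborel)) =
    (\<Prod>j\<in>{..n} - {k}. \<integral>\<^sup>+y. H j y \<partial>lborel)"
proof -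
  interpret product_sigma_finite "\<lambda>_::nat. lborel :: 'v measure" ..
  show ?thesis
  proof (cases "k = n")
    case True
    then have eq: "{..n} - {k} = {..<n}" by auto
    have "(\<integral>\<^sup>+x. (\<Prod>j<n. H j ((x(n := s - (\<Sum>i<n. x i))) j)) \<partial>Pi\<^sub>M {..<n} (\<lambda>_. lborel)) =
        (\<integral>\<^sup>+x. (\<Prod>j<n. H j (x j)) \<partial>Pi\<^sub>M {..<n} (\<lambda>_. lborel))"
      by (intro nn_integral_cong prod.cong) auto
    also have "\<dots> = (\<Prod>j<n. \<integral>\<^sup>+y. H j y \<partial>lborel)"
      by (rule product_nn_integral_prod) auto
    finally show ?thesis unfolding eq .
  next
    case False
    define I where "I = {..<n} - {k}"
    have I: "finite I" "k \<notin> I" "insert k I = {..<n}" "{..n} - {k} = insert n I" "n \<notin> I"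
      using k False by (auto simp: I_def)
    let ?f = "\<lambda>x. \<Prod>j\<in>{..n} - {k}. H j ((x(n := s - (\<Sum>i<n. x i))) j)"
    have f: "?f \<in> borel_measurable (Pi\<^sub>M (insert k I) (\<lambda>_. lborel))"
      unfolding I(3) by (intro borel_measurable_prod_ennreal measurable_component_update_sum) auto
    have "(\<integral>\<^sup>+x. ?f x \<partial>Pi\<^sub>M {..<n} (\<lambda>_. lborel)) = (\<integral>\<^sup>+x. \<integral>\<^sup>+y. ?f (x(k := y)) \<partial>lborel \<partial>Pi\<^sub>M I (\<lambda>_. lborel))"
      using product_nn_integral_insert[OF I(1,2) f] unfolding I(3) .
    also have "\<dots> = (\<integral>\<^sup>+x. (\<integral>\<^sup>+y. H n y \<partial>lborel) * (\<Prod>j\<in>I. H j (x j)) \<partial>Pi\<^sub>M I (\<lambda>_. lborel))"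
    proof (intro nn_integral_cong)
      fix x :: "nat \<Rightarrow> 'v"
      have "?f (x(k := y)) = H n ((s - (\<Sum>i\<in>I. x i)) - y) * (\<Prod>j\<in>I. H j (x j))" for y
      proof -
        have "(\<Sum>i<n. (x(k := y)) i) = y + (\<Sum>i\<in>I. x i)"
          unfolding I(3)[symmetric] using I(1,2) by (simp add: sum.insert) (intro sum.cong, auto)
        moreover have "(\<Prod>j\<in>I. H j (((x(k := y))(n := z)) j)) = (\<Prod>j\<in>I. H j (x j))" for z
          using I(2,5) by (intro prod.cong) auto
        ultimately show ?thesis
          unfolding I(4) using I(1,5) by (simp add: diff_diff_add add.commute)
      qed
      then have "(\<integral>\<^sup>+y. ?f (x(k := y)) \<partial>lborel) = (\<integral>\<^sup>+y. H n ((s - (\<Sum>i\<in>I. x i)) - y) \<partial>lborel) * (\<Prod>j\<in>I. H j (x j))"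
        by (simp add: nn_integral_multc)
      then show "(\<integral>\<^sup>+y. ?f (x(k := y)) \<partial>lborel) = (\<integral>\<^sup>+y. H n y \<partial>lborel) * (\<Prod>j\<in>I. H j (x j))"
        by (simp add: nn_integral_lborel_reflect)
    qed
    also have "\<dots> = (\<integral>\<^sup>+y. H n y \<partial>lborel) * (\<integral>\<^sup>+x. (\<Prod>j\<in>I. H j (x j)) \<partial>Pi\<^sub>M I (\<lambda>_. lborel))"
      by (intro nn_integral_cmult borel_measurable_prod_ennreal) (auto intro!: measurable_compose[OF measurable_component_singleton])
    also have "(\<integral>\<^sup>+x. (\<Prod>j\<in>I. H j (x j)) \<partial>Pi\<^sub>M I (\<lambda>_. lborel)) = (\<Prod>j\<in>I. \<integral>\<^sup>+y. H j y \<partial>lborel)"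
      by (rule product_nn_integral_prod) (use I in auto)
    also have "(\<integral>\<^sup>+y. H n y \<partial>lborel) * (\<Prod>j\<in>I. \<integral>\<^sup>+y. H j y \<partial>lborel) = (\<Prod>j\<in>{..n} - {k}. \<integral>\<^sup>+y. H j y \<partial>lborel)"
      unfolding I(4) using I(1,5) by simp
    finally show ?thesis .
  qed
qed

text \<open>\<open>hyperplane_conv n g\<close> is the convolution of \<open>g 0, \<dots>, g n\<close>.\<close>

definition hyperplane_conv :: "nat \<Rightarrow> (nat \<Rightarrow> 'v::euclidean_space \<Rightarrow> complex) \<Rightarrow> 'v \<Rightarrow> complex" where
  "hyperplane_conv n g s = (\<integral>x. (\<Prod>j\<le>n. g j ((x(n := s - (\<Sum>i<n. x i))) j)) \<partial>Pi\<^sub>M {..<n} (\<lambda>_. lborel))"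

text \<open>The pointwise bound \<open>prod_le_sum_prod_powr\<close> of the integrand replaces Young's convolution inequality;
  applied to a rescaled last factor it also yields continuity of the convolution.\<close>

lemma nn_integral_hyperplane_bound:
  fixes g :: "nat \<Rightarrow> 'v::euclidean_space \<Rightarrow> complex"
  assumes g [measurable]: "\<And>j. g j \<in> borel_measurable borel" and n: "n \<ge> 1"
    and p: "p = real (Suc n) / real n"
    and N: "\<And>j. j \<le> n \<Longrightarrow> (\<integral>\<^sup>+y. ennreal (norm (g j y) powr p) \<partial>lborel) \<le> ennreal (N j)" "\<And>j. j \<le> n \<Longrightarrow> 0 \<le> N j"
  shows "(\<integral>\<^sup>+x. ennreal (norm (\<Prod>j\<le>n. g j ((x(n := s - (\<Sum>i<n. x i))) j))) \<partial>Pi\<^sub>M {..<n} (\<lambda>_. lborel)) \<le>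
    ennreal (\<Sum>k\<le>n. \<Prod>j\<in>{..n} - {k}. N j)"
proof -
  let ?x = "\<lambda>x. x(n := s - (\<Sum>i<n. x i))"
  have "(\<integral>\<^sup>+x. ennreal (norm (\<Prod>j\<le>n. g j (?x x j))) \<partial>Pi\<^sub>M {..<n} (\<lambda>_. lborel)) \<le>
      (\<integral>\<^sup>+x. (\<Sum>k\<le>n. \<Prod>j\<in>{..n} - {k}. ennreal (norm (g j (?x x j)) powr p)) \<partial>Pi\<^sub>M {..<n} (\<lambda>_. lborel))"
  proof (intro nn_integral_mono)
    fix x :: "nat \<Rightarrow> 'v"
    have "norm (\<Prod>j\<le>n. g j (?x x j)) \<le> (\<Sum>k\<le>n. \<Prod>j\<in>{..n} - {k}. norm (g j (?x x j)) powr p)"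
      unfolding prod_norm[symmetric] p by (rule prod_le_sum_prod_powr[OF n]) simp
    then have "ennreal (norm (\<Prod>j\<le>n. g j (?x x j))) \<le> ennreal (\<Sum>k\<le>n. \<Prod>j\<in>{..n} - {k}. norm (g j (?x x j)) powr p)"
      by (rule ennreal_leI)
    also have "\<dots> = (\<Sum>k\<le>n. \<Prod>j\<in>{..n} - {k}. ennreal (norm (g j (?x x j)) powr p))"
      by (simp add: sum_ennreal[symmetric] prod_ennreal[symmetric] prod_nonneg)
    finally show "ennreal (norm (\<Prod>j\<le>n. g j (?x x j))) \<le> \<dots>" .
  qed
  also have "\<dots> = (\<Sum>k\<le>n. \<integral>\<^sup>+x. (\<Prod>j\<in>{..n} - {k}. ennreal (norm (g j (?x x j)) powr p)) \<partial>Pi\<^sub>M {..<n} (\<lambda>_. lborel))"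
    by (intro nn_integral_sum borel_measurable_prod_ennreal measurable_component_update_sum[where g="\<lambda>y. ennreal (norm (g _ y) powr p)"]) auto
  also have "\<dots> = (\<Sum>k\<le>n. \<Prod>j\<in>{..n} - {k}. \<integral>\<^sup>+y. ennreal (norm (g j y) powr p) \<partial>lborel)"
    by (intro sum.cong refl nn_integral_hyperplane_omit) auto
  also have "\<dots> \<le> (\<Sum>k\<le>n. \<Prod>j\<in>{..n} - {k}. ennreal (N j))"
    using N by (intro sum_mono prod_le_ennreal) auto
  also have "\<dots> = ennreal (\<Sum>k\<le>n. \<Prod>j\<in>{..n} - {k}. N j)"
  proof -
    have "(\<Prod>j\<in>{..n} - {k}. ennreal (N j)) = ennreal (\<Prod>j\<in>{..n} - {k}. N j)" for k
      using N(2) by (intro prod_ennreal) auto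
    moreover have "(\<Sum>k\<le>n. ennreal (\<Prod>j\<in>{..n} - {k}. N j)) = ennreal (\<Sum>k\<le>n. \<Prod>j\<in>{..n} - {k}. N j)"
      using N(2) by (intro sum_ennreal prod_nonneg) auto
    ultimately show ?thesis by simp
  qed
  finally show ?thesis .
qed

lemma norm_integral_le_nn_integral:
  fixes f :: "'x \<Rightarrow> complex"
  assumes "(\<integral>\<^sup>+x. ennreal (norm (f x)) \<partial>M) \<le> ennreal C" "0 \<le> C"
  shows "norm (integral\<^sup>L M f) \<le> C"
proof (cases "integrable M f")
  case True
  from order_trans[OF integral_norm_bound_ennreal[OF this] assms(1)] assms(2) show ?thesis by simp
qed (use assms(2) in \<open>simp add: not_integrable_integral_eq\<close>)

lemma integrable_hyperplane:
  fixes g :: "nat \<Rightarrow> 'v::euclidean_space \<Rightarrow> complex"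
  assumes g [measurable]: "\<And>j. g j \<in> borel_measurable borel"
    and "(\<integral>\<^sup>+x. ennreal (norm (\<Prod>j\<le>n. g j ((x(n := s - (\<Sum>i<n. x i))) j))) \<partial>Pi\<^sub>M {..<n} (\<lambda>_. lborel)) \<le> ennreal C"
  shows "integrable (Pi\<^sub>M {..<n} (\<lambda>_. lborel)) (\<lambda>x. \<Prod>j\<le>n. g j ((x(n := s - (\<Sum>i<n. x i))) j))"
  unfolding integrable_iff_bounded
  by (intro conjI order.strict_trans1[OF assms(2)] borel_measurable_prod measurable_component_update_sum g) auto

text \<open>Only the last factor depends on s, so the difference is the same integral with g n
  replaced by its increment. Dividing the increment by d and multiplying the integral by d gives the
  bound d (A U / d^p + B), where U is the integral of the p-th power of the increment. The term d B
  is made small by the choice of d; the other one then tends to 0 with U.\<close>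

lemma hyperplane_conv_tendsto:
  fixes g :: "nat \<Rightarrow> 'v::euclidean_space \<Rightarrow> complex"
  assumes n: "n \<ge> 1" and p: "p = real (Suc n) / real n"
    and g1: "\<And>j. integrable lborel (g j)" and gp: "\<And>j. integrable lborel (\<lambda>y. norm (g j y) powr p)"
    and s: "s \<longlonglongrightarrow> 0"
  shows "(\<lambda>i. hyperplane_conv n g (s i)) \<longlonglongrightarrow> hyperplane_conv n g 0"
proof -
  have g [measurable]: "g j \<in> borel_measurable borel" for j
    using borel_measurable_integrable[OF g1[of j]] by simp
  have p1: "1 \<le> p" using n by (simp add: p)
  define N where "N j = (\<integral>y. norm (g j y) powr p \<partial>lborel)" for j
  have N: "(\<integral>\<^sup>+y. ennreal (norm (g j y) powr p) \<partial>lborel) = ennreal (N j)" "0 \<le> N j" for j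
    unfolding N_def by (auto intro!: nn_integral_eq_integral gp)
  have int: "integrable (Pi\<^sub>M {..<n} (\<lambda>_. lborel)) (\<lambda>x. \<Prod>j\<le>n. g j ((x(n := t - (\<Sum>i<n. x i))) j))" for t
    by (rule integrable_hyperplane[OF g nn_integral_hyperplane_bound[OF g n p]]) (auto simp: N)
  define U where "U t = (\<integral>y. norm (g n (t + y) - g n y) powr p \<partial>lborel)" for t
  have U0: "0 \<le> U t" for t by (simp add: U_def)
  have U: "(\<lambda>i. U (s i)) \<longlonglongrightarrow> 0"
    unfolding U_def by (rule Lp_translation_tendsto(1)[OF g1 gp p1 s])
  define A where "A = (\<Sum>k<n. \<Prod>j\<in>{..<n} - {k}. N j)"
  define B where "B = (\<Prod>j<n. N j)"
  have AB: "0 \<le> A" "0 \<le> B" using N(2) by (auto simp: A_def B_def intro!: sum_nonneg prod_nonneg)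
  have bound: "norm (hyperplane_conv n g t - hyperplane_conv n g 0) \<le> d * (A * (U t / d powr p) + B)" if d: "0 < d" for t d
  proof -
    define h where "h = g(n := \<lambda>y. (g n (t + y) - g n y) / of_real d)"
    have h [measurable]: "h j \<in> borel_measurable borel" for j by (simp add: h_def)
    have prod_split: "(\<Prod>j\<le>n. k j ((x(n := z)) j)) = (\<Prod>j<n. k j (x j)) * k n z" for k :: "nat \<Rightarrow> 'v \<Rightarrow> complex" and x z
      by (simp add: lessThan_Suc_atMost[symmetric])
    have "hyperplane_conv n g t - hyperplane_conv n g 0 = of_real d * hyperplane_conv n h 0"
      unfolding hyperplane_conv_def integral_mult_right_zero[symmetric] Bochner_Integration.integral_diff[OF int int, symmetric]
      unfolding prod_split using d
      by (intro Bochner_Integration.integral_cong refl) (simp add: h_def field_simps)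
    moreover have "norm (hyperplane_conv n h 0) \<le> (\<Sum>k\<le>n. \<Prod>j\<in>{..n} - {k}. (N(n := U t / d powr p)) j)"
      unfolding hyperplane_conv_def
    proof (rule norm_integral_le_nn_integral[OF nn_integral_hyperplane_bound[OF h n p]])
      have "(\<integral>\<^sup>+y. ennreal (norm (h n y) powr p) \<partial>lborel) = (\<integral>\<^sup>+y. ennreal (norm (g n (t + y) - g n y) powr p / d powr p) \<partial>lborel)"
        using d by (simp add: h_def norm_divide powr_divide)
      also have "\<dots> = ennreal (\<integral>y. norm (g n (t + y) - g n y) powr p / d powr p \<partial>lborel)"
        by (intro nn_integral_eq_integral) (auto intro: Lp_translation_tendsto(2)[OF g1 gp p1 s])
      finally have "(\<integral>\<^sup>+y. ennreal (norm (h n y) powr p) \<partial>lborel) = ennreal (U t / d powr p)"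
        by (simp add: U_def)
      then show "(\<integral>\<^sup>+y. ennreal (norm (h j y) powr p) \<partial>lborel) \<le> ennreal ((N(n := U t / d powr p)) j)" for j
        by (cases "j = n") (simp_all add: N h_def)
      show nonneg: "0 \<le> (N(n := U t / d powr p)) j" for j using N(2) U0 by simp
      show "0 \<le> (\<Sum>k\<le>n. \<Prod>j\<in>{..n} - {k}. (N(n := U t / d powr p)) j)"
        by (intro sum_nonneg prod_nonneg nonneg)
    qed
    \<comment> \<open>The summands with k < n contain the last factor once, the summand k = n does
      not contain it.\<close>
    moreover have "(\<Sum>k\<le>n. \<Prod>j\<in>{..n} - {k}. (N(n := z)) j) = A * z + B" for z
    proof -
      have "(\<Prod>j\<in>{..n} - {k}. (N(n := z)) j) = (\<Prod>j\<in>{..<n} - {k}. N j) * z" if "k < n" for k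
      proof -
        have "{..n} - {k} = insert n ({..<n} - {k})" using that by auto
        then have "(\<Prod>j\<in>{..n} - {k}. (N(n := z)) j) = z * (\<Prod>j\<in>{..<n} - {k}. (N(n := z)) j)" by simp
        also have "(\<Prod>j\<in>{..<n} - {k}. (N(n := z)) j) = (\<Prod>j\<in>{..<n} - {k}. N j)" by (intro prod.cong) auto
        finally show ?thesis by (simp add: mult.commute)
      qed
      moreover have "(\<Prod>j\<in>{..n} - {n}. (N(n := z)) j) = B"
        unfolding B_def by (intro prod.cong) auto
      ultimately show ?thesis
        by (simp add: lessThan_Suc_atMost[symmetric] A_def sum_distrib_right del: fun_upd_apply)
    qed
    ultimately show ?thesis using d by (simp add: norm_mult)
  qed
  show ?thesis
  proof (rule LIMSEQ_I)
    fix e :: real assume e: "0 < e"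
    \<comment> \<open>This makes d B at most e/2; the 1 covers B = 0.\<close>
    define d where "d = e / (2 * (B + 1))"
    have d: "0 < d" using e AB by (simp add: d_def)
    have dB: "d * B < e"
    proof -
      have "d * B \<le> e / 2" using e AB by (simp add: d_def field_simps)
      then show ?thesis using e by simp
    qed
    have "(\<lambda>i. d * (A * (U (s i) / d powr p) + B)) \<longlonglongrightarrow> d * (A * (0 / d powr p) + B)"
      using d by (intro tendsto_intros U) simp
    then have "\<forall>\<^sub>F i in sequentially. d * (A * (U (s i) / d powr p) + B) < e"
      using dB by (intro order_tendstoD(2)) auto
    then obtain I where I: "\<And>i. i \<ge> I \<Longrightarrow> d * (A * (U (s i) / d powr p) + B) < e"
      unfolding eventually_sequentially by blast
    show "\<exists>I. \<forall>i\<ge>I. norm (hyperplane_conv n g (s i) - hyperplane_conv n g 0) < e"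
      using order.strict_trans1[OF bound[OF d] I] by blast
  qed
qed

section \<open>Double integrals of translation-invariant kernels\<close>

lemma integrable_pair_mult:
  fixes f :: "'x \<Rightarrow> 'c::{real_normed_field, banach, second_countable_topology}" and g :: "'y \<Rightarrow> 'c"
  assumes "sigma_finite_measure M" "sigma_finite_measure N" and f: "integrable M f" and g: "integrable N g"
  shows "integrable (M \<Otimes>\<^sub>M N) (\<lambda>z. f (fst z) * g (snd z))"
    and "(\<integral>z. f (fst z) * g (snd z) \<partial>(M \<Otimes>\<^sub>M N)) = integral\<^sup>L M f * integral\<^sup>L N g"
proof -
  interpret M: sigma_finite_measure M by fact
  interpret N: sigma_finite_measure N by fact
  interpret pair_sigma_finite M N ..
  have [measurable]: "f \<in> borel_measurable M" "g \<in> borel_measurable N" using f g by auto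
  show int: "integrable (M \<Otimes>\<^sub>M N) (\<lambda>z. f (fst z) * g (snd z))"
    using f g by (intro Fubini_integrable) (auto simp: norm_mult)
  show "(\<integral>z. f (fst z) * g (snd z) \<partial>(M \<Otimes>\<^sub>M N)) = integral\<^sup>L M f * integral\<^sup>L N g"
    using integral_fst'[OF int] by simp
qed

abbreviation cis_prod :: "'v::euclidean_space \<Rightarrow> 'v \<Rightarrow> complex" where
  "cis_prod \<xi> v \<equiv> exp (2 * \<i> * complex_of_real pi * complex_of_real (\<xi> \<bullet> v))"

lemma norm_cis_prod: "norm (cis_prod \<xi> v) = 1"
  by (simp add: norm_exp_eq_Re)

lemma measurable_cis_prod [measurable]:
  assumes [measurable]: "f \<in> borel_measurable M" "g \<in> borel_measurable M"
  shows "(\<lambda>x. cis_prod (f x) (g x)) \<in> borel_measurable M"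
proof -
  have "(\<lambda>z. exp (2 * \<i> * complex_of_real pi * complex_of_real z)) \<in> borel_measurable borel"
    by (intro borel_measurable_continuous_onI continuous_intros)
  then show ?thesis by (rule measurable_compose[rotated]) measurable
qed

lemma cnj_fourier: "cnj (fourier \<psi> \<xi>) = (\<integral>v. of_real (\<psi> v) * cis_prod \<xi> v \<partial>lborel)"
proof -
  have "(\<integral>v. cnj (of_real (\<psi> v) * exp (- (2 * \<i> * complex_of_real pi * complex_of_real (\<xi> \<bullet> v)))) \<partial>lborel) =
      cnj (fourier \<psi> \<xi>)"
    unfolding fourier_def by (rule integral_bounded_linear'[OF bounded_linear_cnj bounded_linear_cnj]) simp
  then show ?thesis by (simp add: exp_cnj)
qed

text \<open>The character at v - u splits into a character at v and a conjugate one at u, so after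
  Fubini the integrals over v and u give the Fourier transform and its conjugate. The space N with
  its frequency map S is left general: it is later a product of copies of V, with the sum of the
  coordinates as S.\<close>

lemma parseval_kernel:
  fixes N :: "'x measure" and T :: "'x \<Rightarrow> complex" and S :: "'x \<Rightarrow> 'v::euclidean_space" and \<psi> :: "'v \<Rightarrow> real"
  assumes N: "sigma_finite_measure N" and \<psi>: "integrable lborel \<psi>" and T: "integrable N T"
    and S [measurable]: "S \<in> borel_measurable N"
  shows "(\<integral>z. of_real (\<psi> (fst z) * \<psi> (snd z)) * (\<integral>x. T x * cis_prod (S x) (fst z - snd z) \<partial>N) \<partial>(lborel \<Otimes>\<^sub>M lborel)) =
    (\<integral>x. T x * of_real ((norm (fourier \<psi> (S x)))\<^sup>2) \<partial>N)"
proof -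
  interpret N: sigma_finite_measure N by fact
  have L: "sigma_finite_measure (lborel \<Otimes>\<^sub>M lborel :: ('v \<times> 'v) measure)"
    unfolding lborel_prod by (rule sigma_finite_lborel)
  interpret L: sigma_finite_measure "lborel \<Otimes>\<^sub>M lborel :: ('v \<times> 'v) measure" by (rule L)
  interpret P: pair_sigma_finite "lborel \<Otimes>\<^sub>M lborel :: ('v \<times> 'v) measure" N ..
  have [measurable]: "\<psi> \<in> borel_measurable borel" "T \<in> borel_measurable N"
    using borel_measurable_integrable[OF \<psi>] T by auto
  let ?\<psi> = "\<lambda>v. complex_of_real (\<psi> v)"
  have \<psi>c: "integrable lborel ?\<psi>" using \<psi> by simp
  have \<psi>2: "integrable (lborel \<Otimes>\<^sub>M lborel) (\<lambda>z. ?\<psi> (fst z) * ?\<psi> (snd z))"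
    by (rule integrable_pair_mult[OF sigma_finite_lborel sigma_finite_lborel \<psi>c \<psi>c])
  let ?f = "\<lambda>z x. ?\<psi> (fst z) * ?\<psi> (snd z) * T x * cis_prod (S x) (fst z - snd z)"
  have "integrable ((lborel \<Otimes>\<^sub>M lborel) \<Otimes>\<^sub>M N) (\<lambda>y. (?\<psi> (fst (fst y)) * ?\<psi> (snd (fst y))) * T (snd y))"
    by (rule integrable_pair_mult[OF L N \<psi>2 T])
  then have int: "integrable ((lborel \<Otimes>\<^sub>M lborel) \<Otimes>\<^sub>M N) (case_prod ?f)"
  proof (rule Bochner_Integration.integrable_bound)
    show "AE y in (lborel \<Otimes>\<^sub>M lborel) \<Otimes>\<^sub>M N. norm (case_prod ?f y) \<le> norm ((?\<psi> (fst (fst y)) * ?\<psi> (snd (fst y))) * T (snd y))"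
      by (intro AE_I2) (simp add: case_prod_unfold norm_mult norm_cis_prod)
  qed measurable
  have "(\<integral>z. of_real (\<psi> (fst z) * \<psi> (snd z)) * (\<integral>x. T x * cis_prod (S x) (fst z - snd z) \<partial>N) \<partial>(lborel \<Otimes>\<^sub>M lborel)) =
      (\<integral>z. \<integral>x. ?f z x \<partial>N \<partial>(lborel \<Otimes>\<^sub>M lborel))"
    by (simp add: mult.assoc flip: integral_mult_right_zero)
  also have "\<dots> = (\<integral>x. \<integral>z. ?f z x \<partial>(lborel \<Otimes>\<^sub>M lborel) \<partial>N)"
    by (rule P.Fubini_integral[OF int, symmetric])
  also have "\<dots> = (\<integral>x. T x * of_real ((norm (fourier \<psi> (S x)))\<^sup>2) \<partial>N)"
  proof (intro Bochner_Integration.integral_cong refl)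
    fix x
    let ?a = "\<lambda>v. ?\<psi> v * cis_prod (S x) v" and ?b = "\<lambda>u. ?\<psi> u * exp (- (2 * \<i> * complex_of_real pi * complex_of_real (S x \<bullet> u)))"
    have "(\<lambda>u. exp (- (2 * \<i> * complex_of_real pi * complex_of_real (S x \<bullet> u)))) \<in> borel_measurable borel"
      by (intro borel_measurable_continuous_onI continuous_intros)
    then have ab: "integrable lborel ?a" "integrable lborel ?b"
      by (auto intro!: Bochner_Integration.integrable_bound[OF \<psi>c] simp: norm_mult norm_cis_prod norm_exp_eq_Re)
    have "?f z x = T x * (?a (fst z) * ?b (snd z))" for z
      by (simp add: inner_diff_right right_diff_distrib exp_diff exp_minus field_simps)
    then have "(\<integral>z. ?f z x \<partial>(lborel \<Otimes>\<^sub>M lborel)) = T x * (\<integral>z. ?a (fst z) * ?b (snd z) \<partial>(lborel \<Otimes>\<^sub>M lborel))"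
      by (simp only: integral_mult_right_zero)
    also have "\<dots> = T x * (cnj (fourier \<psi> (S x)) * fourier \<psi> (S x))"
      unfolding integrable_pair_mult(2)[OF sigma_finite_lborel sigma_finite_lborel ab] cnj_fourier
      unfolding fourier_def ..
    also have "\<dots> = T x * of_real ((norm (fourier \<psi> (S x)))\<^sup>2)"
      by (simp only: complex_norm_square mult.commute[of "cnj _"])
    finally show "(\<integral>z. ?f z x \<partial>(lborel \<Otimes>\<^sub>M lborel)) = T x * of_real ((norm (fourier \<psi> (S x)))\<^sup>2)" .
  qed
  finally show ?thesis .
qed


subsection \<open>Parseval's and Plancherel's identities\<close>

lemma fourier_scale:
  fixes \<phi> :: "'v::euclidean_space \<Rightarrow> real"
  assumes r: "0 < r"
  shows "fourier (\<lambda>v. \<phi> (v /\<^sub>R r)) \<xi> = of_real (r ^ DIM('v)) * fourier \<phi> (r *\<^sub>R \<xi>)"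
proof -
  have r0: "r \<noteq> 0" using r by simp
  show ?thesis
    unfolding fourier_def
    by (subst integral_lborel_affine[OF r0, of _ 0]) (use r in \<open>simp add: scaleR_conv_of_real inner_scaleR_left inner_scaleR_right\<close>)
qed

lemma norm_fourier_le: "norm (fourier \<phi> \<xi>) \<le> (\<integral>v. \<bar>\<phi> v\<bar> \<partial>lborel)"
  unfolding fourier_def
  using integral_norm_bound[of lborel "\<lambda>v. of_real (\<phi> v) * exp (- (2 * \<i> * complex_of_real pi * complex_of_real (\<xi> \<bullet> v)))"]
  by (simp add: norm_mult norm_exp_eq_Re)

lemma measurable_fourier [measurable]:
  assumes "\<phi> \<in> borel_measurable borel"
  shows "fourier \<phi> \<in> borel_measurable borel"
proof -
  have [measurable]: "(\<lambda>z. exp (- (2 * \<i> * complex_of_real pi * complex_of_real z))) \<in> borel_measurable borel"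
    by (intro borel_measurable_continuous_onI continuous_intros)
  note [measurable] = assms
  have "(\<lambda>(\<xi>, v). of_real (\<phi> v) * exp (- (2 * \<i> * complex_of_real pi * complex_of_real (\<xi> \<bullet> v)))) \<in> borel_measurable (borel \<Otimes>\<^sub>M lborel)"
    by measurable
  then show ?thesis
    unfolding fourier_def by (rule lborel.borel_measurable_lebesgue_integral)
qed

lemma prod_cis_prod: "(\<Prod>k\<in>A. cis_prod (x k) w) = cis_prod (\<Sum>k\<in>A. x k) w"
  by (induction A rule: infinite_finite_induct) (simp_all add: inner_add_left distrib_left exp_add)

text \<open>
  By Parseval's identity, the double integral equals
  \<open>\<integral>\<^sub>u \<bar>fourier \<phi> u\<bar>\<^sup>2 hyperplane_conv n g (u / r)\<close>.
\<close>

lemma kernel_limit: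
  fixes \<phi> :: "'v::euclidean_space \<Rightarrow> real" and g :: "nat \<Rightarrow> 'v \<Rightarrow> complex"
  assumes \<phi>: "integrable lborel \<phi>" and \<gamma>: "integrable lborel (\<lambda>\<xi>. (norm (fourier \<phi> \<xi>))\<^sup>2)"
    and g: "\<And>k. integrable lborel (g k)"
    and bound: "\<And>s. (\<integral>\<^sup>+x. ennreal (norm (\<Prod>j\<le>n. g j ((x(n := s - (\<Sum>i<n. x i))) j))) \<partial>Pi\<^sub>M {..<n} (\<lambda>_. lborel)) \<le> ennreal C"
    and C: "0 \<le> C"
    and cont: "\<And>s. s \<longlonglongrightarrow> 0 \<Longrightarrow> (\<lambda>i. hyperplane_conv n g (s i)) \<longlonglongrightarrow> hyperplane_conv n g 0"
  shows "((\<lambda>r. of_real (r powr (- real DIM('v))) *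
      (\<integral>z. of_real (\<phi> (fst z /\<^sub>R r) * \<phi> (snd z /\<^sub>R r)) * (\<Prod>k\<le>n. \<integral>\<xi>. g k \<xi> * cis_prod \<xi> (fst z - snd z) \<partial>lborel) \<partial>(lborel \<Otimes>\<^sub>M lborel)))
    \<longlongrightarrow> of_real (\<integral>\<xi>. (norm (fourier \<phi> \<xi>))\<^sup>2 \<partial>lborel) * hyperplane_conv n g 0) at_top"
proof -
  let ?\<gamma> = "\<lambda>\<xi>. (norm (fourier \<phi> \<xi>))\<^sup>2"
  let ?d = "DIM('v)"
  have [measurable]: "\<phi> \<in> borel_measurable borel" "g k \<in> borel_measurable borel" for k
    using borel_measurable_integrable[OF \<phi>] borel_measurable_integrable[OF g] by auto
  have \<gamma>_meas [measurable]: "?\<gamma> \<in> borel_measurable borel" by measurable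
  have \<gamma>c: "(\<lambda>u. complex_of_real (?\<gamma> u)) \<in> borel_measurable lborel"
    by measurable
  interpret product_sigma_finite "\<lambda>_::nat. lborel :: 'v measure" ..
  let ?P = "Pi\<^sub>M {..<n} (\<lambda>_. lborel :: 'v measure)"
  let ?Q = "Pi\<^sub>M {..n} (\<lambda>_. lborel :: 'v measure)"
  have Psf: "sigma_finite_measure ?P" and Qsf: "sigma_finite_measure ?Q"
    by (intro sigma_finite finite_lessThan finite_atMost)+
  interpret P: sigma_finite_measure ?P by (rule Psf)
  interpret PL: pair_sigma_finite ?P "lborel :: 'v measure" ..
  define T where "T x = (\<Prod>k\<le>n. g k (x k))" for x
  define S where "S x = (\<Sum>k\<le>n. x k)" for x :: "nat \<Rightarrow> 'v"
  have T: "integrable ?Q T" unfolding T_def by (intro product_integrable_prod g) simp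
  have comp [measurable]: "(\<lambda>x. x k) \<in> borel_measurable ?P" if "k < n" for k
    using measurable_component_singleton[of k "{..<n}" "\<lambda>_. lborel :: 'v measure"] that by simp
  have S [measurable]: "S \<in> borel_measurable ?Q"
    unfolding S_def using measurable_component_singleton[of _ "{..n}" "\<lambda>_. lborel :: 'v measure"] by (intro borel_measurable_sum) simp
  define F where "F s u = of_real (?\<gamma> u) * hyperplane_conv n g (s *\<^sub>R u)" for s u
  have sum_meas [measurable]: "(\<lambda>x. \<Sum>i<n. x i) \<in> borel_measurable ?P"
    by (intro borel_measurable_sum) auto
  define A where "A s x u = (\<Prod>j\<le>n. g j ((x(n := s *\<^sub>R u - (\<Sum>i<n. x i))) j))" for s u and x :: "nat \<Rightarrow> 'v"
  have A_conv: "(\<integral>x. A s x u \<partial>?P) = hyperplane_conv n g (s *\<^sub>R u)" for s u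
    by (simp only: A_def hyperplane_conv_def)
  have A_meas: "(\<lambda>x. A s x u) \<in> borel_measurable ?P" for s u
    unfolding A_def by (intro borel_measurable_prod measurable_component_update_sum) auto
  have joint: "(\<lambda>z. A s (fst z) (snd z)) \<in> borel_measurable (?P \<Otimes>\<^sub>M lborel)" for s
    unfolding A_def
  proof (intro borel_measurable_prod)
    fix j assume j: "j \<in> {..n}"
    show "(\<lambda>z. g j (((fst z)(n := s *\<^sub>R snd z - (\<Sum>i<n. fst z i))) j)) \<in> borel_measurable (?P \<Otimes>\<^sub>M lborel)"
    proof (cases "j = n")
      case True
      have "(\<lambda>z. g n (s *\<^sub>R snd z - (\<Sum>i<n. fst z i))) \<in> borel_measurable (?P \<Otimes>\<^sub>M lborel)" by measurable
      with True show ?thesis by simp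
    next
      case False
      then have "j < n" using j by simp
      from measurable_compose[OF measurable_fst comp[OF this]]
      have "(\<lambda>z. g j (fst z j)) \<in> borel_measurable (?P \<Otimes>\<^sub>M (lborel :: 'v measure))" by measurable
      with False show ?thesis by simp
    qed
  qed
  have value_eq: "of_real (r powr (- real ?d)) *
      (\<integral>z. of_real (\<phi> (fst z /\<^sub>R r) * \<phi> (snd z /\<^sub>R r)) * (\<Prod>k\<le>n. \<integral>\<xi>. g k \<xi> * cis_prod \<xi> (fst z - snd z) \<partial>lborel) \<partial>(lborel \<Otimes>\<^sub>M lborel))
    = (\<integral>u. F (1 / r) u \<partial>lborel)" if r: "0 < r" for r
  proof -
    \<comment> \<open>A product of Fourier transforms is an integral over the product space, with
      the character of the total frequency \<open>S x\<close>.\<close>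
    have kernel: "(\<Prod>k\<le>n. \<integral>\<xi>. g k \<xi> * cis_prod \<xi> w \<partial>lborel) = (\<integral>x. T x * cis_prod (S x) w \<partial>?Q)" for w
    proof -
      have "integrable lborel (\<lambda>\<xi>. g k \<xi> * cis_prod \<xi> w)" for k
        by (rule Bochner_Integration.integrable_bound[OF g[of k]]) (auto simp: norm_mult norm_cis_prod)
      from product_integral_prod[OF _ this, of "{..n}"]
      show ?thesis by (simp add: prod.distrib prod_cis_prod T_def S_def)
    qed
    have \<phi>r: "integrable lborel (\<lambda>v. \<phi> (v /\<^sub>R r))"
      by (rule integrable_lborel_scale[OF \<phi> r])
    have "(\<integral>z. of_real (\<phi> (fst z /\<^sub>R r) * \<phi> (snd z /\<^sub>R r)) * (\<Prod>k\<le>n. \<integral>\<xi>. g k \<xi> * cis_prod \<xi> (fst z - snd z) \<partial>lborel) \<partial>(lborel \<Otimes>\<^sub>M lborel)) =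
        (\<integral>x. T x * of_real ((norm (fourier (\<lambda>v. \<phi> (v /\<^sub>R r)) (S x)))\<^sup>2) \<partial>?Q)"
      unfolding kernel by (rule parseval_kernel[OF Qsf \<phi>r T S])
    also have "\<dots> = (\<integral>x. of_real (r ^ (2 * ?d)) * (T x * of_real (?\<gamma> (r *\<^sub>R S x))) \<partial>?Q)"
      using r by (simp add: fourier_scale norm_mult norm_power power_mult_distrib power_even_eq mult.left_commute)
    also have "\<dots> = of_real (r ^ (2 * ?d)) * (\<integral>x. T x * of_real (?\<gamma> (r *\<^sub>R S x)) \<partial>?Q)"
      by (rule integral_mult_right_zero)
    also have "(\<integral>x. T x * of_real (?\<gamma> (r *\<^sub>R S x)) \<partial>?Q) =
        (\<integral>x. \<integral>y. T (x(n := y)) * of_real (?\<gamma> (r *\<^sub>R S (x(n := y)))) \<partial>lborel \<partial>?P)"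
    proof -
      have "integrable ?Q (\<lambda>x. T x * of_real (?\<gamma> (r *\<^sub>R S x)))"
      proof (rule Bochner_Integration.integrable_bound[OF integrable_mult_left[OF T, of "of_real ((\<integral>v. \<bar>\<phi> v\<bar> \<partial>lborel)\<^sup>2)"]])
        show "AE x in ?Q. norm (T x * of_real (?\<gamma> (r *\<^sub>R S x))) \<le> norm (T x * of_real ((\<integral>v. \<bar>\<phi> v\<bar> \<partial>lborel)\<^sup>2))"
          using norm_fourier_le[of \<phi>] by (auto simp: norm_mult norm_power intro!: mult_left_mono power_mono)
      qed (use T in measurable)
      moreover have "insert n {..<n} = {..n}" by auto
      ultimately show ?thesis using product_integral_insert[of "{..<n}" n "\<lambda>x. T x * of_real (?\<gamma> (r *\<^sub>R S x))"] by simp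
    qed
    \<comment> \<open>The last frequency is replaced by u / r minus the sum of the others, so that r
      times the total frequency is u. The Jacobian r^(-d) and the normalization r^(-d) together
      cancel the r^(2d) that comes from the dilation of \<phi>.\<close>
    also have "\<dots> = (\<integral>x. of_real ((1 / r) ^ ?d) * (\<integral>u. A (1 / r) x u * of_real (?\<gamma> u) \<partial>lborel) \<partial>?P)"
    proof (intro Bochner_Integration.integral_cong refl)
      fix x :: "nat \<Rightarrow> 'v"
      have Sx: "S (x(n := y)) = (\<Sum>i<n. x i) + y" for y
        by (simp add: S_def lessThan_Suc_atMost[symmetric])
      have "1 / r \<noteq> 0" using r by simp
      from integral_lborel_affine[OF this, of "\<lambda>y. T (x(n := y)) * of_real (?\<gamma> (r *\<^sub>R S (x(n := y))))" "- (\<Sum>i<n. x i)"]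
      show "(\<integral>y. T (x(n := y)) * of_real (?\<gamma> (r *\<^sub>R S (x(n := y)))) \<partial>lborel) =
        of_real ((1 / r) ^ ?d) * (\<integral>u. A (1 / r) x u * of_real (?\<gamma> u) \<partial>lborel)"
        using r by (simp add: Sx T_def A_def scaleR_conv_of_real del: fun_upd_apply)
    qed
    also have "\<dots> = of_real ((1 / r) ^ ?d) * (\<integral>x. \<integral>u. A (1 / r) x u * of_real (?\<gamma> u) \<partial>lborel \<partial>?P)"
      by (rule integral_mult_right_zero)
    also have "(\<integral>x. \<integral>u. A (1 / r) x u * of_real (?\<gamma> u) \<partial>lborel \<partial>?P) =
        (\<integral>u. \<integral>x. A (1 / r) x u * of_real (?\<gamma> u) \<partial>?P \<partial>lborel)"
    proof (rule PL.Fubini_integral[symmetric])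
      let ?f = "\<lambda>x u. A (1 / r) x u * complex_of_real (?\<gamma> u)"
      from borel_measurable_times[OF joint[of "1 / r"] measurable_compose[OF measurable_snd \<gamma>c]]
      have meas: "(\<lambda>z. ?f (fst z) (snd z)) \<in> borel_measurable (?P \<Otimes>\<^sub>M lborel)" .
      have "(\<integral>\<^sup>+z. ennreal (norm (?f (fst z) (snd z))) \<partial>(?P \<Otimes>\<^sub>M lborel)) = (\<integral>\<^sup>+u. \<integral>\<^sup>+x. ennreal (norm (?f x u)) \<partial>?P \<partial>lborel)"
        using PL.nn_integral_snd[OF measurable_compose[OF measurable_compose[OF meas borel_measurable_norm] measurable_ennreal]] by simp
      also have "\<dots> \<le> (\<integral>\<^sup>+u. ennreal C * ennreal (?\<gamma> u) \<partial>lborel)"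
      proof (intro nn_integral_mono)
        fix u :: 'v
        have "(\<integral>\<^sup>+x. ennreal (norm (?f x u)) \<partial>?P) = (\<integral>\<^sup>+x. ennreal (norm (A (1 / r) x u)) * ennreal (?\<gamma> u) \<partial>?P)"
          by (simp add: norm_mult norm_power ennreal_mult)
        also have "\<dots> = (\<integral>\<^sup>+x. ennreal (norm (A (1 / r) x u)) \<partial>?P) * ennreal (?\<gamma> u)"
          by (rule nn_integral_multc[OF measurable_compose[OF measurable_compose[OF A_meas borel_measurable_norm] measurable_ennreal]])
        also have "\<dots> \<le> ennreal C * ennreal (?\<gamma> u)"
          unfolding A_def by (intro mult_right_mono bound) simp
        finally show "(\<integral>\<^sup>+x. ennreal (norm (?f x u)) \<partial>?P) \<le> ennreal C * ennreal (?\<gamma> u)" .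
      qed
      also have "\<dots> = ennreal C * ennreal (\<integral>u. ?\<gamma> u \<partial>lborel)"
        by (simp add: nn_integral_cmult nn_integral_eq_integral[OF \<gamma>])
      also have "\<dots> < \<infinity>" by (simp add: ennreal_mult_less_top)
      finally show "integrable (?P \<Otimes>\<^sub>M lborel) (case_prod ?f)"
        using meas unfolding integrable_iff_bounded case_prod_unfold by blast
    qed
    also have "\<dots> = (\<integral>u. F (1 / r) u \<partial>lborel)"
      unfolding F_def integral_mult_left_zero A_conv by (simp only: mult.commute)
    finally have "(\<integral>z. of_real (\<phi> (fst z /\<^sub>R r) * \<phi> (snd z /\<^sub>R r)) * (\<Prod>k\<le>n. \<integral>\<xi>. g k \<xi> * cis_prod \<xi> (fst z - snd z) \<partial>lborel) \<partial>(lborel \<Otimes>\<^sub>M lborel)) =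
        of_real (r ^ (2 * ?d)) * (of_real ((1 / r) ^ ?d) * (\<integral>u. F (1 / r) u \<partial>lborel))" .
    moreover have "r powr (- real ?d) * (r ^ (2 * ?d) * (1 / r) ^ ?d) = 1"
      using r by (simp add: powr_minus powr_realpow mult_2 power_add power_one_over)
    then have "complex_of_real (r powr (- real ?d) * (r ^ (2 * ?d) * (1 / r) ^ ?d)) = 1" by (simp only: of_real_1)
    then have "complex_of_real (r powr (- real ?d)) * (of_real (r ^ (2 * ?d)) * (of_real ((1 / r) ^ ?d) * z)) = z" for z
      by (simp only: of_real_mult mult.assoc[symmetric]) simp
    ultimately show ?thesis by (simp only:)
  qed
  have conv_bound: "norm (hyperplane_conv n g s) \<le> C" for s
    unfolding hyperplane_conv_def by (rule norm_integral_le_nn_integral[OF bound C])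
  have F_meas: "F s \<in> borel_measurable lborel" for s
  proof -
    have "(\<lambda>(u, x). A s x u) \<in> borel_measurable (lborel \<Otimes>\<^sub>M ?P)"
      using measurable_compose[OF measurable_pair_swap' joint[of s]] by (simp add: case_prod_unfold)
    from P.borel_measurable_lebesgue_integral[OF this]
    have "(\<lambda>u. hyperplane_conv n g (s *\<^sub>R u)) \<in> borel_measurable lborel"
      unfolding A_conv .
    from borel_measurable_times[OF \<gamma>c this] show ?thesis unfolding F_def .
  qed
  have lim: "((\<lambda>r. \<integral>u. F (1 / r) u \<partial>lborel) \<longlongrightarrow> (\<integral>u. F 0 u \<partial>lborel)) at_top"
  proof (rule tendsto_at_topI_sequentially)
    fix R :: "nat \<Rightarrow> real" assume R: "filterlim R at_top sequentially"
    show "(\<lambda>i. \<integral>u. F (1 / R i) u \<partial>lborel) \<longlonglongrightarrow> (\<integral>u. F 0 u \<partial>lborel)"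
    proof (rule integral_dominated_convergence[where w = "\<lambda>u. C * ?\<gamma> u"])
      show "AE u in lborel. (\<lambda>i. F (1 / R i) u) \<longlonglongrightarrow> F 0 u"
      proof (intro AE_I2)
        fix u :: 'v
        have "(\<lambda>i. (1 / R i) *\<^sub>R u) \<longlonglongrightarrow> 0 *\<^sub>R u"
          by (intro tendsto_scaleR tendsto_const tendsto_divide_0[OF tendsto_const] filterlim_at_top_imp_at_infinity R)
        then have "(\<lambda>i. hyperplane_conv n g ((1 / R i) *\<^sub>R u)) \<longlonglongrightarrow> hyperplane_conv n g 0"
          by (intro cont) simp
        then show "(\<lambda>i. F (1 / R i) u) \<longlonglongrightarrow> F 0 u"
          unfolding F_def by (intro tendsto_mult tendsto_const) simp
      qed
      show "AE u in lborel. norm (F (1 / R i) u) \<le> C * ?\<gamma> u" for i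
      proof (intro AE_I2)
        fix u :: 'v
        have "norm (F (1 / R i) u) = ?\<gamma> u * norm (hyperplane_conv n g ((1 / R i) *\<^sub>R u))"
          unfolding F_def by (simp add: norm_mult norm_power)
        also have "\<dots> \<le> ?\<gamma> u * C" by (intro mult_left_mono conv_bound) simp
        finally show "norm (F (1 / R i) u) \<le> C * ?\<gamma> u" by (simp only: mult.commute)
      qed
    qed (use F_meas \<gamma> in auto)
  qed
  have F0: "(\<integral>u. F 0 u \<partial>lborel) = of_real (\<integral>\<xi>. ?\<gamma> \<xi> \<partial>lborel) * hyperplane_conv n g 0"
    unfolding F_def by (simp flip: of_real_power)
  have "\<forall>\<^sub>F r in at_top. (\<integral>u. F (1 / r) u \<partial>lborel) = of_real (r powr (- real ?d)) *
      (\<integral>z. of_real (\<phi> (fst z /\<^sub>R r) * \<phi> (snd z /\<^sub>R r)) * (\<Prod>k\<le>n. \<integral>\<xi>. g k \<xi> * cis_prod \<xi> (fst z - snd z) \<partial>lborel) \<partial>(lborel \<Otimes>\<^sub>M lborel))"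
    using eventually_gt_at_top[of 0] by eventually_elim (rule value_eq[symmetric])
  from Lim_transform_eventually[OF lim this] show ?thesis unfolding F0 .
qed

section \<open>The Gaussian kernel and its Fourier transform\<close>

lemma lborel_prod_Basis:
  fixes f :: "'v::euclidean_space \<Rightarrow> real \<Rightarrow> complex"
  assumes f: "\<And>b. b \<in> Basis \<Longrightarrow> integrable lborel (f b)"
  shows "integrable lborel (\<lambda>x. \<Prod>b\<in>Basis. f b (x \<bullet> b))"
    and "(\<integral>x. (\<Prod>b\<in>Basis. f b (x \<bullet> b)) \<partial>lborel) = (\<Prod>b\<in>Basis. integral\<^sup>L lborel (f b))"
proof -
  interpret product_sigma_finite "\<lambda>_::'v. lborel :: real measure" ..
  let ?P = "\<Pi>\<^sub>M b\<in>(Basis :: 'v set). (lborel :: real measure)"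
  let ?t = "\<lambda>x. \<Sum>b\<in>Basis. x b *\<^sub>R b :: 'v"
  have [measurable]: "f b \<in> borel_measurable borel" if "b \<in> Basis" for b
    using borel_measurable_integrable[OF f[OF that]] by simp
  have t [measurable]: "?t \<in> measurable ?P borel" by measurable
  have meas: "(\<lambda>x :: 'v. \<Prod>b\<in>Basis. f b (x \<bullet> b)) \<in> borel_measurable borel"
    by (intro borel_measurable_prod) measurable
  have eq: "(\<Prod>b\<in>Basis. f b (?t x \<bullet> b)) = (\<Prod>b\<in>Basis. f b (x b))" for x
    by (intro prod.cong refl) simp
  show "integrable lborel (\<lambda>x :: 'v. \<Prod>b\<in>Basis. f b (x \<bullet> b))"
    unfolding lborel_eq[where 'a = 'v] integrable_distr_eq[OF t meas] eq
    by (intro product_integrable_prod f) auto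
  show "(\<integral>x. (\<Prod>b\<in>Basis. f b (x \<bullet> b)) \<partial>(lborel :: 'v measure)) = (\<Prod>b\<in>Basis. integral\<^sup>L lborel (f b))"
    unfolding lborel_eq[where 'a = 'v] integral_distr[OF t meas] eq
    by (intro product_integral_prod f) auto
qed

text \<open>In this normalization the transform of exp(-x^2/2) is sqrt(2 pi) exp(-2 pi^2 w^2), which
  is the centered normal density of standard deviation 1/(2 pi). It is read off from the
  characteristic function of the standard normal law at 2 pi w.\<close>

lemma gaussian_fourier_real:
  "integrable lborel (\<lambda>x. complex_of_real (exp (- (x\<^sup>2 / 2))))"
  "(\<integral>x. complex_of_real (exp (- (x\<^sup>2 / 2))) * exp (2 * \<i> * complex_of_real pi * complex_of_real (x * w)) \<partial>lborel) =
     complex_of_real (normal_density 0 (1 / (2 * pi)) w)"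
proof -
  have dens: "exp (- (x\<^sup>2 / 2)) = sqrt (2 * pi) * std_normal_density x" for x
    by (simp add: std_normal_density_def)
  have int: "integrable lborel std_normal_density"
    by (rule integrable_normal_density) simp
  then show "integrable lborel (\<lambda>x. complex_of_real (exp (- (x\<^sup>2 / 2))))"
    unfolding dens by simp
  let ?t = "2 * pi * w"
  have "(\<integral>x. std_normal_density x *\<^sub>R iexp (?t * x) \<partial>lborel) = char std_normal_distribution ?t"
    unfolding char_def by (subst integral_density) (auto simp: normal_density_nonneg)
  also have "\<dots> = complex_of_real (exp (- (?t\<^sup>2) / 2))"
    by (simp add: char_std_normal_distribution)
  finally have char: "(\<integral>x. std_normal_density x *\<^sub>R iexp (?t * x) \<partial>lborel) = complex_of_real (exp (- (?t\<^sup>2) / 2))" .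
  have "(\<integral>x. complex_of_real (exp (- (x\<^sup>2 / 2))) * exp (2 * \<i> * complex_of_real pi * complex_of_real (x * w)) \<partial>lborel) =
      (\<integral>x. complex_of_real (sqrt (2 * pi)) * (std_normal_density x *\<^sub>R iexp (?t * x)) \<partial>lborel)"
    unfolding dens by (intro Bochner_Integration.integral_cong refl) (simp add: scaleR_conv_of_real ac_simps)
  also have "\<dots> = complex_of_real (sqrt (2 * pi) * exp (- (?t\<^sup>2) / 2))"
    unfolding integral_mult_right_zero char by simp
  also have "sqrt (2 * pi) * exp (- (?t\<^sup>2) / 2) = normal_density 0 (1 / (2 * pi)) w"
    by (simp add: normal_density_def power_divide power_mult_distrib real_sqrt_divide real_sqrt_mult field_simps)
  finally show "(\<integral>x. complex_of_real (exp (- (x\<^sup>2 / 2))) * exp (2 * \<i> * complex_of_real pi * complex_of_real (x * w)) \<partial>lborel) =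
     complex_of_real (normal_density 0 (1 / (2 * pi)) w)" .
qed

text \<open>The product form fits \<open>lborel_prod_Basis\<close>, and the complex values fit the
  role of G in \<open>kernel_limit_0\<close>.\<close>

definition gauss :: "'v::euclidean_space \<Rightarrow> complex" where
  "gauss x = (\<Prod>b\<in>Basis. complex_of_real (exp (- ((x \<bullet> b)\<^sup>2 / 2))))"

definition gauss_kernel :: "'v::euclidean_space \<Rightarrow> real" where
  "gauss_kernel w = (\<Prod>b\<in>Basis. normal_density 0 (1 / (2 * pi)) (w \<bullet> b))"

lemma integrable_gauss: "integrable lborel (gauss :: 'v::euclidean_space \<Rightarrow> complex)"
  unfolding gauss_def[abs_def] by (rule lborel_prod_Basis(1)) (rule gaussian_fourier_real(1))

lemma gauss_fourier: "(\<integral>x. gauss x * cis_prod x w \<partial>lborel) = complex_of_real (gauss_kernel w)"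
proof -
  have "cis_prod x w = (\<Prod>b\<in>Basis. exp (2 * \<i> * complex_of_real pi * complex_of_real ((x \<bullet> b) * (w \<bullet> b))))" for x
    by (subst euclidean_inner) (simp add: sum_distrib_left exp_sum)
  then have "(\<integral>x. gauss x * cis_prod x w \<partial>lborel) =
    (\<integral>x. (\<Prod>b\<in>Basis. complex_of_real (exp (- ((x \<bullet> b)\<^sup>2 / 2))) * exp (2 * \<i> * complex_of_real pi * complex_of_real ((x \<bullet> b) * (w \<bullet> b)))) \<partial>lborel)"
    by (simp only: gauss_def prod.distrib)
  also have "\<dots> = (\<Prod>b\<in>Basis. \<integral>x. complex_of_real (exp (- (x\<^sup>2 / 2))) * exp (2 * \<i> * complex_of_real pi * complex_of_real (x * (w \<bullet> b))) \<partial>lborel)"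
  proof (rule lborel_prod_Basis(2)[where f = "\<lambda>b x. complex_of_real (exp (- (x\<^sup>2 / 2))) * exp (2 * \<i> * complex_of_real pi * complex_of_real (x * (w \<bullet> b)))"])
    fix b :: 'a
    have "(\<lambda>x. exp (2 * \<i> * complex_of_real pi * complex_of_real (x * (w \<bullet> b)))) \<in> borel_measurable borel"
      by (intro borel_measurable_continuous_onI continuous_intros)
    then show "integrable lborel (\<lambda>x. complex_of_real (exp (- (x\<^sup>2 / 2))) * exp (2 * \<i> * complex_of_real pi * complex_of_real (x * (w \<bullet> b))))"
      by (intro Bochner_Integration.integrable_bound[OF gaussian_fourier_real(1)]) (auto simp: norm_mult norm_exp_eq_Re)
  qed
  finally show ?thesis unfolding gaussian_fourier_real(2) by (simp add: gauss_kernel_def)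
qed

lemma gauss_kernel_nonneg: "0 \<le> gauss_kernel w"
  by (simp add: gauss_kernel_def prod_nonneg normal_density_nonneg)

lemma gauss_kernel_integral:
  "integrable lborel (gauss_kernel :: 'v::euclidean_space \<Rightarrow> real)"
  "(\<integral>w. gauss_kernel w \<partial>(lborel :: 'v measure)) = 1"
proof -
  have 1: "integrable lborel (\<lambda>x. complex_of_real (normal_density 0 (1 / (2 * pi)) x))"
    "(\<integral>x. complex_of_real (normal_density 0 (1 / (2 * pi)) x) \<partial>lborel) = 1"
    by (simp_all add: integral_normal_density)
  have "integrable lborel (\<lambda>w :: 'v. complex_of_real (gauss_kernel w))"
    using lborel_prod_Basis(1)[where 'v = 'v, OF 1(1)] by (simp add: gauss_kernel_def)
  then show "integrable lborel (gauss_kernel :: 'v \<Rightarrow> real)"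
    by (simp add: complex_of_real_integrable_eq)
  have "complex_of_real (\<integral>w. gauss_kernel w \<partial>(lborel :: 'v measure)) = (\<integral>w. complex_of_real (gauss_kernel w) \<partial>(lborel :: 'v measure))"
    by simp
  also have "\<dots> = 1"
    using lborel_prod_Basis(2)[where 'v = 'v, OF 1(1)] by (simp add: gauss_kernel_def 1(2))
  finally show "(\<integral>w. gauss_kernel w \<partial>(lborel :: 'v measure)) = 1" by simp
qed

lemma gauss_kernel_bounded:
  fixes w :: "'v::euclidean_space"
  shows "gauss_kernel w \<le> (\<integral>x. norm (gauss x) \<partial>(lborel :: 'v measure))"
proof -
  have "norm (complex_of_real (gauss_kernel w)) \<le> (\<integral>x. norm (gauss x * cis_prod x w) \<partial>lborel)"
    unfolding gauss_fourier[symmetric] by (rule integral_norm_bound)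
  then show ?thesis by (simp add: norm_mult norm_cis_prod gauss_kernel_nonneg)
qed

lemma continuous_gauss: "continuous_on UNIV gauss"
  unfolding gauss_def by (intro continuous_intros) auto

text \<open>The product measure over the empty index set is a unit mass at one point, so no
  integration is left.\<close>

lemma hyperplane_conv_0: "hyperplane_conv 0 g s = g 0 s"
  "(\<integral>\<^sup>+x. ennreal (norm (\<Prod>j\<le>0::nat. g j ((x(0 := s - (\<Sum>i<0. x i))) j))) \<partial>Pi\<^sub>M {..<0} (\<lambda>_. lborel)) = ennreal (norm (g 0 s))"
  by (simp_all add: hyperplane_conv_def PiM_empty lebesgue_integral_count_space_finite nn_integral_count_space_finite)

text \<open>The case of a single factor. With G the Gaussian it yields the frequency side of
  Plancherel's identity.\<close>

lemma kernel_limit_0: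
  fixes \<phi> :: "'v::euclidean_space \<Rightarrow> real" and G :: "'v \<Rightarrow> complex"
  assumes \<phi>: "integrable lborel \<phi>" and \<gamma>: "integrable lborel (\<lambda>\<xi>. (norm (fourier \<phi> \<xi>))\<^sup>2)"
    and G: "integrable lborel G" "continuous_on UNIV G" "\<And>x. norm (G x) \<le> C"
  shows "((\<lambda>r. of_real (r powr (- real DIM('v))) *
      (\<integral>z. of_real (\<phi> (fst z /\<^sub>R r) * \<phi> (snd z /\<^sub>R r)) * (\<integral>\<xi>. G \<xi> * cis_prod \<xi> (fst z - snd z) \<partial>lborel) \<partial>(lborel \<Otimes>\<^sub>M lborel)))
    \<longlongrightarrow> of_real (\<integral>\<xi>. (norm (fourier \<phi> \<xi>))\<^sup>2 \<partial>lborel) * G 0) at_top"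
proof -
  have "((\<lambda>r. of_real (r powr (- real DIM('v))) *
      (\<integral>z. of_real (\<phi> (fst z /\<^sub>R r) * \<phi> (snd z /\<^sub>R r)) * (\<Prod>k\<le>0::nat. \<integral>\<xi>. G \<xi> * cis_prod \<xi> (fst z - snd z) \<partial>lborel) \<partial>(lborel \<Otimes>\<^sub>M lborel)))
    \<longlongrightarrow> of_real (\<integral>\<xi>. (norm (fourier \<phi> \<xi>))\<^sup>2 \<partial>lborel) * hyperplane_conv 0 (\<lambda>_. G) 0) at_top"
  proof (rule kernel_limit[OF \<phi> \<gamma> G(1)])
    show "(\<integral>\<^sup>+x. ennreal (norm (\<Prod>j\<le>0::nat. G ((x(0 := s - (\<Sum>i<0. x i))) j))) \<partial>Pi\<^sub>M {..<0} (\<lambda>_. lborel)) \<le> ennreal C" for s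
      unfolding hyperplane_conv_0(2)[of "\<lambda>_. G" s] by (intro ennreal_leI G)
    show "0 \<le> C" using order_trans[OF norm_ge_zero G(3)] .
    show "(\<lambda>i. hyperplane_conv 0 (\<lambda>_. G) (s i)) \<longlonglongrightarrow> hyperplane_conv 0 (\<lambda>_. G) 0" if "s \<longlonglongrightarrow> 0" for s
      unfolding hyperplane_conv_0(1) using continuous_on_tendsto_compose[OF G(2) that] by simp
  qed
  then show ?thesis by (simp add: hyperplane_conv_0(1))
qed

text \<open>The normalized double integral of \<phi>(v/r) \<phi>(u/r) against the Gaussian kernel at
  v - u has two limits. In frequency, \<open>kernel_limit_0\<close> gives the integral of
  |F\<phi>|^2, as the Gaussian is 1 at 0. In space it is the average of the autocorrelation
  \<open>\<psi>\<close> at t / r against a probability density in t, which tends to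
  \<open>\<psi> 0\<close>, the integral of \<phi>^2.\<close>

lemma plancherel:
  fixes \<phi> :: "'v::euclidean_space \<Rightarrow> real"
  assumes \<phi>: "integrable lborel \<phi>" and \<phi>2: "integrable lborel (\<lambda>v. (\<phi> v)\<^sup>2)"
    and \<gamma>: "integrable lborel (\<lambda>\<xi>. (norm (fourier \<phi> \<xi>))\<^sup>2)"
  shows "(\<integral>\<xi>. (norm (fourier \<phi> \<xi>))\<^sup>2 \<partial>lborel) = (\<integral>v. (\<phi> v)\<^sup>2 \<partial>lborel)"
proof -
  have [measurable]: "\<phi> \<in> borel_measurable borel" "gauss_kernel \<in> borel_measurable (borel :: 'v measure)"
    using borel_measurable_integrable[OF \<phi>] borel_measurable_integrable[OF gauss_kernel_integral(1)] by auto
  let ?k = "gauss_kernel :: 'v \<Rightarrow> real"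
  let ?d = "DIM('v)"
  have gauss_bound: "norm (gauss x) \<le> 1" for x :: 'v
    by (simp add: gauss_def prod_norm[symmetric] prod_le_1)
  have "gauss (0 :: 'v) = 1" by (simp add: gauss_def)
  with kernel_limit_0[OF \<phi> \<gamma> integrable_gauss continuous_gauss gauss_bound]
  have lim1: "((\<lambda>r. of_real (r powr (- real ?d)) *
      (\<integral>z. of_real (\<phi> (fst z /\<^sub>R r) * \<phi> (snd z /\<^sub>R r)) * complex_of_real (?k (fst z - snd z)) \<partial>(lborel \<Otimes>\<^sub>M lborel)))
    \<longlongrightarrow> of_real (\<integral>\<xi>. (norm (fourier \<phi> \<xi>))\<^sup>2 \<partial>lborel)) at_top"
    by (simp add: gauss_fourier)
  define \<psi> where "\<psi> s = (\<integral>v. \<phi> v * \<phi> (v - s) \<partial>lborel)" for s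
  \<comment> \<open>With the reflected function as second factor the convolution is the
    autocorrelation, and the case n = 1, p = 2 of \<open>hyperplane_conv_tendsto\<close> makes it
    continuous at 0.\<close>
  define g where "g j = (if j = (0::nat) then (\<lambda>v. complex_of_real (\<phi> v)) else (\<lambda>v. complex_of_real (\<phi> (- v))))" for j
  have refl_int: "integrable lborel (\<lambda>v. f (- v))" if "integrable lborel f" for f :: "'v \<Rightarrow> real"
    using integrable_lborel_affine[OF that, of "-1" 0] by simp
  have g1: "integrable lborel (g j)" for j
    using \<phi> refl_int[OF \<phi>] by (simp add: g_def)
  have g2: "integrable lborel (\<lambda>v. norm (g j v) powr 2)" for j
    using \<phi>2 refl_int[OF \<phi>2] by (cases "j = 0") (simp_all add: g_def powr_numeral)
  have conv: "hyperplane_conv 1 g s = complex_of_real (\<psi> s)" for s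
  proof -
    interpret product_sigma_finite "\<lambda>_::nat. lborel :: 'v measure" ..
    have "(\<lambda>y. complex_of_real (\<phi> y * \<phi> (y - s))) \<in> borel_measurable lborel" by measurable
    from product_integral_singleton[OF this, of 0]
    show ?thesis
      by (simp add: hyperplane_conv_def \<psi>_def g_def lessThan_Suc One_nat_def[symmetric] atMost_Suc del: One_nat_def)
         (simp add: lessThan_Suc flip: of_real_mult)
  qed
  have cont: "(\<lambda>i. \<psi> (s i)) \<longlonglongrightarrow> \<psi> 0" if "s \<longlonglongrightarrow> 0" for s
  proof -
    have "(\<lambda>i. hyperplane_conv 1 g (s i)) \<longlonglongrightarrow> hyperplane_conv 1 g 0"
      by (rule hyperplane_conv_tendsto[where p = 2, OF _ _ g1 g2 that]) simp_all
    then show ?thesis unfolding conv by (simp only: tendsto_of_real_iff)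
  qed
  have \<psi>0: "\<psi> 0 = (\<integral>v. (\<phi> v)\<^sup>2 \<partial>lborel)" by (simp add: \<psi>_def power2_eq_square)
  let ?A = "\<integral>v. (\<phi> v)\<^sup>2 \<partial>lborel"
  have shift2: "integrable lborel (\<lambda>v. (\<phi> (v - s))\<^sup>2)" "(\<integral>v. (\<phi> (v - s))\<^sup>2 \<partial>lborel) = ?A" for s
    using integrable_lborel_shift[OF \<phi>2, of "- s"] integral_lborel_shift[of "\<lambda>v. (\<phi> v)\<^sup>2" "- s"] by (simp_all add: add.commute)
  have prod_int: "integrable lborel (\<lambda>v. \<phi> v * \<phi> (v - s))" and abs_int: "(\<integral>v. \<bar>\<phi> v * \<phi> (v - s)\<bar> \<partial>lborel) \<le> ?A" for s
  proof -
    have maj: "integrable lborel (\<lambda>v. ((\<phi> v)\<^sup>2 + (\<phi> (v - s))\<^sup>2) / 2)"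
      using \<phi>2 shift2(1)[of s] by simp
    show i: "integrable lborel (\<lambda>v. \<phi> v * \<phi> (v - s))"
    proof (rule Bochner_Integration.integrable_bound[OF maj])
      show "AE v in lborel. norm (\<phi> v * \<phi> (v - s)) \<le> norm (((\<phi> v)\<^sup>2 + (\<phi> (v - s))\<^sup>2) / 2)"
        unfolding real_norm_def by (intro AE_I2 order_trans[OF abs_mult_le_squares abs_ge_self])
    qed measurable
    have "(\<integral>v. \<bar>\<phi> v * \<phi> (v - s)\<bar> \<partial>lborel) \<le> (\<integral>v. ((\<phi> v)\<^sup>2 + (\<phi> (v - s))\<^sup>2) / 2 \<partial>lborel)"
      using i by (intro integral_mono maj abs_mult_le_squares) simp
    also have "\<dots> = ?A" using \<phi>2 shift2[of s] by simp
    finally show "(\<integral>v. \<bar>\<phi> v * \<phi> (v - s)\<bar> \<partial>lborel) \<le> ?A" .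
  qed
  have bound: "\<bar>\<psi> s\<bar> \<le> ?A" for s
    unfolding \<psi>_def by (rule order_trans[OF integral_abs_bound abs_int])
  have \<psi>_meas [measurable]: "\<psi> \<in> borel_measurable borel"
    unfolding \<psi>_def by (rule lborel.borel_measurable_lebesgue_integral) measurable
  \<comment> \<open>Dominated convergence: the autocorrelation is continuous at 0 and bounded by the
    integral of \<phi>^2, and the Gaussian kernel has mass one.\<close>
  have "((\<lambda>r. \<integral>t. ?k t * \<psi> ((1 / r) *\<^sub>R t) \<partial>lborel) \<longlongrightarrow> (\<integral>t. ?k t * \<psi> 0 \<partial>lborel)) at_top"
  proof (rule tendsto_at_topI_sequentially)
    fix R :: "nat \<Rightarrow> real" assume R: "filterlim R at_top sequentially"
    show "(\<lambda>i. \<integral>t. ?k t * \<psi> ((1 / R i) *\<^sub>R t) \<partial>lborel) \<longlonglongrightarrow> (\<integral>t. ?k t * \<psi> 0 \<partial>lborel)"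
    proof (rule integral_dominated_convergence[where w = "\<lambda>t. ?k t * ?A"])
      show "AE t in lborel. (\<lambda>i. ?k t * \<psi> ((1 / R i) *\<^sub>R t)) \<longlonglongrightarrow> ?k t * \<psi> 0"
      proof (intro AE_I2 tendsto_mult tendsto_const cont)
        fix t :: 'v
        have "(\<lambda>i. (1 / R i) *\<^sub>R t) \<longlonglongrightarrow> 0 *\<^sub>R t"
          by (intro tendsto_scaleR tendsto_const tendsto_divide_0[OF tendsto_const] filterlim_at_top_imp_at_infinity R)
        then show "(\<lambda>i. (1 / R i) *\<^sub>R t) \<longlonglongrightarrow> 0" by simp
      qed
      show "AE t in lborel. norm (?k t * \<psi> ((1 / R i) *\<^sub>R t)) \<le> ?k t * ?A" for i
        using bound by (intro AE_I2) (simp add: abs_mult gauss_kernel_nonneg mult_left_mono)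
    qed (use gauss_kernel_integral(1) in auto)
  qed
  then have lim2: "((\<lambda>r. complex_of_real (\<integral>t. ?k t * \<psi> ((1 / r) *\<^sub>R t) \<partial>lborel)) \<longlongrightarrow> complex_of_real ?A) at_top"
    by (intro tendsto_of_real) (simp add: \<psi>0 gauss_kernel_integral)
  \<comment> \<open>After the substitution t = v - u the variable v is rescaled by r; the Jacobian
    r^d cancels the normalization.\<close>
  have eq: "complex_of_real (\<integral>t. ?k t * \<psi> ((1 / r) *\<^sub>R t) \<partial>lborel) = of_real (r powr (- real ?d)) *
      (\<integral>z. of_real (\<phi> (fst z /\<^sub>R r) * \<phi> (snd z /\<^sub>R r)) * complex_of_real (?k (fst z - snd z)) \<partial>(lborel \<Otimes>\<^sub>M lborel))"
    if r: "0 < r" for r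
  proof -
    define \<phi>r where "\<phi>r v = \<phi> (v /\<^sub>R r)" for v
    have \<phi>r_meas [measurable]: "\<phi>r \<in> borel_measurable borel" unfolding \<phi>r_def by measurable
    have \<phi>r: "integrable lborel \<phi>r"
      unfolding \<phi>r_def by (rule integrable_lborel_scale[OF \<phi> r])
    have scale: "(\<integral>v. f v \<partial>lborel) = r ^ ?d * (\<integral>v. f (r *\<^sub>R v) \<partial>lborel)" for f :: "'v \<Rightarrow> real"
      using integral_lborel_affine[of r f 0] r by simp
    \<comment> \<open>Used for h the identity, which gives the autocorrelation, and for h the
      absolute value, which justifies Fubini.\<close>
    have inner: "(\<integral>v. h (\<phi>r v * \<phi>r (v - t)) \<partial>lborel) = r ^ ?d * (\<integral>v. h (\<phi> v * \<phi> (v - (1 / r) *\<^sub>R t)) \<partial>lborel)" for t and h :: "real \<Rightarrow> real"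
      using r by (subst scale) (simp add: \<phi>r_def scaleR_diff_right divide_inverse)
    have "(\<integral>z. \<phi>r (fst z) * \<phi>r (snd z) * ?k (fst z - snd z) \<partial>(lborel \<Otimes>\<^sub>M lborel)) =
        (\<integral>v. \<integral>u. \<phi>r v * \<phi>r u * ?k (v - u) \<partial>lborel \<partial>lborel)"
    proof (subst lborel_pair.integral_fst'[symmetric])
      have "integrable (lborel \<Otimes>\<^sub>M lborel) (\<lambda>z. (\<phi>r (fst z) * \<phi>r (snd z)) * (\<integral>x. norm (gauss x) \<partial>(lborel :: 'v measure)))"
        by (intro integrable_mult_left integrable_pair_mult(1)[OF sigma_finite_lborel sigma_finite_lborel \<phi>r \<phi>r])
      then show "integrable (lborel \<Otimes>\<^sub>M lborel) (\<lambda>z. \<phi>r (fst z) * \<phi>r (snd z) * ?k (fst z - snd z))"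
        by (rule Bochner_Integration.integrable_bound)
           (auto simp: abs_mult gauss_kernel_nonneg intro!: mult_left_mono order_trans[OF gauss_kernel_bounded])
    qed simp
    also have "\<dots> = (\<integral>v. \<integral>t. \<phi>r v * \<phi>r (v - t) * ?k t \<partial>lborel \<partial>lborel)"
    proof (rule Bochner_Integration.integral_cong[OF refl])
      fix v
      show "(\<integral>u. \<phi>r v * \<phi>r u * ?k (v - u) \<partial>lborel) = (\<integral>t. \<phi>r v * \<phi>r (v - t) * ?k t \<partial>lborel)"
        using integral_lborel_affine[of "-1" "\<lambda>u. \<phi>r v * \<phi>r u * ?k (v - u)" v] by simp
    qed
    also have "\<dots> = (\<integral>t. \<integral>v. \<phi>r v * \<phi>r (v - t) * ?k t \<partial>lborel \<partial>lborel)"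
    proof (rule lborel_pair.Fubini_integral[symmetric])
      let ?f = "\<lambda>z. \<phi>r (fst z) * \<phi>r (fst z - snd z) * ?k (snd z)"
      have "(\<integral>\<^sup>+z. ennreal (norm (?f z)) \<partial>(lborel \<Otimes>\<^sub>M lborel)) = (\<integral>\<^sup>+t. \<integral>\<^sup>+v. ennreal (norm (?f (v, t))) \<partial>lborel \<partial>lborel)"
        by (subst lborel_pair.nn_integral_snd) (auto simp: case_prod_unfold)
      also have "\<dots> \<le> (\<integral>\<^sup>+t. ennreal (r ^ ?d * ?A * ?k t) \<partial>lborel)"
      proof (intro nn_integral_mono)
        fix t :: 'v
        have i: "integrable lborel (\<lambda>v. \<phi>r v * \<phi>r (v - t))"
          using integrable_lborel_affine[OF prod_int[of "(1 / r) *\<^sub>R t"], of "1 / r" 0] r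
          by (simp add: \<phi>r_def scaleR_diff_right divide_inverse)
        have "(\<integral>\<^sup>+v. ennreal (norm (?f (v, t))) \<partial>lborel) = ennreal (\<integral>v. norm (?f (v, t)) \<partial>lborel)"
          using i by (intro nn_integral_eq_integral) auto
        also have "(\<integral>v. norm (?f (v, t)) \<partial>lborel) = (\<integral>v. \<bar>\<phi>r v * \<phi>r (v - t)\<bar> \<partial>lborel) * ?k t"
          by (simp add: abs_mult gauss_kernel_nonneg)
        also have "\<dots> \<le> r ^ ?d * ?A * ?k t"
          unfolding inner using r abs_int by (intro mult_right_mono mult_left_mono gauss_kernel_nonneg) auto
        finally show "(\<integral>\<^sup>+v. ennreal (norm (?f (v, t))) \<partial>lborel) \<le> ennreal (r ^ ?d * ?A * ?k t)"
          by (simp add: ennreal_leI)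
      qed
      also have "\<dots> < \<infinity>"
        using gauss_kernel_integral(1) r by (subst nn_integral_eq_integral) (auto simp: gauss_kernel_nonneg)
      finally show "integrable (lborel \<Otimes>\<^sub>M lborel) (\<lambda>(v, t). \<phi>r v * \<phi>r (v - t) * ?k t)"
        unfolding case_prod_unfold by (intro integrableI_bounded) auto
    qed
    also have "\<dots> = (\<integral>t. r ^ ?d * (?k t * \<psi> ((1 / r) *\<^sub>R t)) \<partial>lborel)"
      using inner[of "\<lambda>x. x"] by (simp add: \<psi>_def mult.commute mult.left_commute)
    also have "\<dots> = r ^ ?d * (\<integral>t. ?k t * \<psi> ((1 / r) *\<^sub>R t) \<partial>lborel)"
      by (rule integral_mult_right_zero)
    finally have J: "(\<integral>z. \<phi>r (fst z) * \<phi>r (snd z) * ?k (fst z - snd z) \<partial>(lborel \<Otimes>\<^sub>M lborel)) = \<dots>" .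
    have "(\<integral>z. of_real (\<phi> (fst z /\<^sub>R r) * \<phi> (snd z /\<^sub>R r)) * complex_of_real (?k (fst z - snd z)) \<partial>(lborel \<Otimes>\<^sub>M lborel)) =
      complex_of_real (\<integral>z. \<phi>r (fst z) * \<phi>r (snd z) * ?k (fst z - snd z) \<partial>(lborel \<Otimes>\<^sub>M lborel))"
      unfolding \<phi>r_def of_real_mult[symmetric] by (rule integral_complex_of_real)
    moreover have "r powr (- real ?d) * (r ^ ?d * z) = z" for z
      using r by (simp add: powr_minus powr_realpow)
    ultimately show ?thesis
      unfolding J by (simp flip: of_real_mult)
  qed
  have "\<forall>\<^sub>F r in at_top. complex_of_real (\<integral>t. ?k t * \<psi> ((1 / r) *\<^sub>R t) \<partial>lborel) = of_real (r powr (- real ?d)) *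
      (\<integral>z. of_real (\<phi> (fst z /\<^sub>R r) * \<phi> (snd z /\<^sub>R r)) * complex_of_real (?k (fst z - snd z)) \<partial>(lborel \<Otimes>\<^sub>M lborel))"
    using eventually_gt_at_top[of 0] by eventually_elim (rule eq)
  from tendsto_unique[OF _ lim1 Lim_transform_eventually[OF lim2 this]]
  show ?thesis by simp
qed


subsection \<open>Variances in terms of the spectral density\<close>

text \<open>Fubini is used twice: on the product of V with the probability space for the mean, and
  with two copies of V for the square. Both times the uniform bound C on the second moments controls
  the inner expectations, and h is integrable.\<close>

lemma (in prob_space) second_moment_of_integral:
  fixes P :: "'v::euclidean_space \<Rightarrow> 'a \<Rightarrow> real" and h :: "'v \<Rightarrow> real"
  assumes meas [measurable]: "(\<lambda>z. P (fst z) (snd z)) \<in> borel_measurable (borel \<Otimes>\<^sub>M M)"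
    and h: "integrable lborel h"
    and sq: "\<And>v. integrable M (\<lambda>\<omega>. (P v \<omega>)\<^sup>2)" "\<And>v. expectation (\<lambda>\<omega>. (P v \<omega>)\<^sup>2) \<le> C"
    and mean: "\<And>v. expectation (P v) = 0"
  shows "variance (\<lambda>\<omega>. \<integral>v. h v * P v \<omega> \<partial>lborel) =
    (\<integral>z. h (fst z) * h (snd z) * expectation (\<lambda>\<omega>. P (fst z) \<omega> * P (snd z) \<omega>) \<partial>(lborel \<Otimes>\<^sub>M lborel))"
proof -
  have L: "sigma_finite_measure (lborel \<Otimes>\<^sub>M lborel :: ('v \<times> 'v) measure)"
    unfolding lborel_prod by (rule sigma_finite_lborel)
  interpret L: sigma_finite_measure "lborel \<Otimes>\<^sub>M lborel :: ('v \<times> 'v) measure" by (rule L)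
  interpret LM: pair_sigma_finite "lborel :: 'v measure" M ..
  interpret LLM: pair_sigma_finite "lborel \<Otimes>\<^sub>M lborel :: ('v \<times> 'v) measure" M ..
  have [measurable]: "h \<in> borel_measurable borel" using borel_measurable_integrable[OF h] by simp
  have P_meas [measurable]: "P v \<in> borel_measurable M" for v
    using measurable_compose[OF measurable_Pair1'[of v borel M] meas] by simp
  have PP: "integrable M (\<lambda>\<omega>. P v \<omega> * P u \<omega>)" and PP_le: "expectation (\<lambda>\<omega>. \<bar>P v \<omega> * P u \<omega>\<bar>) \<le> C" for v u
  proof -
    have maj: "integrable M (\<lambda>\<omega>. ((P v \<omega>)\<^sup>2 + (P u \<omega>)\<^sup>2) / 2)" using sq(1)[of v] sq(1)[of u] by simp
    show i: "integrable M (\<lambda>\<omega>. P v \<omega> * P u \<omega>)"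
    proof (rule Bochner_Integration.integrable_bound[OF maj])
      show "AE \<omega> in M. norm (P v \<omega> * P u \<omega>) \<le> norm (((P v \<omega>)\<^sup>2 + (P u \<omega>)\<^sup>2) / 2)"
        unfolding real_norm_def by (intro AE_I2 order_trans[OF abs_mult_le_squares abs_ge_self])
    qed measurable
    have "expectation (\<lambda>\<omega>. \<bar>P v \<omega> * P u \<omega>\<bar>) \<le> expectation (\<lambda>\<omega>. ((P v \<omega>)\<^sup>2 + (P u \<omega>)\<^sup>2) / 2)"
      using i by (intro integral_mono maj abs_mult_le_squares) simp
    also have "\<dots> \<le> C" using sq[of v] sq[of u] by simp
    finally show "expectation (\<lambda>\<omega>. \<bar>P v \<omega> * P u \<omega>\<bar>) \<le> C" .
  qed
  have C: "0 \<le> C" by (rule order_trans[OF _ sq(2)]) simp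
  have P1: "integrable M (P v)" and P1_le: "expectation (\<lambda>\<omega>. \<bar>P v \<omega>\<bar>) \<le> (1 + C) / 2" for v
  proof -
    have am1: "\<bar>P v \<omega>\<bar> \<le> (1 + (P v \<omega>)\<^sup>2) / 2" for \<omega> using abs_mult_le_squares[of 1 "P v \<omega>"] by simp
    have maj: "integrable M (\<lambda>\<omega>. (1 + (P v \<omega>)\<^sup>2) / 2)" using sq(1)[of v] by simp
    show i: "integrable M (P v)"
    proof (rule Bochner_Integration.integrable_bound[OF maj])
      show "AE \<omega> in M. norm (P v \<omega>) \<le> norm ((1 + (P v \<omega>)\<^sup>2) / 2)"
        unfolding real_norm_def by (intro AE_I2 order_trans[OF am1 abs_ge_self])
    qed measurable
    have "expectation (\<lambda>\<omega>. \<bar>P v \<omega>\<bar>) \<le> expectation (\<lambda>\<omega>. (1 + (P v \<omega>)\<^sup>2) / 2)"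
      using i by (intro integral_mono maj am1) simp
    also have "\<dots> \<le> (1 + C) / 2" using sq[of v] by (simp add: prob_space)
    finally show "expectation (\<lambda>\<omega>. \<bar>P v \<omega>\<bar>) \<le> (1 + C) / 2" .
  qed
  define Z where "Z \<omega> = (\<integral>v. h v * P v \<omega> \<partial>lborel)" for \<omega>
  have joint: "(\<lambda>z. h (fst z) * P (fst z) (snd z)) \<in> borel_measurable (lborel \<Otimes>\<^sub>M M)" by measurable
  have "integrable (lborel \<Otimes>\<^sub>M M) (\<lambda>z. h (fst z) * P (fst z) (snd z))"
  proof (rule LM.Fubini_integrable[OF joint])
    show "integrable lborel (\<lambda>v. \<integral>\<omega>. norm (h (fst (v, \<omega>)) * P (fst (v, \<omega>)) (snd (v, \<omega>))) \<partial>M)"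
    proof (rule Bochner_Integration.integrable_bound[OF integrable_mult_left[OF h, of "(1 + C) / 2"]])
      show "(\<lambda>v. \<integral>\<omega>. norm (h (fst (v, \<omega>)) * P (fst (v, \<omega>)) (snd (v, \<omega>))) \<partial>M) \<in> borel_measurable lborel"
        by measurable
      show "AE v in lborel. norm (\<integral>\<omega>. norm (h (fst (v, \<omega>)) * P (fst (v, \<omega>)) (snd (v, \<omega>))) \<partial>M) \<le> norm (h v * ((1 + C) / 2))"
      proof (intro AE_I2)
        fix v
        have "\<bar>h v\<bar> * expectation (\<lambda>\<omega>. \<bar>P v \<omega>\<bar>) \<le> \<bar>h v\<bar> * ((1 + C) / 2)"
          by (intro mult_left_mono P1_le) simp
        then show "norm (\<integral>\<omega>. norm (h (fst (v, \<omega>)) * P (fst (v, \<omega>)) (snd (v, \<omega>))) \<partial>M) \<le> norm (h v * ((1 + C) / 2))"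
          using C by (simp add: abs_mult)
      qed
    qed
    show "AE v in lborel. integrable M (\<lambda>\<omega>. h (fst (v, \<omega>)) * P (fst (v, \<omega>)) (snd (v, \<omega>)))"
      using P1 by simp
  qed
  then have int1: "integrable (lborel \<Otimes>\<^sub>M M) (case_prod (\<lambda>v \<omega>. h v * P v \<omega>))" by (simp add: case_prod_unfold)
  have EZ: "expectation Z = 0"
    unfolding Z_def LM.Fubini_integral[OF int1] by (simp add: mean)
  have Z_meas [measurable]: "Z \<in> borel_measurable M"
    unfolding Z_def using LM.integrable_snd[OF int1] by (rule borel_measurable_integrable)
  let ?f = "\<lambda>z \<omega>. h (fst z) * h (snd z) * (P (fst z) \<omega> * P (snd z) \<omega>)"
  have m2: "(\<lambda>y. ?f (fst y) (snd y)) \<in> borel_measurable ((lborel \<Otimes>\<^sub>M lborel) \<Otimes>\<^sub>M M)"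
  proof -
    have "(\<lambda>y. P (fst (fst y)) (snd y)) \<in> borel_measurable (((lborel :: 'v measure) \<Otimes>\<^sub>M (lborel :: 'v measure)) \<Otimes>\<^sub>M M)"
      "(\<lambda>y. P (snd (fst y)) (snd y)) \<in> borel_measurable (((lborel :: 'v measure) \<Otimes>\<^sub>M (lborel :: 'v measure)) \<Otimes>\<^sub>M M)"
      by (rule measurable_compose[OF _ meas, of "\<lambda>y. (fst (fst y), snd y)", simplified]; measurable)
         (rule measurable_compose[OF _ meas, of "\<lambda>y. (snd (fst y), snd y)", simplified]; measurable)
    note [measurable] = this
    show ?thesis by measurable
  qed
  have h2: "integrable (lborel \<Otimes>\<^sub>M lborel) (\<lambda>z. h (fst z) * h (snd z))"
    by (rule integrable_pair_mult(1)[OF sigma_finite_lborel sigma_finite_lborel h h])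
  have "integrable ((lborel \<Otimes>\<^sub>M lborel) \<Otimes>\<^sub>M M) (\<lambda>y. ?f (fst y) (snd y))"
  proof (rule LLM.Fubini_integrable[OF m2])
    show "integrable (lborel \<Otimes>\<^sub>M lborel) (\<lambda>z. \<integral>\<omega>. norm (?f (fst (z, \<omega>)) (snd (z, \<omega>))) \<partial>M)"
    proof (rule Bochner_Integration.integrable_bound[OF integrable_mult_left[OF h2, of C]])
      have "(\<lambda>(z, \<omega>). norm (?f z \<omega>)) \<in> borel_measurable ((lborel \<Otimes>\<^sub>M lborel) \<Otimes>\<^sub>M M)"
        using measurable_compose[OF m2 borel_measurable_norm] by (simp add: case_prod_unfold)
      from borel_measurable_lebesgue_integral[OF this]
      show "(\<lambda>z. \<integral>\<omega>. norm (?f (fst (z, \<omega>)) (snd (z, \<omega>))) \<partial>M) \<in> borel_measurable (lborel \<Otimes>\<^sub>M lborel)"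
        by simp
      show "AE z in lborel \<Otimes>\<^sub>M lborel. norm (\<integral>\<omega>. norm (?f (fst (z, \<omega>)) (snd (z, \<omega>))) \<partial>M) \<le> norm (h (fst z) * h (snd z) * C)"
      proof (intro AE_I2)
        fix z :: "'v \<times> 'v"
        have "\<bar>h (fst z) * h (snd z)\<bar> * expectation (\<lambda>\<omega>. \<bar>P (fst z) \<omega> * P (snd z) \<omega>\<bar>) \<le> \<bar>h (fst z) * h (snd z)\<bar> * C"
          by (intro mult_left_mono PP_le) simp
        then show "norm (\<integral>\<omega>. norm (?f (fst (z, \<omega>)) (snd (z, \<omega>))) \<partial>M) \<le> norm (h (fst z) * h (snd z) * C)"
          using C by (simp add: abs_mult)
      qed
    qed
    show "AE z in lborel \<Otimes>\<^sub>M lborel. integrable M (\<lambda>\<omega>. ?f (fst (z, \<omega>)) (snd (z, \<omega>)))"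
      using PP by simp
  qed
  then have int2: "integrable ((lborel \<Otimes>\<^sub>M lborel) \<Otimes>\<^sub>M M) (case_prod ?f)" by (simp add: case_prod_unfold)
  \<comment> \<open>The square is computed as a double integral for those \<omega> at which the
    integrand is integrable in both variables, that is for almost every \<omega>.\<close>
  have sect: "AE \<omega> in M. (\<integral>z. ?f z \<omega> \<partial>(lborel \<Otimes>\<^sub>M lborel)) = (Z \<omega>)\<^sup>2"
    using LLM.AE_integrable_snd[OF int2]
  proof eventually_elim
    case (elim \<omega>)
    have "(\<integral>z. ?f z \<omega> \<partial>(lborel \<Otimes>\<^sub>M lborel)) = (\<integral>v. \<integral>u. ?f (v, u) \<omega> \<partial>lborel \<partial>lborel)"
      by (rule lborel_pair.integral_fst'[OF elim, symmetric])
    also have "\<dots> = (\<integral>v. \<integral>u. (h v * P v \<omega>) * (h u * P u \<omega>) \<partial>lborel \<partial>lborel)"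
      by (simp add: ac_simps)
    also have "\<dots> = (Z \<omega>)\<^sup>2"
      unfolding integral_mult_right_zero integral_mult_left_zero Z_def by (simp add: power2_eq_square)
    finally show ?case .
  qed
  have "variance Z = expectation (\<lambda>\<omega>. (Z \<omega>)\<^sup>2)" by (simp add: EZ)
  also have "\<dots> = expectation (\<lambda>\<omega>. \<integral>z. ?f z \<omega> \<partial>(lborel \<Otimes>\<^sub>M lborel))"
    using sect by (intro integral_cong_AE borel_measurable_integrable[OF LLM.integrable_snd[OF int2]]) auto
  also have "\<dots> = (\<integral>z. expectation (\<lambda>\<omega>. ?f z \<omega>) \<partial>(lborel \<Otimes>\<^sub>M lborel))"
    by (rule LLM.Fubini_integral[OF int2])
  finally show ?thesis unfolding Z_def[abs_def] by simp
qed

lemma (in stationary_gaussian) variance_chaos_functional: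
  assumes q: "q \<ge> 1" and \<phi>: "integrable lborel \<phi>" and r: "0 < r"
  shows "variance (chaos_functional M X f q \<phi> r) = r powr (- real DIM('v)) *
    (\<integral>z. \<phi> (fst z /\<^sub>R r) * \<phi> (snd z /\<^sub>R r) *
      expectation (\<lambda>\<omega>. proj f q (X (fst z) \<omega>) * proj f q (X (snd z) \<omega>)) \<partial>(lborel \<Otimes>\<^sub>M lborel))"
proof -
  define P where "P v \<omega> = proj f q (X v \<omega>)" for v \<omega>
  have wick_meas: "(\<lambda>x. wick B (\<lambda>l. l x) (mset (map coord bs))) \<in> borel_measurable borel" for bs :: "'w list"
    by (intro borel_measurable_continuous_onI continuous_at_imp_continuous_on ballI)
       (rule has_derivative_continuous[OF has_derivative_wick[OF symmetric_form_axioms]], auto intro: linear_coordinate)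
  have "proj f q \<in> borel_measurable borel"
    unfolding chaos_proj_wick[abs_def] by (intro borel_measurable_times borel_measurable_const borel_measurable_sum wick_meas)
  from measurable_compose[OF measurable_field this]
  have meas: "(\<lambda>z. P (fst z) (snd z)) \<in> borel_measurable (borel \<Otimes>\<^sub>M M)"
    by (simp add: P_def case_prod_unfold)
  have \<phi>r: "integrable lborel (\<lambda>v. \<phi> (v /\<^sub>R r))"
    by (rule integrable_lborel_scale[OF \<phi> r])
  define C where "C = expectation (\<lambda>\<omega>. (P 0 \<omega>)\<^sup>2)"
  \<comment> \<open>The second moment does not depend on v, since
    \<open>expectation_proj_proj\<close> involves only the lag v - v.\<close>
  have sq: "integrable M (\<lambda>\<omega>. (P v \<omega>)\<^sup>2)" "expectation (\<lambda>\<omega>. (P v \<omega>)\<^sup>2) \<le> C" for v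
    unfolding C_def P_def power2_eq_square
    by (intro all_moments_integrable all_moments_mult proj_all_moments) (simp add: expectation_proj_proj)
  have mean: "expectation (P v) = 0" for v
    unfolding P_def by (rule expectation_proj[OF q])
  let ?c = "r powr (- (real DIM('v) / 2))"
  have "variance (chaos_functional M X f q \<phi> r) = variance (\<lambda>\<omega>. ?c * (\<integral>v. \<phi> (v /\<^sub>R r) * P v \<omega> \<partial>lborel))"
    by (simp add: chaos_functional_def[abs_def] P_def)
  also have "\<dots> = ?c\<^sup>2 * variance (\<lambda>\<omega>. \<integral>v. \<phi> (v /\<^sub>R r) * P v \<omega> \<partial>lborel)"
    by (simp add: power_mult_distrib flip: right_diff_distrib)
  also have "?c\<^sup>2 = r powr (- real DIM('v))"
    using r by (simp add: power2_eq_square flip: powr_add)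
  also have "variance (\<lambda>\<omega>. \<integral>v. \<phi> (v /\<^sub>R r) * P v \<omega> \<partial>lborel) = (\<integral>z. \<phi> (fst z /\<^sub>R r) * \<phi> (snd z /\<^sub>R r) *
      expectation (\<lambda>\<omega>. P (fst z) \<omega> * P (snd z) \<omega>) \<partial>(lborel \<Otimes>\<^sub>M lborel))"
    by (rule second_moment_of_integral[OF meas \<phi>r sq mean])
  finally show ?thesis by (simp only: P_def)
qed

section \<open>Hermitian forms and the spectral density\<close>

lemma linear_cmult:
  fixes l :: "'w::euclidean_space \<Rightarrow> complex"
  shows "linear l \<Longrightarrow> linear (\<lambda>x. c * l x)"
  using linear_compose[OF _ bounded_linear.linear[OF bounded_linear_mult_right[of c]], of l] by (simp add: o_def)

lemma hermitian_form_conj: "hermitian_form H \<Longrightarrow> linear l \<Longrightarrow> linear m \<Longrightarrow> H m l = cnj (H l m)"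
  unfolding hermitian_form_def by blast

lemma hermitian_form_sum_right:
  assumes H: "hermitian_form H" "linear m" "finite I" "\<And>i. i \<in> I \<Longrightarrow> linear (l i)"
  shows "H m (\<lambda>x. \<Sum>i\<in>I. c i * l i x) = (\<Sum>i\<in>I. cnj (c i) * H m (l i))"
proof -
  have "linear (\<lambda>x. \<Sum>i\<in>I. c i * l i x)"
    using H(4) by (intro linear_compose_sum ballI linear_cmult)
  from hermitian_form_conj[OF H(1) this H(2)]
  have "H m (\<lambda>x. \<Sum>i\<in>I. c i * l i x) = cnj (\<Sum>i\<in>I. c i * H (l i) m)"
    by (simp only: hermitian_form_sum_left[OF H])
  also have "\<dots> = (\<Sum>i\<in>I. cnj (c i) * H m (l i))"
    using H(4) by (simp add: hermitian_form_conj[OF H(1) _ H(2)])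
  finally show ?thesis .
qed

lemma hermitian_form_combination:
  assumes H: "hermitian_form H" and lm: "linear l" "linear m"
  shows "H (\<lambda>x. l x + c * m x) (\<lambda>x. l x + c * m x) = H l l + c * H m l + cnj c * H l m + c * cnj c * H m m"
proof -
  have add: "H (\<lambda>x. k x + k' x) n = H k n + H k' n" if "linear k" "linear k'" "linear n" for k k' n
    using H that unfolding hermitian_form_def by blast
  have mult: "H (\<lambda>x. c * k x) n = c * H k n" if "linear k" "linear n" for k n c
    using H that unfolding hermitian_form_def by blast
  let ?k = "\<lambda>x. l x + c * m x"
  have k: "linear ?k" by (intro linear_compose_add linear_cmult lm)
  have left: "H ?k n = H l n + c * H m n" if "linear n" for n
    using add[OF lm(1) linear_cmult[OF lm(2)] that] mult[OF lm(2) that] by simp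
  have "H l ?k = H l l + cnj c * H l m"
    unfolding hermitian_form_conj[OF H k lm(1)] left[OF lm(1)]
    by (simp add: hermitian_form_conj[OF H lm(2) lm(1), symmetric] hermitian_form_conj[OF H lm(1) lm(1), symmetric])
  moreover have "H m ?k = H m l + cnj c * H m m"
    unfolding hermitian_form_conj[OF H k lm(2)] left[OF lm(2)]
    by (simp add: hermitian_form_conj[OF H lm(1) lm(2), symmetric] hermitian_form_conj[OF H lm(2) lm(2), symmetric])
  ultimately show ?thesis
    unfolding left[OF k] by (simp add: algebra_simps)
qed

text \<open>In the expansion the coefficient of \<open>H l m\<close> is \<i>^k times its conjugate,
  that is 1. The coefficients of the other three terms are \<i>^k or \<i>^(2k), which sum to zero
  over the four values of k.\<close>

lemma hermitian_form_polarization: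
  assumes H: "hermitian_form H" and lm: "linear l" "linear m"
  shows "(\<Sum>k<4::nat. \<i> ^ k * H (\<lambda>x. l x + \<i> ^ k * m x) (\<lambda>x. l x + \<i> ^ k * m x)) = 4 * H l m"
  unfolding hermitian_form_combination[OF H lm]
  by (simp add: eval_nat_numeral algebra_simps)

lemma has_density_integrable:
  assumes "has_density \<mu> \<Sigma>" "linear l" "linear m"
  shows "integrable lborel (\<lambda>\<xi>. \<Sigma> \<xi> l m)"
proof -
  have "set_integrable lborel UNIV (\<lambda>\<xi>. \<Sigma> \<xi> l m)"
    using assms unfolding has_density_def by (metis space_borel sets.top)
  then show ?thesis by (simp add: set_integrable_def)
qed

text \<open>\<open>measure_of\<close> depends only on the values on Borel sets; there they are those
  of a measure with density, which brings countable additivity with it.\<close>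

lemma diagonal_measure_density:
  assumes dens: "has_density \<mu> \<Sigma>" and l: "linear l"
  shows "diagonal_measure \<mu> l = density lborel (\<lambda>\<xi>. ennreal (Re (\<Sigma> \<xi> l l)))"
proof -
  have int: "integrable lborel (\<lambda>\<xi>. \<Sigma> \<xi> l l)" by (rule has_density_integrable[OF dens l l])
  have [measurable]: "(\<lambda>\<xi>. \<Sigma> \<xi> l l) \<in> borel_measurable borel" using borel_measurable_integrable[OF int] by simp
  have nonneg: "0 \<le> Re (\<Sigma> \<xi> l l)" for \<xi>
    using dens l unfolding has_density_def psd_hermitian_form_def by blast
  let ?D = "density lborel (\<lambda>\<xi>. ennreal (Re (\<Sigma> \<xi> l l)))"
  have eq: "ennreal (Re (\<mu> A l l)) = emeasure ?D A" if A: "A \<in> sets borel" for A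
  proof -
    have Aint: "integrable lborel (\<lambda>\<xi>. indicator A \<xi> *\<^sub>R \<Sigma> \<xi> l l)"
      using integrable_mult_indicator[OF _ int, of A] A by simp
    have "\<mu> A l l = (\<integral>\<xi>. indicator A \<xi> *\<^sub>R \<Sigma> \<xi> l l \<partial>lborel)"
      using dens l A unfolding has_density_def set_lebesgue_integral_def by blast
    then have "ennreal (Re (\<mu> A l l)) = ennreal (\<integral>\<xi>. Re (indicator A \<xi> *\<^sub>R \<Sigma> \<xi> l l) \<partial>lborel)"
      by (simp only: integral_Re[OF Aint])
    also have "\<dots> = (\<integral>\<^sup>+\<xi>. ennreal (Re (indicator A \<xi> *\<^sub>R \<Sigma> \<xi> l l)) \<partial>lborel)"
      by (rule nn_integral_eq_integral[OF integrable_Re[OF Aint], symmetric]) (simp add: nonneg)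
    also have "\<dots> = emeasure ?D A"
      using A by (subst emeasure_density) (auto intro!: nn_integral_cong simp: indicator_def)
    finally show ?thesis .
  qed
  have "diagonal_measure \<mu> l = measure_of UNIV (sets borel) (emeasure ?D)"
    unfolding diagonal_measure_def
    by (rule measure_of_eq) (auto simp: eq sets.sigma_sets_eq[of borel, simplified])
  also have "\<dots> = ?D"
    using measure_of_of_measure[of ?D] by simp
  finally show ?thesis .
qed

text \<open>\<open>form_integral\<close> consists of four integrals against diagonal measures. Each
  becomes an integral against a density, and polarization under the integral sign recombines them
  into one coefficient of \<Sigma>.\<close>

lemma covariance_spectral:
  assumes spec: "spectral_measure \<mu> \<Omega>" and dens: "has_density \<mu> \<Sigma>" and l: "linear l" and m: "linear m"
  shows "complex_of_real (\<Omega> v l m) = (\<integral>\<xi>. \<Sigma> \<xi> (complexify l) (complexify m) * cis_prod \<xi> v \<partial>lborel)"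
proof -
  let ?l = "complexify l" and ?m = "complexify m"
  let ?k = "\<lambda>k x. ?l x + \<i> ^ k * ?m x"
  have lin: "linear ?l" "linear ?m" by (intro linear_complexify l m)+
  have k: "linear (?k k)" for k by (intro linear_compose_add linear_cmult lin)
  have H: "hermitian_form (\<Sigma> \<xi>)" for \<xi>
    using dens unfolding has_density_def psd_hermitian_form_def by blast
  have nonneg: "0 \<le> Re (\<Sigma> \<xi> (?k k) (?k k))" for \<xi> k
    using dens k unfolding has_density_def psd_hermitian_form_def by blast
  have real: "of_real (Re (\<Sigma> \<xi> (?k k) (?k k))) = \<Sigma> \<xi> (?k k) (?k k)" for \<xi> k
    using hermitian_form_conj[OF H k k, of \<xi> k k] by (simp add: complex_eq_iff)
  have S: "integrable lborel (\<lambda>\<xi>. \<Sigma> \<xi> (?k k) (?k k))" for k by (rule has_density_integrable[OF dens k k])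
  have [measurable]: "(\<lambda>\<xi>. \<Sigma> \<xi> (?k k) (?k k)) \<in> borel_measurable borel" for k
    using borel_measurable_integrable[OF S] by simp
  have diag: "(\<integral>\<xi>. cis_prod \<xi> v \<partial>diagonal_measure \<mu> (?k k)) = (\<integral>\<xi>. \<Sigma> \<xi> (?k k) (?k k) * cis_prod \<xi> v \<partial>lborel)" for k
    unfolding diagonal_measure_density[OF dens k]
    by (subst integral_density) (auto simp: nonneg scaleR_conv_of_real real)
  have int: "integrable lborel (\<lambda>\<xi>. \<i> ^ k * (\<Sigma> \<xi> (?k k) (?k k) * cis_prod \<xi> v))" for k
    by (rule Bochner_Integration.integrable_bound[OF S[of k]]) (auto simp: norm_mult norm_cis_prod norm_power)
  have "complex_of_real (\<Omega> v l m) = form_integral \<mu> (\<lambda>\<xi>. cis_prod \<xi> v) ?l ?m"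
    using spec l m unfolding spectral_measure_def by (simp add: mult.assoc)
  also have "\<dots> = 1 / 4 * (\<Sum>k<4::nat. \<integral>\<xi>. \<i> ^ k * (\<Sigma> \<xi> (?k k) (?k k) * cis_prod \<xi> v) \<partial>lborel)"
    unfolding form_integral_def diag by simp
  also have "\<dots> = 1 / 4 * (\<integral>\<xi>. (\<Sum>k<4::nat. \<i> ^ k * (\<Sigma> \<xi> (?k k) (?k k) * cis_prod \<xi> v)) \<partial>lborel)"
    by (subst Bochner_Integration.integral_sum[OF int]) (rule refl)
  also have "(\<lambda>\<xi>. \<Sum>k<4::nat. \<i> ^ k * (\<Sigma> \<xi> (?k k) (?k k) * cis_prod \<xi> v)) = (\<lambda>\<xi>. 4 * (\<Sigma> \<xi> ?l ?m * cis_prod \<xi> v))"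
    unfolding mult.assoc[symmetric] sum_distrib_right[symmetric] hermitian_form_polarization[OF H lin] ..
  finally show ?thesis by simp
qed

text \<open>Conditions that make the convolution of g 0, ..., g n bounded, and continuous at 0. The
  exponent (n + 1) / n is conjugate to q = n + 1; for n = 0, where the convolution is g 0 itself,
  boundedness and continuity are asked directly.\<close>

definition regular_family :: "nat \<Rightarrow> (nat \<Rightarrow> 'v::euclidean_space \<Rightarrow> complex) \<Rightarrow> bool" where
  "regular_family n g \<longleftrightarrow> (\<forall>k. integrable lborel (g k)) \<and>
    (if n = 0 then continuous_on UNIV (g 0) \<and> bounded (range (g 0))
     else \<forall>k. integrable lborel (\<lambda>\<xi>. norm (g k \<xi>) powr (real (Suc n) / real n)))"

lemma regular_family_bound:
  assumes reg: "regular_family n g"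
  shows "\<exists>C\<ge>0. \<forall>s. (\<integral>\<^sup>+x. ennreal (norm (\<Prod>j\<le>n. g j ((x(n := s - (\<Sum>i<n. x i))) j))) \<partial>Pi\<^sub>M {..<n} (\<lambda>_. lborel)) \<le> ennreal C"
proof (cases "n = 0")
  case True
  with reg have "bounded (range (g 0))" by (simp add: regular_family_def)
  then obtain C where C: "\<And>x. norm (g 0 x) \<le> C" unfolding bounded_iff by blast
  show ?thesis
    unfolding True hyperplane_conv_0(2)
    by (intro exI[of _ C] conjI allI ennreal_leI C order_trans[OF norm_ge_zero C])
next
  case False
  have g [measurable]: "g j \<in> borel_measurable borel" for j
    using reg borel_measurable_integrable[of lborel "g j"] by (simp add: regular_family_def)
  let ?p = "real (Suc n) / real n"
  define N where "N j = (\<integral>y. norm (g j y) powr ?p \<partial>lborel)" for j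
  have N: "(\<integral>\<^sup>+y. ennreal (norm (g j y) powr ?p) \<partial>lborel) \<le> ennreal (N j)" "0 \<le> N j" for j
    unfolding N_def using reg False by (auto simp: regular_family_def nn_integral_eq_integral)
  have "0 \<le> (\<Sum>k\<le>n. \<Prod>j\<in>{..n} - {k}. N j)" using N(2) by (intro sum_nonneg prod_nonneg) auto
  moreover have "1 \<le> n" using False by simp
  ultimately show ?thesis
    by (intro exI[of _ "\<Sum>k\<le>n. \<Prod>j\<in>{..n} - {k}. N j"] conjI allI nn_integral_hyperplane_bound[OF g _ refl N])
qed

lemma regular_family_integrable:
  assumes reg: "regular_family n g"
  shows "integrable (Pi\<^sub>M {..<n} (\<lambda>_. lborel)) (\<lambda>x. \<Prod>j\<le>n. g j ((x(n := s - (\<Sum>i<n. x i))) j))"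
proof -
  obtain C where C: "(\<integral>\<^sup>+x. ennreal (norm (\<Prod>j\<le>n. g j ((x(n := s - (\<Sum>i<n. x i))) j))) \<partial>Pi\<^sub>M {..<n} (\<lambda>_. lborel)) \<le> ennreal C"
    using regular_family_bound[OF reg] by blast
  have "g j \<in> borel_measurable borel" for j
    using reg borel_measurable_integrable[of lborel "g j"] by (simp add: regular_family_def)
  then show ?thesis by (rule integrable_hyperplane[OF _ C])
qed

text \<open>\<open>radial_sup\<close> majorizes the function at each point, the supremum being
  finite because the Fourier transform is bounded by the L^1 norm. This gives the integrability that
  \<open>plancherel\<close> asks for, and the L^2 normalization of \<phi> gives the value 1.\<close>

lemma test_function_fourier:
  fixes \<phi> :: "'v::euclidean_space \<Rightarrow> real"
  assumes \<phi>: "test_function \<phi>"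
  shows "integrable lborel (\<lambda>\<xi>. (norm (fourier \<phi> \<xi>))\<^sup>2)" "(\<integral>\<xi>. (norm (fourier \<phi> \<xi>))\<^sup>2 \<partial>lborel) = 1"
proof -
  let ?\<gamma> = "\<lambda>\<xi>. (norm (fourier \<phi> \<xi>))\<^sup>2"
  have \<phi>1: "integrable lborel \<phi>" and \<phi>2: "integrable lborel (\<lambda>v. (\<phi> v)\<^sup>2)" "(\<integral>v. (\<phi> v)\<^sup>2 \<partial>lborel) = 1"
    and sup: "integrable lborel (radial_sup ?\<gamma>)"
    using \<phi> by (auto simp: test_function_def)
  have [measurable]: "\<phi> \<in> borel_measurable borel" using borel_measurable_integrable[OF \<phi>1] by simp
  have bdd: "bdd_above (?\<gamma> ` A)" for A
    by (rule bdd_aboveI2[of _ _ "(\<integral>v. \<bar>\<phi> v\<bar> \<partial>lborel)\<^sup>2"]) (intro power_mono norm_fourier_le norm_ge_zero)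
  have le: "?\<gamma> x \<le> radial_sup ?\<gamma> x" for x
    unfolding radial_sup_def by (rule cSUP_upper[OF _ bdd]) simp
  show int: "integrable lborel ?\<gamma>"
  proof (rule Bochner_Integration.integrable_bound[OF sup])
    show "AE x in lborel. norm (?\<gamma> x) \<le> norm (radial_sup ?\<gamma> x)"
      using order_trans[OF le abs_ge_self] by (intro AE_I2) simp
  qed measurable
  show "(\<integral>\<xi>. ?\<gamma> \<xi> \<partial>lborel) = 1"
    using plancherel[OF \<phi>1 \<phi>2(1) int] \<phi>2(2) by simp
qed

lemma regular_kernel_limit:
  fixes \<phi> :: "'v::euclidean_space \<Rightarrow> real"
  assumes \<phi>: "test_function \<phi>" and reg: "regular_family n g"
  shows "((\<lambda>r. of_real (r powr (- real DIM('v))) *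
      (\<integral>z. of_real (\<phi> (fst z /\<^sub>R r) * \<phi> (snd z /\<^sub>R r)) * (\<Prod>k\<le>n. \<integral>\<xi>. g k \<xi> * cis_prod \<xi> (fst z - snd z) \<partial>lborel) \<partial>(lborel \<Otimes>\<^sub>M lborel)))
    \<longlongrightarrow> hyperplane_conv n g 0) at_top"
proof -
  obtain C where C: "0 \<le> C" "\<And>s. (\<integral>\<^sup>+x. ennreal (norm (\<Prod>j\<le>n. g j ((x(n := s - (\<Sum>i<n. x i))) j))) \<partial>Pi\<^sub>M {..<n} (\<lambda>_. lborel)) \<le> ennreal C"
    using regular_family_bound[OF reg] by blast
  have g: "integrable lborel (g k)" for k using reg by (simp add: regular_family_def)
  have cont: "(\<lambda>i. hyperplane_conv n g (s i)) \<longlonglongrightarrow> hyperplane_conv n g 0" if s: "s \<longlonglongrightarrow> 0" for s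
  proof (cases "n = 0")
    case True
    then have "continuous_on UNIV (g 0)" using reg by (simp add: regular_family_def)
    from continuous_on_tendsto_compose[OF this s] show ?thesis
      unfolding True hyperplane_conv_0(1) by simp
  next
    case False
    then show ?thesis
      using reg g s by (intro hyperplane_conv_tendsto[OF _ refl]) (auto simp: regular_family_def)
  qed
  have "integrable lborel \<phi>" using \<phi> by (simp add: test_function_def)
  from kernel_limit[OF this test_function_fourier(1)[OF \<phi>] g C(2,1) cont]
  show ?thesis unfolding test_function_fourier(2)[OF \<phi>] by simp
qed

context stationary_gaussian
begin

text \<open>G is any regular family whose Fourier transforms are the covariances, not necessarily
  the coefficients of \<Sigma>. This freedom is used for q = 2, where a partly reflected family
  leads to the trace formula.\<close>

lemma variance_limit:
  fixes \<phi> :: "'v \<Rightarrow> real" and G :: "'w list \<Rightarrow> 'w list \<Rightarrow> nat \<Rightarrow> 'v \<Rightarrow> complex"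
  assumes q: "q = Suc n" and \<phi>: "test_function \<phi>"
    and cov: "\<And>bs cs k v. k \<le> n \<Longrightarrow>
      complex_of_real (covariance M X v (coord (bs ! k)) (coord (cs ! k))) = (\<integral>\<xi>. G bs cs k \<xi> * cis_prod \<xi> v \<partial>lborel)"
    and reg: "\<And>bs cs. regular_family n (G bs cs)"
  shows "((\<lambda>r. complex_of_real (variance (chaos_functional M X f q \<phi> r))) \<longlongrightarrow>
    1 / fact q * (\<Sum>bs\<in>multi_indices q. \<Sum>cs\<in>multi_indices q.
       of_real (coeff f bs) * of_real (coeff f cs) * hyperplane_conv n (G bs cs) 0)) at_top"
proof -
  define I where "I bs cs r = of_real (r powr (- real DIM('v))) *
      (\<integral>z. of_real (\<phi> (fst z /\<^sub>R r) * \<phi> (snd z /\<^sub>R r)) * (\<Prod>k\<le>n. \<integral>\<xi>. G bs cs k \<xi> * cis_prod \<xi> (fst z - snd z) \<partial>lborel) \<partial>(lborel \<Otimes>\<^sub>M lborel))"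
    for bs cs r
  have q1: "1 \<le> q" using q by simp
  have \<phi>1: "integrable lborel \<phi>" using \<phi> by (simp add: test_function_def)
  have G: "integrable lborel (G bs cs k)" for bs cs k
    using reg[of bs cs] by (simp add: regular_family_def)
  have lim: "((\<lambda>r. 1 / fact q * (\<Sum>bs\<in>multi_indices q. \<Sum>cs\<in>multi_indices q. of_real (coeff f bs) * of_real (coeff f cs) * I bs cs r)) \<longlongrightarrow>
      1 / fact q * (\<Sum>bs\<in>multi_indices q. \<Sum>cs\<in>multi_indices q. of_real (coeff f bs) * of_real (coeff f cs) * hyperplane_conv n (G bs cs) 0)) at_top"
    unfolding I_def by (intro tendsto_mult tendsto_const tendsto_sum regular_kernel_limit[OF \<phi> reg])
  have eq: "1 / fact q * (\<Sum>bs\<in>multi_indices q. \<Sum>cs\<in>multi_indices q. of_real (coeff f bs) * of_real (coeff f cs) * I bs cs r) =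
     complex_of_real (variance (chaos_functional M X f q \<phi> r))" if r: "0 < r" for r
  proof -
    define \<phi>r where "\<phi>r v = \<phi> (v /\<^sub>R r)" for v
    have \<phi>r: "integrable lborel \<phi>r"
      unfolding \<phi>r_def by (rule integrable_lborel_scale[OF \<phi>1 r])
    define R where "R bs cs w = (\<Prod>k\<le>n. \<integral>\<xi>. G bs cs k \<xi> * cis_prod \<xi> w \<partial>lborel)" for bs cs w
    have R: "complex_of_real (\<Prod>k<q. covariance M X w (coord (bs ! k)) (coord (cs ! k))) = R bs cs w" for bs cs w
      unfolding R_def q lessThan_Suc_atMost of_real_prod by (intro prod.cong refl cov) simp
    have Rint: "integrable (lborel \<Otimes>\<^sub>M lborel) (\<lambda>z. complex_of_real (\<phi>r (fst z) * \<phi>r (snd z)) * R bs cs (fst z - snd z))" for bs cs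
    proof (rule Bochner_Integration.integrable_bound)
      have "integrable (lborel \<Otimes>\<^sub>M lborel) (\<lambda>z. \<phi>r (fst z) * \<phi>r (snd z))"
        by (rule integrable_pair_mult(1)[OF sigma_finite_lborel sigma_finite_lborel \<phi>r \<phi>r])
      then show "integrable (lborel \<Otimes>\<^sub>M lborel) (\<lambda>z. \<phi>r (fst z) * \<phi>r (snd z) * (\<Prod>k\<le>n. \<integral>\<xi>. norm (G bs cs k \<xi>) \<partial>lborel))"
        by (rule integrable_mult_left)
      \<comment> \<open>Each covariance is bounded by the L^1 norm of its spectral coefficient. The
        kernel is thus bounded, and the finite sums can be taken out of the double integral.\<close>
      have "norm (R bs cs w) \<le> (\<Prod>k\<le>n. \<integral>\<xi>. norm (G bs cs k \<xi>) \<partial>lborel)" for w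
        unfolding R_def prod_norm[symmetric]
      proof (intro prod_mono conjI norm_ge_zero)
        fix k
        show "norm (\<integral>\<xi>. G bs cs k \<xi> * cis_prod \<xi> w \<partial>lborel) \<le> (\<integral>\<xi>. norm (G bs cs k \<xi>) \<partial>lborel)"
          using integral_norm_bound[of lborel "\<lambda>\<xi>. G bs cs k \<xi> * cis_prod \<xi> w"] by (simp add: norm_mult norm_cis_prod)
      qed
      then show "AE z in lborel \<Otimes>\<^sub>M lborel. norm (complex_of_real (\<phi>r (fst z) * \<phi>r (snd z)) * R bs cs (fst z - snd z)) \<le>
          norm (\<phi>r (fst z) * \<phi>r (snd z) * (\<Prod>k\<le>n. \<integral>\<xi>. norm (G bs cs k \<xi>) \<partial>lborel))"
        by (intro AE_I2) (simp add: norm_mult abs_mult mult_left_mono order_trans[OF _ abs_ge_self])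
      have [measurable]: "\<phi>r \<in> borel_measurable borel" "G bs cs k \<in> borel_measurable borel" for k
        using borel_measurable_integrable[OF \<phi>r] borel_measurable_integrable[OF G] by auto
      have "(\<lambda>w. \<integral>\<xi>. G bs cs k \<xi> * cis_prod \<xi> w \<partial>lborel) \<in> borel_measurable borel" for k
        by (rule lborel.borel_measurable_lebesgue_integral) measurable
      then have [measurable]: "R bs cs \<in> borel_measurable borel"
        unfolding R_def[abs_def] by (rule borel_measurable_prod)
      show "(\<lambda>z. complex_of_real (\<phi>r (fst z) * \<phi>r (snd z)) * R bs cs (fst z - snd z)) \<in> borel_measurable (lborel \<Otimes>\<^sub>M lborel)"
        by measurable
    qed
    have "complex_of_real (variance (chaos_functional M X f q \<phi> r)) = of_real (r powr (- real DIM('v))) *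
        (\<integral>z. complex_of_real (\<phi>r (fst z) * \<phi>r (snd z) * (1 / fact q * (\<Sum>bs\<in>multi_indices q. \<Sum>cs\<in>multi_indices q. coeff f bs * coeff f cs *
        (\<Prod>k<q. covariance M X (fst z - snd z) (coord (bs ! k)) (coord (cs ! k)))))) \<partial>(lborel \<Otimes>\<^sub>M lborel))"
      unfolding variance_chaos_functional[OF q1 \<phi>1 r] \<phi>r_def expectation_proj_proj of_real_mult[of "r powr _"] integral_complex_of_real ..
    also have "(\<lambda>z. complex_of_real (\<phi>r (fst z) * \<phi>r (snd z) * (1 / fact q * (\<Sum>bs\<in>multi_indices q. \<Sum>cs\<in>multi_indices q. coeff f bs * coeff f cs *
        (\<Prod>k<q. covariance M X (fst z - snd z) (coord (bs ! k)) (coord (cs ! k))))))) =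
        (\<lambda>z. 1 / fact q * (\<Sum>bs\<in>multi_indices q. \<Sum>cs\<in>multi_indices q. (of_real (coeff f bs) * of_real (coeff f cs)) *
          (complex_of_real (\<phi>r (fst z) * \<phi>r (snd z)) * R bs cs (fst z - snd z))))"
    proof
      fix z
      show "complex_of_real (\<phi>r (fst z) * \<phi>r (snd z) * (1 / fact q * (\<Sum>bs\<in>multi_indices q. \<Sum>cs\<in>multi_indices q. coeff f bs * coeff f cs *
        (\<Prod>k<q. covariance M X (fst z - snd z) (coord (bs ! k)) (coord (cs ! k)))))) =
        1 / fact q * (\<Sum>bs\<in>multi_indices q. \<Sum>cs\<in>multi_indices q. (of_real (coeff f bs) * of_real (coeff f cs)) *
          (complex_of_real (\<phi>r (fst z) * \<phi>r (snd z)) * R bs cs (fst z - snd z)))"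
        unfolding R[symmetric] by (simp add: sum_distrib_left mult.assoc mult.left_commute)
    qed
    also have "of_real (r powr (- real DIM('v))) * (\<integral>z. 1 / fact q * (\<Sum>bs\<in>multi_indices q. \<Sum>cs\<in>multi_indices q. (of_real (coeff f bs) * of_real (coeff f cs)) *
          (complex_of_real (\<phi>r (fst z) * \<phi>r (snd z)) * R bs cs (fst z - snd z))) \<partial>(lborel \<Otimes>\<^sub>M lborel)) =
        1 / fact q * (\<Sum>bs\<in>multi_indices q. \<Sum>cs\<in>multi_indices q. of_real (coeff f bs) * of_real (coeff f cs) * I bs cs r)"
      unfolding integral_mult_right_zero
      apply (subst Bochner_Integration.integral_sum)
       apply (intro Bochner_Integration.integrable_sum integrable_mult_right Rint)
      apply (subst Bochner_Integration.integral_sum)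
       apply (intro integrable_mult_right Rint)
      unfolding integral_mult_right_zero I_def R_def \<phi>r_def
      by (simp only: sum_distrib_left mult.assoc mult.left_commute)
    finally show ?thesis ..
  qed
  have "\<forall>\<^sub>F r in at_top. 1 / fact q * (\<Sum>bs\<in>multi_indices q. \<Sum>cs\<in>multi_indices q. of_real (coeff f bs) * of_real (coeff f cs) * I bs cs r) =
     complex_of_real (variance (chaos_functional M X f q \<phi> r))"
    using eventually_gt_at_top[of 0] by eventually_elim (rule eq)
  from Lim_transform_eventually[OF lim this] show ?thesis .
qed

end


subsection \<open>The limit formula\<close>

lemma sum_multi_indices_1:
  fixes f :: "'w::euclidean_space list \<Rightarrow> 'a::comm_monoid_add"
  shows "(\<Sum>bs\<in>multi_indices (Suc 0). f bs) = (\<Sum>b\<in>Basis. f [b])"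
proof -
  have "multi_indices 0 = {[] :: 'w list}" by (auto simp: multi_indices_def)
  then show ?thesis by (subst sum_multi_indices_insert[of 0]) simp_all
qed

lemma sum_multi_indices_2:
  fixes f :: "'w::euclidean_space list \<Rightarrow> 'a::comm_monoid_add"
  shows "(\<Sum>bs\<in>multi_indices (Suc (Suc 0)). f bs) = (\<Sum>b\<in>Basis. \<Sum>c\<in>Basis. f [b, c])"
  by (subst sum_multi_indices_insert[of 0]) (simp_all add: sum_multi_indices_1)

text \<open>Flattening four nested sums into one over quadruples lets a single interchange move four
  indices past four others.\<close>

lemma sum_nested4:
  "(\<Sum>a\<in>A. \<Sum>b\<in>A. \<Sum>c\<in>A. \<Sum>d\<in>A. f a b c d) =
    (\<Sum>p\<in>A \<times> A \<times> A \<times> A. f (fst p) (fst (snd p)) (fst (snd (snd p))) (snd (snd (snd p))))"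
  by (simp add: sum.cartesian_product case_prod_unfold)

lemma sum_nested3_reverse: "(\<Sum>l\<in>I. \<Sum>k\<in>I. \<Sum>j\<in>I. t j k l) = (\<Sum>j\<in>I. \<Sum>k\<in>I. \<Sum>l\<in>I. t j k l)"
proof -
  have "(\<Sum>l\<in>I. \<Sum>k\<in>I. \<Sum>j\<in>I. t j k l) = (\<Sum>k\<in>I. \<Sum>l\<in>I. \<Sum>j\<in>I. t j k l)"
    by (rule sum.swap)
  also have "\<dots> = (\<Sum>k\<in>I. \<Sum>j\<in>I. \<Sum>l\<in>I. t j k l)"
    by (rule sum.cong[OF refl], rule sum.swap)
  also have "\<dots> = (\<Sum>j\<in>I. \<Sum>k\<in>I. \<Sum>l\<in>I. t j k l)"
    by (rule sum.swap)
  finally show ?thesis .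
qed

lemma sum_nested2_product:
  fixes p r :: "'x \<Rightarrow> 'y \<Rightarrow> 'c::comm_semiring_0"
  shows "(\<Sum>i\<in>A. \<Sum>j\<in>B. p i j) * (\<Sum>k\<in>C. \<Sum>l\<in>D. r k l) = (\<Sum>i\<in>A. \<Sum>j\<in>B. \<Sum>k\<in>C. \<Sum>l\<in>D. p i j * r k l)"
  unfolding sum_distrib_right by (simp only: sum_distrib_left)

lemma sum_nested4_swap:
  "(\<Sum>a\<in>A. \<Sum>b\<in>A. \<Sum>c\<in>A. \<Sum>d\<in>A. \<Sum>i\<in>I. \<Sum>j\<in>I. \<Sum>k\<in>I. \<Sum>l\<in>I. t a b c d i j k l) =
    (\<Sum>i\<in>I. \<Sum>j\<in>I. \<Sum>k\<in>I. \<Sum>l\<in>I. \<Sum>a\<in>A. \<Sum>b\<in>A. \<Sum>c\<in>A. \<Sum>d\<in>A. t a b c d i j k l)"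
  unfolding sum_nested4[of _ I] sum_nested4[of _ A] by (rule sum.swap)

section \<open>Matrices of forms in an arbitrary basis\<close>

context
  fixes es :: "'w::euclidean_space list"
  assumes es: "basis_list es"
begin

lemma dual_basis_expand: "(\<Sum>i<length es. dual_basis es i x *\<^sub>R es ! i) = x"
proof -
  have "(\<Sum>b\<in>set es. representation (set es) x b *\<^sub>R b) = x"
    by (rule real_vector.sum_representation_eq) (use es in \<open>auto simp: basis_list_def\<close>)
  moreover have "set es = (!) es ` {..<length es}" by (auto simp: set_conv_nth)
  moreover have "inj_on ((!) es) {..<length es}"
    using es by (auto simp: basis_list_def inj_on_def nth_eq_iff_index_eq)
  ultimately show ?thesis
    by (simp add: sum.reindex dual_basis_def)
qed

lemma linear_dual_basis: "linear (dual_basis es i)"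
proof -
  have "independent (set es)" "\<And>x. x \<in> span (set es)" using es by (auto simp: basis_list_def)
  then show ?thesis
    unfolding dual_basis_def
    by (intro linearI) (simp_all add: real_vector.representation_add real_vector.representation_scale)
qed

lemma coord_dual_basis: "complexify (coord b) = (\<lambda>x. \<Sum>i<length es. of_real (es ! i \<bullet> b) * complexify (dual_basis es i) x)"
proof
  fix x
  have "x \<bullet> b = (\<Sum>i<length es. dual_basis es i x *\<^sub>R es ! i) \<bullet> b" by (simp only: dual_basis_expand)
  then show "complexify (coord b) x = (\<Sum>i<length es. of_real (es ! i \<bullet> b) * complexify (dual_basis es i) x)"
    by (simp add: complexify_def inner_sum_left mult.commute)
qed

lemma hermitian_form_dual_basis:
  assumes H: "hermitian_form H"
  shows "H (complexify (coord b)) (complexify (coord c)) =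
    (\<Sum>i<length es. \<Sum>j<length es. of_real ((es ! i \<bullet> b) * (es ! j \<bullet> c)) * H (complexify (dual_basis es i)) (complexify (dual_basis es j)))"
proof -
  have lin: "linear (complexify (dual_basis es i))" for i by (intro linear_complexify linear_dual_basis)
  have linc: "linear (complexify (coord b))" for b :: 'w by (intro linear_complexify linear_coordinate)
  have "H (complexify (coord b)) (complexify (coord c)) = (\<Sum>i<length es. of_real (es ! i \<bullet> b) * H (complexify (dual_basis es i)) (complexify (coord c)))"
    unfolding coord_dual_basis[of b] by (rule hermitian_form_sum_left[OF H linc]) (auto intro: lin)
  also have "\<dots> = (\<Sum>i<length es. of_real (es ! i \<bullet> b) * (\<Sum>j<length es. cnj (of_real (es ! j \<bullet> c)) * H (complexify (dual_basis es i)) (complexify (dual_basis es j))))"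
    unfolding coord_dual_basis[of c] by (subst hermitian_form_sum_right[OF H lin]) (auto intro: lin)
  finally show ?thesis by (simp add: sum_distrib_left mult.assoc)
qed

text \<open>The matrix product gives the cyclic pattern S(i,j) g(j,k) S(k,l) g(l,i). Expanding g in
  the standard basis and resumming the two forms removes every trace of \<open>es\<close>. The
  result contains H(b,c) H(c',b'), whereas \<open>tensor_hermitian\<close> has H(b,c) H(b',c'): the
  arguments of the second form are exchanged.\<close>

lemma mat_trace_forms:
  assumes H: "hermitian_form H" and g_sym: "\<And>x y. g [x, y] = g [y, x]"
    and g_bilin: "\<And>x y. g [x, y] = (\<Sum>b\<in>Basis. \<Sum>c\<in>Basis. (x \<bullet> b) * (y \<bullet> c) * g [b, c])"
  shows "mat_trace (dual_form_matrix es H * bilinear_form_matrix es g * dual_form_matrix es H * bilinear_form_matrix es g) =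
    (\<Sum>b\<in>Basis. \<Sum>b'\<in>Basis. \<Sum>c\<in>Basis. \<Sum>c'\<in>Basis. of_real (g [b, b']) * of_real (g [c, c']) *
       (H (complexify (coord b)) (complexify (coord c)) * H (complexify (coord c')) (complexify (coord b'))))"
proof -
  let ?n = "length es"
  define S where "S i j = H (complexify (dual_basis es i)) (complexify (dual_basis es j))" for i j
  define a where "a i b = complex_of_real (es ! i \<bullet> b)" for i and b :: 'w
  define \<gamma> where "\<gamma> b c = complex_of_real (g [b, c])" for b c
  let ?A = "dual_form_matrix es H" and ?B = "bilinear_form_matrix es g"
  have dims: "?A \<in> carrier_mat ?n ?n" "?B \<in> carrier_mat ?n ?n"
    by (simp_all add: dual_form_matrix_def bilinear_form_matrix_def)
  have A: "?A $$ (i, j) = S i j" and B: "?B $$ (i, j) = \<gamma> (es ! i) (es ! j)" if "i < ?n" "j < ?n" for i j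
    using that by (simp_all add: dual_form_matrix_def bilinear_form_matrix_def S_def \<gamma>_def)
  have mult: "(P * Q) $$ (i, j) = (\<Sum>k<?n. P $$ (i, k) * Q $$ (k, j))"
    if "P \<in> carrier_mat ?n ?n" "Q \<in> carrier_mat ?n ?n" "i < ?n" "j < ?n" for P Q :: "complex mat" and i j
    using that by (auto simp: scalar_prod_def atLeast0LessThan intro!: sum.cong)
  have carr: "P * Q \<in> carrier_mat ?n ?n" if "P \<in> carrier_mat ?n ?n" "Q \<in> carrier_mat ?n ?n" for P Q :: "complex mat"
    using that by (rule mult_carrier_mat)
  note cs = carr[OF dims] carr[OF carr[OF dims] dims(1)]
  have "mat_trace (?A * ?B * ?A * ?B) = (\<Sum>i<?n. (?A * ?B * ?A * ?B) $$ (i, i))"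
    using dims by (simp add: mat_trace_def)
  also have "\<dots> = (\<Sum>i<?n. \<Sum>l<?n. \<Sum>k<?n. \<Sum>j<?n. S i j * \<gamma> (es ! j) (es ! k) * S k l * \<gamma> (es ! l) (es ! i))"
  proof (intro sum.cong refl)
    fix i assume "i \<in> {..<?n}"
    then have i: "i < ?n" by simp
    have AB: "(?A * ?B) $$ (i, k) = (\<Sum>j<?n. S i j * \<gamma> (es ! j) (es ! k))" if "k < ?n" for k
      unfolding mult[OF dims i that] by (intro sum.cong refl) (simp only: A B i that lessThan_iff)
    have ABA: "(?A * ?B * ?A) $$ (i, l) = (\<Sum>k<?n. (\<Sum>j<?n. S i j * \<gamma> (es ! j) (es ! k)) * S k l)" if "l < ?n" for l
      unfolding mult[OF cs(1) dims(1) i that] by (intro sum.cong refl) (simp only: AB A that lessThan_iff)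
    have "(?A * ?B * ?A * ?B) $$ (i, i) = (\<Sum>l<?n. (\<Sum>k<?n. (\<Sum>j<?n. S i j * \<gamma> (es ! j) (es ! k)) * S k l) * \<gamma> (es ! l) (es ! i))"
      unfolding mult[OF cs(2) dims(2) i i] by (intro sum.cong refl) (simp only: ABA B i lessThan_iff)
    then show "(?A * ?B * ?A * ?B) $$ (i, i) = (\<Sum>l<?n. \<Sum>k<?n. \<Sum>j<?n. S i j * \<gamma> (es ! j) (es ! k) * S k l * \<gamma> (es ! l) (es ! i))"
      by (simp only: sum_distrib_right)
  qed
  also have "\<dots> = (\<Sum>i<?n. \<Sum>j<?n. \<Sum>k<?n. \<Sum>l<?n. S i j * \<gamma> (es ! j) (es ! k) * S k l * \<gamma> (es ! l) (es ! i))"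
    by (rule sum.cong[OF refl]) (rule sum_nested3_reverse)
  also have "\<dots> = (\<Sum>i<?n. \<Sum>j<?n. \<Sum>k<?n. \<Sum>l<?n. \<Sum>b\<in>Basis. \<Sum>b'\<in>Basis. \<Sum>c\<in>Basis. \<Sum>c'\<in>Basis.
      (a i b * a l b' * \<gamma> b b') * (a j c * a k c' * \<gamma> c c') * (S i j * S k l))"
  proof (intro sum.cong refl)
    fix i j k l
    have e: "\<gamma> (es ! i) (es ! j) = (\<Sum>b\<in>Basis. \<Sum>c\<in>Basis. a i b * a j c * \<gamma> b c)" for i j
      unfolding \<gamma>_def a_def by (subst g_bilin) simp
    \<comment> \<open>Symmetry of g attaches b to the index i of the first form and b' to the index
      l of the second, as \<open>hermitian_form_dual_basis\<close> requires.\<close>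
    have "\<gamma> (es ! l) (es ! i) = (\<Sum>b\<in>Basis. \<Sum>b'\<in>Basis. a i b * a l b' * \<gamma> b b')"
      unfolding e[symmetric] by (simp add: \<gamma>_def g_sym)
    moreover have "\<gamma> (es ! j) (es ! k) = (\<Sum>c\<in>Basis. \<Sum>c'\<in>Basis. a j c * a k c' * \<gamma> c c')"
      by (rule e)
    moreover have "S i j * (\<Sum>c\<in>Basis. \<Sum>c'\<in>Basis. a j c * a k c' * \<gamma> c c') * S k l * (\<Sum>b\<in>Basis. \<Sum>b'\<in>Basis. a i b * a l b' * \<gamma> b b') =
      (\<Sum>b\<in>Basis. \<Sum>b'\<in>Basis. a i b * a l b' * \<gamma> b b') * (\<Sum>c\<in>Basis. \<Sum>c'\<in>Basis. a j c * a k c' * \<gamma> c c') * (S i j * S k l)"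
      by (simp only: ac_simps)
    moreover have "\<dots> = (\<Sum>b\<in>Basis. \<Sum>b'\<in>Basis. \<Sum>c\<in>Basis. \<Sum>c'\<in>Basis.
      (a i b * a l b' * \<gamma> b b') * (a j c * a k c' * \<gamma> c c') * (S i j * S k l))"
      unfolding sum_nested2_product by (simp only: sum_distrib_right)
    ultimately show "S i j * \<gamma> (es ! j) (es ! k) * S k l * \<gamma> (es ! l) (es ! i) = (\<Sum>b\<in>Basis. \<Sum>b'\<in>Basis. \<Sum>c\<in>Basis. \<Sum>c'\<in>Basis.
      (a i b * a l b' * \<gamma> b b') * (a j c * a k c' * \<gamma> c c') * (S i j * S k l))"
      by (simp only:)
  qed
  also have "\<dots> = (\<Sum>b\<in>Basis. \<Sum>b'\<in>Basis. \<Sum>c\<in>Basis. \<Sum>c'\<in>Basis. \<Sum>i<?n. \<Sum>j<?n. \<Sum>k<?n. \<Sum>l<?n.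
      (a i b * a l b' * \<gamma> b b') * (a j c * a k c' * \<gamma> c c') * (S i j * S k l))"
    by (rule sum_nested4_swap)
  also have "\<dots> = (\<Sum>b\<in>Basis. \<Sum>b'\<in>Basis. \<Sum>c\<in>Basis. \<Sum>c'\<in>Basis. \<gamma> b b' * \<gamma> c c' *
       ((\<Sum>i<?n. \<Sum>j<?n. a i b * a j c * S i j) * (\<Sum>k<?n. \<Sum>l<?n. a k c' * a l b' * S k l)))"
    unfolding sum_nested2_product unfolding sum_distrib_left by (intro sum.cong refl) (simp only: ac_simps)
  finally show ?thesis
    unfolding hermitian_form_dual_basis[OF H] S_def a_def \<gamma>_def of_real_mult .
qed

end

context stationary_gaussian
begin

lemma continuous_hermite: "continuous_on UNIV (\<lambda>x. hermite_form B x ws)"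
  unfolding hermite_form_wick
  by (intro continuous_at_imp_continuous_on ballI)
     (rule has_derivative_continuous[OF has_derivative_wick[OF symmetric_form_axioms]], auto intro: linear_T)

text \<open>The Hermite form is a polynomial in Gaussian variables, hence square integrable under
  the law of X 0, as f is.\<close>

lemma integrable_hermite_coeff:
  assumes f: "L2_function \<eta> f"
  shows "integrable \<eta> (\<lambda>x. f x * hermite_form B x ws)"
proof -
  let ?h = "\<lambda>x. hermite_form B x ws"
  have [measurable]: "?h \<in> borel_measurable borel" "f \<in> borel_measurable borel"
    using f by (auto intro!: borel_measurable_continuous_onI continuous_hermite simp: L2_function_def)
  have "(\<lambda>\<omega>. ?h (X 0 \<omega>)) \<in> all_moments M"
    unfolding hermite_form_wick by (intro wick_X_all_moments) (auto intro: linear_T)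
  then have "integrable M (\<lambda>\<omega>. (?h (X 0 \<omega>))\<^sup>2)"
    unfolding power2_eq_square by (intro all_moments_integrable all_moments_mult)
  then have h2: "integrable \<eta> (\<lambda>x. (?h x)\<^sup>2)" by (subst integrable_distr_eq) auto
  have f2: "integrable \<eta> (\<lambda>x. (f x)\<^sup>2)" using f by (simp add: L2_function_def)
  show ?thesis
  proof (rule Bochner_Integration.integrable_bound[OF Bochner_Integration.integrable_add[OF f2 h2]])
    have "\<bar>a * b\<bar> \<le> \<bar>a\<^sup>2 + b\<^sup>2\<bar>" for a b :: real
      by (rule abs_mult_le_abs_squares)
    then show "AE x in \<eta>. norm (f x * ?h x) \<le> norm ((f x)\<^sup>2 + (?h x)\<^sup>2)" by simp
  qed measurable
qed

lemma coeff_1: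
  assumes f: "L2_function \<eta> f"
  shows "coeff f [x] = (\<Sum>b\<in>Basis. (x \<bullet> b) * coeff f [b])"
proof -
  have h: "hermite_form B z [x] = T x z" for x z by (simp add: hermite_form_wick wick_add_mset)
  have int: "integrable \<eta> (\<lambda>z. (x \<bullet> b) * (f z * T b z))" for b
    using integrable_hermite_coeff[OF f, of "[b]"] by (simp add: h)
  have "coeff f [x] = (\<integral>z. (\<Sum>b\<in>Basis. (x \<bullet> b) * (f z * T b z)) \<partial>\<eta>)"
    unfolding chaos_coeff_def h T_expand[of x] by (simp add: sum_distrib_left mult.left_commute)
  also have "\<dots> = (\<Sum>b\<in>Basis. \<integral>z. (x \<bullet> b) * (f z * T b z) \<partial>\<eta>)"
    by (rule Bochner_Integration.integral_sum[OF int])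
  finally show ?thesis by (simp add: chaos_coeff_def h)
qed

text \<open>The Hermite form of order two at z is T x z T y z - T x y, which is bilinear in x and y;
  this passes to the coefficient because f times each Hermite form is integrable.\<close>

lemma coeff_2:
  assumes f: "L2_function \<eta> f"
  shows "coeff f [x, y] = (\<Sum>b\<in>Basis. \<Sum>c\<in>Basis. (x \<bullet> b) * (y \<bullet> c) * coeff f [b, c])"
proof -
  have h: "hermite_form B z [x, y] = T x z * T y z - T x y" for x y z
    by (simp add: hermite_form_wick wick_add_mset B_T[OF linear_T] T_commute[of y x])
  have he: "hermite_form B z [x, y] = (\<Sum>b\<in>Basis. \<Sum>c\<in>Basis. (x \<bullet> b) * (y \<bullet> c) * hermite_form B z [b, c])" for z
  proof -
    have "T x y = (\<Sum>b\<in>Basis. \<Sum>c\<in>Basis. (x \<bullet> b) * (y \<bullet> c) * T b c)"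
    proof -
      have "T b y = (\<Sum>c\<in>Basis. (y \<bullet> c) * T b c)" for b
        using T_expand[of y b] by (simp only: T_commute[of _ b])
      then show ?thesis by (subst T_expand) (simp add: sum_distrib_left mult.assoc)
    qed
    moreover have "T x z * T y z = (\<Sum>b\<in>Basis. \<Sum>c\<in>Basis. (x \<bullet> b) * (y \<bullet> c) * (T b z * T c z))"
      unfolding T_expand[of x] T_expand[of y] sum_product by (simp add: mult.assoc mult.left_commute)
    ultimately show ?thesis
      unfolding h by (simp add: right_diff_distrib sum_subtractf)
  qed
  have int: "integrable \<eta> (\<lambda>z. (x \<bullet> b) * (y \<bullet> c) * (f z * hermite_form B z [b, c]))" for b c
    by (intro integrable_mult_right integrable_hermite_coeff[OF f])
  have "coeff f [x, y] = (\<integral>z. (\<Sum>b\<in>Basis. \<Sum>c\<in>Basis. (x \<bullet> b) * (y \<bullet> c) * (f z * hermite_form B z [b, c])) \<partial>\<eta>)"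
    unfolding chaos_coeff_def he by (simp add: sum_distrib_left mult.left_commute)
  also have "\<dots> = (\<Sum>b\<in>Basis. \<Sum>c\<in>Basis. \<integral>z. (x \<bullet> b) * (y \<bullet> c) * (f z * hermite_form B z [b, c]) \<partial>\<eta>)"
    by (subst Bochner_Integration.integral_sum)
       (intro Bochner_Integration.integrable_sum int sum.cong refl Bochner_Integration.integral_sum)+
  finally show ?thesis by (simp add: chaos_coeff_def)
qed

end

lemma hyperplane_conv_1:
  fixes g :: "nat \<Rightarrow> 'v::euclidean_space \<Rightarrow> complex"
  assumes [measurable]: "\<And>j. g j \<in> borel_measurable borel"
  shows "hyperplane_conv (Suc 0) g s = (\<integral>y. g 0 y * g 1 (s - y) \<partial>lborel)"
proof -
  interpret product_sigma_finite "\<lambda>_::nat. lborel :: 'v measure" ..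
  have "(\<lambda>y. g 0 y * g 1 (s - y)) \<in> borel_measurable lborel" by measurable
  from product_integral_singleton[OF this, of 0]
  show ?thesis
    by (simp add: hyperplane_conv_def atMost_Suc lessThan_Suc mult.commute)
qed

lemma C0_bounded:
  fixes f :: "'v::euclidean_space \<Rightarrow> complex"
  assumes cont: "continuous_on UNIV f" and lim: "(f \<longlongrightarrow> 0) at_infinity"
  shows "bounded (range f)"
proof -
  obtain b where b: "\<And>x. norm x \<ge> b \<Longrightarrow> norm (f x) < 1"
    using tendstoD[OF lim, of 1] by (auto simp: eventually_at_infinity)
  have "compact (f ` cball 0 b)"
    by (intro compact_continuous_image continuous_on_subset[OF cont] compact_cball) simp
  then have "bounded (f ` cball 0 b \<union> cball 0 1)" by (simp add: compact_imp_bounded)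
  moreover have "range f \<subseteq> f ` cball 0 b \<union> cball 0 1"
  proof
    fix y assume "y \<in> range f"
    then obtain x where y: "y = f x" by blast
    show "y \<in> f ` cball 0 b \<union> cball 0 1"
    proof (cases "norm x \<le> b")
      case False
      then have "norm (f x) < 1" using b[of x] by simp
      then show ?thesis by (simp add: y)
    qed (simp add: y)
  qed
  ultimately show ?thesis by (rule bounded_subset)
qed

text \<open>The limits are stated in the complex numbers because \<Sigma> has complex values; as
  limits of variances they are real.\<close>

theorem corollary1p3:
  fixes M :: "'o measure"
    and X :: "'v::euclidean_space \<Rightarrow> 'o \<Rightarrow> 'w::euclidean_space"
    and \<Omega> :: "'v \<Rightarrow> ('w \<Rightarrow> real) \<Rightarrow> ('w \<Rightarrow> real) \<Rightarrow> real"
    and \<mu> :: "'v set \<Rightarrow> ('w \<Rightarrow> complex) \<Rightarrow> ('w \<Rightarrow> complex) \<Rightarrow> complex"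
    and \<Sigma> :: "'v \<Rightarrow> ('w \<Rightarrow> complex) \<Rightarrow> ('w \<Rightarrow> complex) \<Rightarrow> complex"
    and \<eta> :: "'w measure"
    and f :: "'w \<Rightarrow> real"
    and F :: "'w list \<Rightarrow> real"
    and \<phi> :: "'v \<Rightarrow> real"
    and q :: nat
    and p :: real
  assumes "prob_space M"
    and "gaussian_field M X"
    and "centered_field M X"
    and "stationary_field M X"
    and "\<Omega> = covariance M X"
    and "continuous_form \<Omega>"
    and "positive_definite_form (\<Omega> 0)"
    and "spectral_measure \<mu> \<Omega>"
    and "\<eta> = distr M borel (X 0)"
    and "L2_function \<eta> f"
    and "F = chaos_coeff (\<Omega> 0) \<eta> f"
    and "test_function \<phi>"
    and "q \<ge> 1"
    and "q \<ge> 2 \<Longrightarrow> 1 / p + 1 / real q = 1"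
    and "has_density \<mu> \<Sigma>"
    and "q \<ge> 2 \<Longrightarrow> Lp_form p \<Sigma>"
    and "q = 1 \<Longrightarrow> C0_form \<Sigma>"
  shows
    "((\<lambda>r. complex_of_real (prob_space.variance M (chaos_functional M X f q \<phi> r))) \<longlongrightarrow>
        1 / fact q *
        hyperplane_integral q
          (\<lambda>\<xi>. tensor_hermitian (\<lambda>k. \<Sigma> (\<xi> k)) q
                 (\<lambda>ws. complex_of_real (F ws)) (\<lambda>ws. complex_of_real (F ws)))) at_top
     \<and> (q = 1 \<longrightarrow>
        ((\<lambda>r. complex_of_real (prob_space.variance M (chaos_functional M X f 1 \<phi> r))) \<longlongrightarrow>
          \<Sigma> 0 (complexify (\<lambda>w. F [w])) (complexify (\<lambda>w. F [w]))) at_top)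
     \<and> (q = 2 \<longrightarrow> (\<forall>es :: 'w list. basis_list es \<longrightarrow>
        ((\<lambda>r. complex_of_real (prob_space.variance M (chaos_functional M X f 2 \<phi> r))) \<longlongrightarrow>
          1 / 2 * (\<integral>\<xi>. mat_trace
             (dual_form_matrix es (\<Sigma> \<xi>) * bilinear_form_matrix es F *
              dual_form_matrix es (\<Sigma> \<xi>) * bilinear_form_matrix es F) \<partial>lborel)) at_top))"
proof -
  interpret stationary_gaussian M X
    using assms(1-5,7) by (intro stationary_gaussian.intro stationary_gaussian_axioms.intro) auto
  obtain n where q: "q = Suc n" using assms(13) by (cases q) auto
  have F: "F = coeff f" using assms(5,9,11) by simp
  have f: "L2_function (distr M borel (X 0)) f" using assms(9,10) by simp
  note dens = assms(15)
  have herm: "hermitian_form (\<Sigma> \<xi>)" for \<xi>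
    using dens unfolding has_density_def psd_hermitian_form_def by blast
  let ?e = "\<lambda>b :: 'w. complexify (coord b)"
  have e: "linear (?e b)" for b by (intro linear_complexify linear_coordinate)
  have spec: "complex_of_real (covariance M X v (coord b) (coord c)) = (\<integral>\<xi>. \<Sigma> \<xi> (?e b) (?e c) * cis_prod \<xi> v \<partial>lborel)" for v b c
    using covariance_spectral[OF assms(8) dens linear_coordinate linear_coordinate] assms(5) by simp
  have int: "integrable lborel (\<lambda>\<xi>. \<Sigma> \<xi> (?e b) (?e c))" for b c by (rule has_density_integrable[OF dens e e])
  define G where "G bs cs k \<xi> = \<Sigma> \<xi> (?e (bs ! k)) (?e (cs ! k))" for bs cs k \<xi>
  have p: "p = real (Suc n) / real n" if "n \<noteq> 0"
  proof -
    have "1 / p = 1 - 1 / real q" using assms(14) that q by simp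
    also have "\<dots> = real n / real (Suc n)" unfolding q by (simp add: field_simps)
    finally have "inverse p = inverse (real (Suc n) / real n)" by (simp add: divide_inverse)
    then show ?thesis by (rule inverse_eq_imp_eq)
  qed
  have Lp: "integrable lborel (\<lambda>\<xi>. norm (\<Sigma> \<xi> (?e b) (?e c)) powr (real (Suc n) / real n))" if "n \<noteq> 0" for b c
    using assms(16) that q e unfolding Lp_form_def p[OF that, symmetric] by auto
  have reg: "regular_family n (G bs cs)" for bs cs
  proof (cases "n = 0")
    case True
    then have C0: "C0_form \<Sigma>" using assms(17) q by simp
    then have "continuous_on UNIV (G bs cs 0)" "(G bs cs 0 \<longlongrightarrow> 0) at_infinity"
      using e unfolding C0_form_def G_def[abs_def] by blast+
    then show ?thesis
      using True C0_bounded[of "G bs cs 0"] int by (simp add: regular_family_def G_def[abs_def])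
  next
    case False
    then show ?thesis
      using Lp int by (simp add: regular_family_def G_def[abs_def])
  qed
  have limit: "((\<lambda>r. complex_of_real (variance (chaos_functional M X f q \<phi> r))) \<longlongrightarrow>
    1 / fact q * (\<Sum>bs\<in>multi_indices q. \<Sum>cs\<in>multi_indices q. of_real (F bs) * of_real (F cs) * hyperplane_conv n (G bs cs) 0)) at_top"
    unfolding F by (rule variance_limit[OF q assms(12) _ reg]) (simp add: G_def spec)
  \<comment> \<open>Exchanging the integral with the finite sums of \<open>tensor_hermitian\<close>
    requires every term to be integrable over the hyperplane, which
    \<open>regular_family_integrable\<close> provides.\<close>
  have hyper: "hyperplane_integral q (\<lambda>\<xi>. tensor_hermitian (\<lambda>k. \<Sigma> (\<xi> k)) q (\<lambda>ws. complex_of_real (F ws)) (\<lambda>ws. complex_of_real (F ws))) =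
    (\<Sum>bs\<in>multi_indices q. \<Sum>cs\<in>multi_indices q. of_real (F bs) * of_real (F cs) * hyperplane_conv n (G bs cs) 0)"
  proof -
    let ?P = "Pi\<^sub>M {..<n} (\<lambda>_. lborel :: 'v measure)"
    let ?x = "\<lambda>x. x(n := 0 - (\<Sum>i<n. x i))"
    have i: "integrable ?P (\<lambda>x. of_real (F bs) * of_real (F cs) * (\<Prod>j\<le>n. G bs cs j (?x x j)))" for bs cs
      by (intro integrable_mult_right regular_family_integrable[OF reg])
    have "hyperplane_integral q (\<lambda>\<xi>. tensor_hermitian (\<lambda>k. \<Sigma> (\<xi> k)) q (\<lambda>ws. complex_of_real (F ws)) (\<lambda>ws. complex_of_real (F ws))) =
        (\<integral>x. (\<Sum>bs\<in>multi_indices q. \<Sum>cs\<in>multi_indices q. of_real (F bs) * of_real (F cs) * (\<Prod>j\<le>n. G bs cs j (?x x j))) \<partial>?P)"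
      unfolding hyperplane_integral_def tensor_hermitian_def q lessThan_Suc_atMost G_def by simp
    also have "\<dots> = (\<Sum>bs\<in>multi_indices q. \<Sum>cs\<in>multi_indices q. \<integral>x. of_real (F bs) * of_real (F cs) * (\<Prod>j\<le>n. G bs cs j (?x x j)) \<partial>?P)"
      by (subst Bochner_Integration.integral_sum)
         (intro Bochner_Integration.integrable_sum i sum.cong refl Bochner_Integration.integral_sum)+
    finally show ?thesis by (simp only: integral_mult_right_zero hyperplane_conv_def)
  qed
  have "((\<lambda>r. complex_of_real (variance (chaos_functional M X f 1 \<phi> r))) \<longlongrightarrow>
      \<Sigma> 0 (complexify (\<lambda>w. F [w])) (complexify (\<lambda>w. F [w]))) at_top" if q1: "q = 1"
  proof -
    have n: "n = 0" using q q1 by simp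
    \<comment> \<open>\<open>hermitian_form_coordinates\<close> is available for linear functionals,
      so the coefficient of order one must be seen to be one.\<close>
    have "(\<lambda>w. F [w]) = (\<lambda>w. \<Sum>b\<in>Basis. F [b] * coord b w)"
      unfolding F by (rule ext, subst coeff_1[OF f]) (simp add: mult.commute)
    then have "linear (\<lambda>w. F [w])" by (simp only:) (intro linear_sum_mult linear_coordinate)
    from hermitian_form_coordinates[OF herm linear_complexify[OF this] linear_complexify[OF this], of 0]
    have "\<Sigma> 0 (complexify (\<lambda>w. F [w])) (complexify (\<lambda>w. F [w])) =
      1 / fact q * (\<Sum>bs\<in>multi_indices q. \<Sum>cs\<in>multi_indices q. of_real (F bs) * of_real (F cs) * hyperplane_conv n (G bs cs) 0)"
      by (simp add: q n sum_multi_indices_1 hyperplane_conv_0(1) G_def complexify_def)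
    with limit show ?thesis by (simp only: q1)
  qed
  moreover have "((\<lambda>r. complex_of_real (variance (chaos_functional M X f 2 \<phi> r))) \<longlongrightarrow>
      1 / 2 * (\<integral>\<xi>. mat_trace
         (dual_form_matrix es (\<Sigma> \<xi>) * bilinear_form_matrix es F *
          dual_form_matrix es (\<Sigma> \<xi>) * bilinear_form_matrix es F) \<partial>lborel)) at_top"
    if q2: "q = 2" and es: "basis_list es" for es :: "'w list"
  proof -
    have n: "n = 1" using q q2 by simp
    text \<open>The covariance is real, so it is also the Fourier transform of
      \<open>\<xi> \<mapsto> cnj (\<Sigma> (- \<xi>) l m) = \<Sigma> (- \<xi>) m l\<close>.\<close>
    define G' where "G' bs cs k \<xi> = (if k = 0 then \<Sigma> \<xi> (?e (bs ! k)) (?e (cs ! k)) else \<Sigma> (- \<xi>) (?e (cs ! k)) (?e (bs ! k)))"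
      for bs cs and k :: nat and \<xi>
    have reflect: "integrable lborel (\<lambda>\<xi>. h (- \<xi>))" if "integrable lborel h" for h :: "'v \<Rightarrow> 'z::{banach, second_countable_topology}"
      using integrable_lborel_affine[OF that, of "-1" 0] by simp
    have cov: "complex_of_real (covariance M X v (coord (bs ! k)) (coord (cs ! k))) = (\<integral>\<xi>. G' bs cs k \<xi> * cis_prod \<xi> v \<partial>lborel)"
      for bs cs k v
    proof (cases "k = 0")
      case True
      then show ?thesis by (simp add: G'_def spec)
    next
      case False
      let ?h = "\<lambda>\<xi>. cnj (\<Sigma> \<xi> (?e (bs ! k)) (?e (cs ! k)) * cis_prod \<xi> v)"
      have "complex_of_real (covariance M X v (coord (bs ! k)) (coord (cs ! k))) = cnj (of_real (covariance M X v (coord (bs ! k)) (coord (cs ! k))))"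
        by simp
      also have "\<dots> = (\<integral>\<xi>. ?h \<xi> \<partial>lborel)"
        unfolding spec by (rule integral_bounded_linear'[OF bounded_linear_cnj bounded_linear_cnj, symmetric]) simp
      also have "\<dots> = (\<integral>\<xi>. ?h (- \<xi>) \<partial>lborel)"
        using integral_lborel_affine[of "-1" ?h 0] by simp
      also have "\<dots> = (\<integral>\<xi>. G' bs cs k \<xi> * cis_prod \<xi> v \<partial>lborel)"
        using False by (simp add: G'_def hermitian_form_conj[OF herm e e, symmetric] exp_cnj)
      finally show ?thesis .
    qed
    have int': "integrable lborel (G' bs cs k)" for bs cs k
      unfolding G'_def[abs_def] using int reflect[OF int] by (cases "k = 0") simp_all
    have "integrable lborel (\<lambda>\<xi>. norm (G' bs cs k \<xi>) powr (real (Suc n) / real n))" for bs cs k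
    proof (cases "k = 0")
      case True
      then show ?thesis using Lp n by (simp add: G'_def)
    next
      case False
      then show ?thesis using reflect[OF Lp] n by (simp add: G'_def)
    qed
    then have reg': "regular_family n (G' bs cs)" for bs cs
      using n int' by (simp add: regular_family_def)
    have L2: "integrable lborel (\<lambda>\<xi>. (norm (\<Sigma> \<xi> (?e b) (?e c)))\<^sup>2)" for b c
      using Lp[of b c] n by (simp add: powr_numeral)
    have prod_int: "integrable lborel (\<lambda>\<xi>. \<Sigma> \<xi> (?e b) (?e c) * \<Sigma> \<xi> (?e c') (?e b'))" for b b' c c'
    proof (rule Bochner_Integration.integrable_bound[OF Bochner_Integration.integrable_add[OF L2[of b c] L2[of c' b']]])
      have "a * d \<le> \<bar>a\<^sup>2 + d\<^sup>2\<bar>" for a d :: real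
        by (rule order_trans[OF abs_ge_self abs_mult_le_abs_squares])
      then show "AE \<xi> in lborel. norm (\<Sigma> \<xi> (?e b) (?e c) * \<Sigma> \<xi> (?e c') (?e b')) \<le> norm ((norm (\<Sigma> \<xi> (?e b) (?e c)))\<^sup>2 + (norm (\<Sigma> \<xi> (?e c') (?e b')))\<^sup>2)"
        by (simp add: norm_mult)
    qed (use borel_measurable_integrable[OF int] in measurable)
    \<comment> \<open>At s = 0 the second frequency is -\<xi>, and the reflection built into
      \<open>G'\<close> turns it back into \<xi>; the exchanged arguments give the pattern of
      \<open>mat_trace_forms\<close>.\<close>
    have conv: "hyperplane_conv n (G' [b, b'] [c, c']) 0 = (\<integral>\<xi>. \<Sigma> \<xi> (?e b) (?e c) * \<Sigma> \<xi> (?e c') (?e b') \<partial>lborel)" for b b' c c'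
      unfolding n One_nat_def using borel_measurable_integrable[OF int']
      by (subst hyperplane_conv_1) (simp_all add: G'_def)
    have sym2: "F [x, y] = F [y, x]" for x y
      unfolding F by (rule chaos_coeff_symmetric) simp
    have bilin: "F [x, y] = (\<Sum>b\<in>Basis. \<Sum>c\<in>Basis. (x \<bullet> b) * (y \<bullet> c) * F [b, c])" for x y
      unfolding F by (rule coeff_2[OF f])
    have "(\<integral>\<xi>. mat_trace (dual_form_matrix es (\<Sigma> \<xi>) * bilinear_form_matrix es F * dual_form_matrix es (\<Sigma> \<xi>) * bilinear_form_matrix es F) \<partial>lborel) =
      (\<integral>\<xi>. (\<Sum>b\<in>Basis. \<Sum>b'\<in>Basis. \<Sum>c\<in>Basis. \<Sum>c'\<in>Basis. of_real (F [b, b']) * of_real (F [c, c']) *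
         (\<Sigma> \<xi> (?e b) (?e c) * \<Sigma> \<xi> (?e c') (?e b'))) \<partial>lborel)"
      by (intro Bochner_Integration.integral_cong refl mat_trace_forms[OF es herm sym2 bilin])
    also have "\<dots> = (\<Sum>b\<in>Basis. \<Sum>b'\<in>Basis. \<Sum>c\<in>Basis. \<Sum>c'\<in>Basis. of_real (F [b, b']) * of_real (F [c, c']) *
         hyperplane_conv n (G' [b, b'] [c, c']) 0)"
      unfolding conv by (simp add: prod_int)
    finally have trace: "(\<integral>\<xi>. mat_trace (dual_form_matrix es (\<Sigma> \<xi>) * bilinear_form_matrix es F * dual_form_matrix es (\<Sigma> \<xi>) * bilinear_form_matrix es F) \<partial>lborel) =
      (\<Sum>bs\<in>multi_indices q. \<Sum>cs\<in>multi_indices q. of_real (F bs) * of_real (F cs) * hyperplane_conv n (G' bs cs) 0)"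
      by (simp add: q n sum_multi_indices_2)
    \<comment> \<open>The limit is computed afresh with the family \<open>G'\<close>, rather than by
      transforming the integral over the hyperplane.\<close>
    have "((\<lambda>r. complex_of_real (variance (chaos_functional M X f q \<phi> r))) \<longlongrightarrow>
      1 / fact q * (\<Sum>bs\<in>multi_indices q. \<Sum>cs\<in>multi_indices q. of_real (F bs) * of_real (F cs) * hyperplane_conv n (G' bs cs) 0)) at_top"
      unfolding F by (rule variance_limit[OF q assms(12) cov reg'])
    then show ?thesis unfolding trace[symmetric] by (simp add: q2)
  qed
  ultimately show ?thesis using limit unfolding hyper by blast
qed

end
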